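(* Let $\mathbb{K}$ be a field, let $G$ be a simple graph with vertex set $V_G=\{1,\dots,\ell\}$ and edge set $E_G$, and let $\psi\colon V_G\to 2^{\mathbb{K}}$ be a map such that $\psi(i)$ is a finite subset of $\mathbb{K}$ for every $i\in V_G$. Let $\mathcal{A}_{G,\psi}$ be the associated $\psi$-graphical arrangement. Then the following conditions are equivalent: 1. $(G,\psi)$ has a weighted elimination ordering. 2. $\mathcal{A}_{G,\psi}$ is supersolvable. 3. $\mathcal{A}_{G,\psi}$ is free. 4. $G$ is chordal and contains neither of the following as an induced path: (i) an edge $\{v_1,v_2\}$ such that $\psi(v_1)$ and $\psi(v_2)$ are not comparable under inclusion; (ii) a path $v_1\cdots v_k$ with $k\ge 3$ and $\psi(v_1)\supsetneq\psi(v_2)=\dots=\psi(v_{k-1})\subsetneq\psi(v_k)$. 5. $G$ is chordal and every induced path of $G$ is unimodal with respect to $\psi$.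
   Context: Let $V$ be an $(\ell+1)$-dimensional vector space over $\mathbb{K}$ and $\{z,x_1,\dots,x_\ell\}$ a basis of the dual space $V^*$. For nonzero $\alpha\in V^*$, $\{\alpha=0\}$ denotes the hyperplane $\{v\in V\mid\alpha(v)=0\}$. A (central) arrangement in $V$ is a finite set of linear subspaces of codimension $1$. The $\psi$-graphical arrangement is $$\mathcal{A}_{G,\psi}=\{\{z=0\}\}\cup\{\{x_i-x_j=0\}\mid\{i,j\}\in E_G\}\cup\{\{x_i=az\}\mid 1\le i\le\ell,\ a\in\psi(i)\}.$$ The intersection lattice $L(\mathcal{A})$ of an arrangement $\mathcal{A}$ is the set of all intersections of hyperplanes in $\mathcal{A}$ (including the empty intersection $V$), ordered by reverse inclusion. $\mathcal{A}$ is supersolvable if $L(\mathcal{A})$ is a supersolvable lattice in the sense of Stanley (equivalently, for this geometric lattice, it has a maximal chain consisting of modular elements). Let $S$ be the symmetric algebra of $V^*$, identified with $\mathbb{K}[z,x_1,\dots,x_\ell]$, and $\operatorname{Der}(S)$ the $S$-module of $\mathbb{K}$-linear derivations $S\to S$. For $H\in\mathcal{A}$ let $\alpha_H$ be a linear form with kernel $H$. Put $D(\mathcal{A})=\{\theta\in\operatorname{Der}(S)\mid\theta(\alpha_H)\in\alpha_HS\text{ for all }H\in\mathcal{A}\}$. $\mathcal{A}$ is free if $D(\mathcal{A})$ is a free $S$-module. A graph is chordal if every cycle of length at least four has a chord (an edge not in the cycle joining two vertices of the cycle). A vertex is simplicial if the subgraph induced by its neighbors is complete. An ordering $(v_1,\dots,v_\ell)$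 of the vertices is a perfect elimination ordering if each $v_i$ is simplicial in the subgraph induced by $\{v_1,\dots,v_i\}$. A perfect elimination ordering $(v_1,\dots,v_\ell)$ of $G$ is a weighted elimination ordering of $(G,\psi)$ if $\psi(v_i)\supseteq\psi(v_j)$ whenever $i<j$ and $\{v_i,v_j\}\in E_G$. A path $v_1\cdots v_k$ in $G$ is unimodal if there exists $i\in\{1,\dots,k\}$ such that $\psi(v_1)\subseteq\dots\subseteq\psi(v_i)\supseteq\dots\supseteq\psi(v_k)$. A path is induced if it is an induced subgraph of $G$. *)

theory Defs
  imports
    "HOL-Analysis.Cartesian_Space"
    "HOL-Library.Poly_Mapping"
    "HOL-Library.Function_Algebras"
    "HOL-Library.Ramsey"
    "HOL-Algebra.Lattice"
begin

section \<open>Vertex-weighted graphs\<close>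

text \<open>A simple graph with vertex set \<open>V\<close> is given by its edge set \<open>E \<subseteq> nsets V 2\<close>; a path or a
  cycle is given by the list of its vertices.\<close>

definition induced_edges :: "'v set \<Rightarrow> 'v set set \<Rightarrow> 'v set set" where
  "induced_edges W E = {e \<in> E. e \<subseteq> W}"

definition simplicial :: "'v set set \<Rightarrow> 'v \<Rightarrow> bool" where
  "simplicial E v \<longleftrightarrow> clique {u. {u, v} \<in> E} E"

definition perfect_elimination_ordering :: "'v set \<Rightarrow> 'v set set \<Rightarrow> 'v list \<Rightarrow> bool" where
  "perfect_elimination_ordering V E vs \<longleftrightarrow> distinct vs \<and> set vs = V \<and>
     (\<forall>i < length vs. simplicial (induced_edges (set (take (Suc i) vs)) E) (vs ! i))"

definition weighted_elimination_ordering ::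
    "'v set \<Rightarrow> 'v set set \<Rightarrow> ('v \<Rightarrow> 'k set) \<Rightarrow> 'v list \<Rightarrow> bool" where
  "weighted_elimination_ordering V E \<psi> vs \<longleftrightarrow> perfect_elimination_ordering V E vs \<and>
     (\<forall>i j. i < j \<and> j < length vs \<and> {vs ! i, vs ! j} \<in> E \<longrightarrow> \<psi> (vs ! i) \<supseteq> \<psi> (vs ! j))"

definition cycle_edges :: "'v list \<Rightarrow> 'v set set" where
  "cycle_edges vs = {{vs ! i, vs ! (Suc i mod length vs)} | i. i < length vs}"

definition is_cycle :: "'v set set \<Rightarrow> 'v list \<Rightarrow> bool" where
  "is_cycle E vs \<longleftrightarrow> length vs \<ge> 3 \<and> distinct vs \<and> cycle_edges vs \<subseteq> E"

definition chordal :: "'v set set \<Rightarrow> bool" where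
  "chordal E \<longleftrightarrow> (\<forall>vs. is_cycle E vs \<and> length vs \<ge> 4 \<longrightarrow>
     (\<exists>u \<in> set vs. \<exists>v \<in> set vs. {u, v} \<in> E \<and> {u, v} \<notin> cycle_edges vs))"

definition path_edges :: "'v list \<Rightarrow> 'v set set" where
  "path_edges vs = {{vs ! i, vs ! Suc i} | i. Suc i < length vs}"

definition induced_path :: "'v set \<Rightarrow> 'v set set \<Rightarrow> 'v list \<Rightarrow> bool" where
  "induced_path V E vs \<longleftrightarrow> vs \<noteq> [] \<and> distinct vs \<and> set vs \<subseteq> V \<and>
     induced_edges (set vs) E = path_edges vs"

definition unimodal :: "('v \<Rightarrow> 'k set) \<Rightarrow> 'v list \<Rightarrow> bool" where
  "unimodal \<psi> vs \<longleftrightarrow> (\<exists>i < length vs.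
     (\<forall>j < i. \<psi> (vs ! j) \<subseteq> \<psi> (vs ! Suc j)) \<and>
     (\<forall>j. i \<le> j \<and> Suc j < length vs \<longrightarrow> \<psi> (vs ! j) \<supseteq> \<psi> (vs ! Suc j)))"

definition has_incomparable_edge :: "'v set \<Rightarrow> 'v set set \<Rightarrow> ('v \<Rightarrow> 'k set) \<Rightarrow> bool" where
  "has_incomparable_edge V E \<psi> \<longleftrightarrow>
     (\<exists>u v. induced_path V E [u, v] \<and> \<not> \<psi> u \<subseteq> \<psi> v \<and> \<not> \<psi> v \<subseteq> \<psi> u)"

text \<open>List positions count from 0: the inner vertices of a path \<open>vs\<close> with \<open>k\<close> vertices are
  \<open>vs ! 1, \<dots>, vs ! (k - 2)\<close>.\<close>

definition has_valley_path :: "'v set \<Rightarrow> 'v set set \<Rightarrow> ('v \<Rightarrow> 'k set) \<Rightarrow> bool" where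
  "has_valley_path V E \<psi> \<longleftrightarrow>
     (\<exists>vs. induced_path V E vs \<and> length vs \<ge> 3 \<and>
        \<psi> (vs ! 0) \<supset> \<psi> (vs ! 1) \<and>
        (\<forall>j. 1 \<le> j \<and> j \<le> length vs - 2 \<longrightarrow> \<psi> (vs ! j) = \<psi> (vs ! 1)) \<and>
        \<psi> (vs ! (length vs - 2)) \<subset> \<psi> (vs ! (length vs - 1)))"


section \<open>Supersolvable lattices\<close>

definition order_chain :: "('a, 'b) gorder_scheme \<Rightarrow> 'a set \<Rightarrow> bool" where
  "order_chain L C \<longleftrightarrow> C \<subseteq> carrier L \<and> (\<forall>x \<in> C. \<forall>y \<in> C. x \<sqsubseteq>\<^bsub>L\<^esub> y \<or> y \<sqsubseteq>\<^bsub>L\<^esub> x)"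

definition maximal_order_chain :: "('a, 'b) gorder_scheme \<Rightarrow> 'a set \<Rightarrow> bool" where
  "maximal_order_chain L C \<longleftrightarrow>
     order_chain L C \<and> (\<forall>C'. order_chain L C' \<and> C \<subseteq> C' \<longrightarrow> C' = C)"

inductive_set generated_sublattice :: "('a, 'b) gorder_scheme \<Rightarrow> 'a set \<Rightarrow> 'a set"
  for L :: "('a, 'b) gorder_scheme" and X :: "'a set" where
  generator: "x \<in> X \<Longrightarrow> x \<in> generated_sublattice L X"
| join: "x \<in> generated_sublattice L X \<Longrightarrow> y \<in> generated_sublattice L X \<Longrightarrow>
    x \<squnion>\<^bsub>L\<^esub> y \<in> generated_sublattice L X"
| meet: "x \<in> generated_sublattice L X \<Longrightarrow> y \<in> generated_sublattice L X \<Longrightarrow>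
    x \<sqinter>\<^bsub>L\<^esub> y \<in> generated_sublattice L X"

definition distributive_on :: "('a, 'b) gorder_scheme \<Rightarrow> 'a set \<Rightarrow> bool" where
  "distributive_on L M \<longleftrightarrow> (\<forall>x \<in> M. \<forall>y \<in> M. \<forall>w \<in> M.
     x \<sqinter>\<^bsub>L\<^esub> (y \<squnion>\<^bsub>L\<^esub> w) = (x \<sqinter>\<^bsub>L\<^esub> y) \<squnion>\<^bsub>L\<^esub> (x \<sqinter>\<^bsub>L\<^esub> w))"

text \<open>Stanley's definition: a finite lattice with a maximal chain that generates, together with
  any chain, a distributive sublattice.\<close>

definition supersolvable_lattice :: "('a, 'b) gorder_scheme \<Rightarrow> bool" where
  "supersolvable_lattice L \<longleftrightarrow> Lattice.lattice L \<and> finite (carrier L) \<and>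
     (\<exists>D. maximal_order_chain L D \<and>
        (\<forall>C. order_chain L C \<longrightarrow> distributive_on L (generated_sublattice L (C \<union> D))))"


section \<open>Arrangements of hyperplanes\<close>

text \<open>\<open>V\<close> is the coordinate space \<open>'k ^ 'm\<close>. A linear form on \<open>V\<close> is given by its vector of
  coefficients with respect to the coordinate functions.\<close>

definition form_kernel :: "'k::field ^ 'm \<Rightarrow> ('k ^ 'm) set" where
  "form_kernel \<alpha> = {v. scalar_product \<alpha> v = 0}"

definition intersection_lattice :: "('k ^ 'm) set set \<Rightarrow> ('k ^ 'm) set gorder" where
  "intersection_lattice \<A> =
     \<lparr>carrier = {\<Inter>\<B> | \<B>. \<B> \<subseteq> \<A>}, eq = (=), le = (\<lambda>X Y. Y \<subseteq> X)\<rparr>"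

definition supersolvable_arrangement :: "('k ^ 'm) set set \<Rightarrow> bool" where
  "supersolvable_arrangement \<A> \<longleftrightarrow> supersolvable_lattice (intersection_lattice \<A>)"

text \<open>The symmetric algebra of the dual of \<open>'k ^ 'm\<close>: polynomials over \<open>'k\<close> with one
  indeterminate for each element of \<open>'m\<close>.\<close>

type_synonym ('k, 'm) sym_alg = "('m \<Rightarrow>\<^sub>0 nat) \<Rightarrow>\<^sub>0 'k"

definition scalar_mult :: "'k::field \<Rightarrow> ('k, 'm) sym_alg \<Rightarrow> ('k, 'm) sym_alg" where
  "scalar_mult c p = Poly_Mapping.single 0 c * p"

definition form_poly :: "'k::field ^ 'm::finite \<Rightarrow> ('k, 'm) sym_alg" where
  "form_poly \<alpha> = (\<Sum>i\<in>UNIV. Poly_Mapping.single (Poly_Mapping.single i 1) (\<alpha> $ i))"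

definition derivation :: "(('k::field, 'm) sym_alg \<Rightarrow> ('k, 'm) sym_alg) \<Rightarrow> bool" where
  "derivation \<theta> \<longleftrightarrow> Vector_Spaces.linear scalar_mult scalar_mult \<theta> \<and>
     (\<forall>f g. \<theta> (f * g) = \<theta> f * g + f * \<theta> g)"

text \<open>A linear form with kernel \<open>H\<close> is unique only up to a nonzero scalar. All of them are
  quantified over, since the divisibility condition does not depend on the choice.\<close>

definition log_derivations ::
    "('k::field ^ 'm::finite) set set \<Rightarrow> (('k, 'm) sym_alg \<Rightarrow> ('k, 'm) sym_alg) set" where
  "log_derivations \<A> = {\<theta>. derivation \<theta> \<and>
     (\<forall>H \<in> \<A>. \<forall>\<alpha>. form_kernel \<alpha> = H \<longrightarrow> form_poly \<alpha> dvd \<theta> (form_poly \<alpha>))}"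

text \<open>The \<open>S\<close>-module of all maps from \<open>S\<close> to \<open>S\<close>, of which the derivations form a submodule.\<close>

interpretation S_mod: module
  "\<lambda>(p :: ('k::field, 'm) sym_alg) (\<theta> :: ('k, 'm) sym_alg \<Rightarrow> ('k, 'm) sym_alg) f. p * \<theta> f"
  by unfold_locales (auto simp: fun_eq_iff algebra_simps)

definition free_arrangement :: "('k::field ^ 'm::finite) set set \<Rightarrow> bool" where
  "free_arrangement \<A> \<longleftrightarrow>
     (\<exists>B. S_mod.independent B \<and> S_mod.span B = log_derivations \<A>)"

text \<open>The arguments \<open>z\<close> and \<open>x i\<close> are the positions in \<open>'m\<close> of the coordinate functions
  \<open>z\<close> and \<open>x\<^sub>i\<close>.\<close>

definition psi_graphical_arrangement ::
    "'m \<Rightarrow> ('v \<Rightarrow> 'm) \<Rightarrow> 'v set \<Rightarrow> 'v set set \<Rightarrow> ('v \<Rightarrow> 'k set) \<Rightarrow> ('k::field ^ 'm) set set" where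
  "psi_graphical_arrangement z x V E \<psi> =
     {{v. v $ z = 0}} \<union>
     {{v. v $ x i - v $ x j = 0} | i j. {i, j} \<in> E} \<union>
     {{v. v $ x i = a * v $ z} | i a. i \<in> V \<and> a \<in> \<psi> i}"

end

theory Submission
  imports Defs "HOL-Computational_Algebra.Polynomial"
begin

text \<open>
  The implications \<open>1 \<Longrightarrow> 2 \<Longrightarrow> 3 \<Longrightarrow> 4 \<Longrightarrow> 1\<close> are proved in a circle, and 4 is compared with 5
  by locating a lowest stretch on a path that is not unimodal (\<open>unimodal_induced_paths_iff\<close>).

  Supersolvability enters through \<^emph>\<open>modular rankings\<close>: functions \<open>\<rho>\<close> on the hyperplanes such that two
  distinct hyperplanes of equal rank meet inside a hyperplane of smaller rank, while no hyperplane
  contains the intersection of all hyperplanes of smaller rank. Such a ranking and a modular maximal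
  chain amount to the same. Given the chain, the rank of \<open>H\<close> counts the members of the chain
  that do not lie in \<open>H\<close> (\<open>modular_ranking_if_supersolvable\<close>). Given the ranking, the chain consists
  of the intersections of all hyperplanes of rank less than \<open>k\<close>
  (\<open>supersolvable_if_modular_ranking\<close>); Stanley's distributivity condition then holds
  because two chains of subspaces always have a common adapted basis (\<open>adapted_basis\<close>). For a
  \<open>\<psi>\<close>-graphical arrangement, ranking each hyperplane by the last vertex that it involves turns the
  first condition on \<open>\<rho>\<close> into the definition of a weighted elimination ordering:
  \<open>x\<^sub>i = x\<^sub>j\<close> and \<open>x\<^sub>i = x\<^sub>k\<close> meet inside \<open>x\<^sub>j = x\<^sub>k\<close>, \<open>x\<^sub>i = x\<^sub>j\<close> and \<open>x\<^sub>i = a z\<close> meet inside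
  \<open>x\<^sub>j = a z\<close>, and \<open>x\<^sub>i = a z\<close> and \<open>x\<^sub>i = b z\<close> meet inside \<open>z = 0\<close>.

  An arrangement with a modular ranking is free (\<open>free_if_modular_ranking\<close>). In coordinates
  adapted to the ranks, a logarithmic derivation for the hyperplanes of small rank is extended to the
  next rank by solving an interpolation problem (\<open>interpolation\<close>), and the extensions of the
  products of the forms of one rank are a triangular basis.

  For \<open>3 \<Longrightarrow> 4\<close>, let \<open>C\<close> be the cokernel of the map from \<open>Der(S)\<close> to the direct sum of the rings
  \<open>S/\<alpha>\<^sub>H S\<close> which sends \<open>\<theta>\<close> to the classes of \<open>\<theta>(\<alpha>\<^sub>H)\<close>. The kernel of this map is the module of
  logarithmic derivations; if it is free, then \<open>C\<close> has projective dimension at most 2, so no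
  nonzero element of \<open>C\<close> is annihilated by a regular sequence of length three. The lemma
  \<open>free_saturated\<close> proves this directly from the exactness of the Koszul complex. Each forbidden
  configuration produces an element of \<open>C\<close> that is annihilated by three such polynomials but is
  nonzero, even after localization at a flat: for chordless cycles and for paths whose two ends
  share a weight see \<open>not_free_circuit\<close>, for paths whose ends have weights that cross see
  \<open>not_free_crossing_path\<close>.

  For \<open>4 \<Longrightarrow> 1\<close> it suffices to find a simplicial vertex whose weight is contained in the weights
  of its neighbours, and to remove it. Take a connected component \<open>U\<close> of the set of vertices with
  some fixed minimal weight. Two nonadjacent neighbours of \<open>U\<close> would be joined through \<open>U\<close> by a
  forbidden valley path, so the neighbours of \<open>U\<close> form a clique, and Dirac's theorem provides a
  simplicial vertex inside \<open>U\<close> (\<open>weighted_simplicial_vertex\<close>).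
\<close>

section \<open>Polynomials and substitutions\<close>

lemma poly_mapping_as_sum_of_singles:
  "p = (\<Sum>m\<in>Poly_Mapping.keys p. Poly_Mapping.single m (Poly_Mapping.lookup p m))"
  by (rule poly_mapping_eqI) (auto simp: lookup_sum lookup_single when_def in_keys_iff sum.delta')

lemma poly_mapping_additive_induct [case_names single add]:
  assumes single: "\<And>m c. P (Poly_Mapping.single m c)"
    and add: "\<And>p q. P p \<Longrightarrow> P q \<Longrightarrow> P (p + q)"
  shows "P (p :: 'a \<Rightarrow>\<^sub>0 'b::comm_monoid_add)"
proof -
  have "P (\<Sum>m\<in>A. Poly_Mapping.single m (Poly_Mapping.lookup p m))" if "finite A" for A
    using that
  proof (induction A)
    case empty
    have "P (Poly_Mapping.single undefined 0)" by (rule single)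
    then show ?case by simp
  qed (auto intro: add single)
  then show ?thesis using poly_mapping_as_sum_of_singles[of p] by (metis finite_keys)
qed

abbreviation Const :: "'a::zero \<Rightarrow> ('i \<Rightarrow>\<^sub>0 nat) \<Rightarrow>\<^sub>0 'a" where
  "Const c \<equiv> Poly_Mapping.single 0 c"

definition Var :: "'i \<Rightarrow> ('i \<Rightarrow>\<^sub>0 nat) \<Rightarrow>\<^sub>0 'a::{zero,one}" where
  "Var i = Poly_Mapping.single (Poly_Mapping.single i 1) 1"

lemma Var_power:
  "Var i ^ n = (Poly_Mapping.single (Poly_Mapping.single i n) 1 :: ('i \<Rightarrow>\<^sub>0 nat) \<Rightarrow>\<^sub>0 'a::comm_ring_1)"
proof (induction n)
  case (Suc n)
  have "Poly_Mapping.single i 1 + Poly_Mapping.single i n = Poly_Mapping.single i (Suc n)"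
    by (simp flip: single_add)
  then show ?case unfolding power_Suc Suc unfolding Var_def mult_single by simp
qed simp

lemma prod_singles:
  "finite A \<Longrightarrow> (\<Prod>i\<in>A. Poly_Mapping.single (f i) (1 :: 'a::comm_ring_1)) =
    Poly_Mapping.single (\<Sum>i\<in>A. f i :: 'i \<Rightarrow>\<^sub>0 nat) 1"
  by (induction A rule: finite_induct) (auto simp: mult_single)

lemma single_as_product:
  "Poly_Mapping.single m (c :: 'a::comm_ring_1) =
    Const c * (\<Prod>i\<in>Poly_Mapping.keys m. Var i ^ Poly_Mapping.lookup m i)"
  by (simp add: Var_power prod_singles mult_single flip: poly_mapping_as_sum_of_singles)

lemma poly_algebra_induct [case_names Const Var add mult]:
  assumes C: "\<And>c. P (Const c)" and V: "\<And>i. P (Var i)"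
    and add: "\<And>p q. P p \<Longrightarrow> P q \<Longrightarrow> P (p + q)"
    and mult: "\<And>p q. P p \<Longrightarrow> P q \<Longrightarrow> P (p * q)"
  shows "P (p :: ('i \<Rightarrow>\<^sub>0 nat) \<Rightarrow>\<^sub>0 'a::comm_ring_1)"
proof (induction p rule: poly_mapping_additive_induct)
  case (single m c)
  have one: "P 1" using C[of 1] by simp
  have pow: "P (Var i ^ n)" for i n by (induction n) (auto simp: one V mult)
  have "P (\<Prod>i\<in>A. Var i ^ Poly_Mapping.lookup m i)" if "finite A" for A
    using that by (induction A) (auto simp: one pow mult)
  then show ?case unfolding single_as_product[of m c] by (intro mult C) auto
qed (rule add)

subsection \<open>Evaluation\<close>

definition poly_eval :: "('a \<Rightarrow> 'r) \<Rightarrow> ('i \<Rightarrow> 'r) \<Rightarrow> (('i \<Rightarrow>\<^sub>0 nat) \<Rightarrow>\<^sub>0 'a::comm_ring_1) \<Rightarrow> 'r::comm_ring_1" where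
  "poly_eval \<kappa> \<phi> p = (\<Sum>m\<in>Poly_Mapping.keys p.
     \<kappa> (Poly_Mapping.lookup p m) * (\<Prod>i\<in>Poly_Mapping.keys m. \<phi> i ^ Poly_Mapping.lookup m i))"

locale coefficient_hom =
  fixes \<kappa> :: "'a::comm_ring_1 \<Rightarrow> 'r::comm_ring_1"
  assumes hom_0: "\<kappa> 0 = 0" and hom_1: "\<kappa> 1 = 1"
    and hom_add: "\<kappa> (a + b) = \<kappa> a + \<kappa> b" and hom_mult: "\<kappa> (a * b) = \<kappa> a * \<kappa> b"
begin

lemma poly_eval_single:
  "poly_eval \<kappa> \<phi> (Poly_Mapping.single m c) =
    \<kappa> c * (\<Prod>i\<in>Poly_Mapping.keys m. \<phi> i ^ Poly_Mapping.lookup m i)"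
  by (cases "c = 0") (auto simp: poly_eval_def hom_0)

lemma poly_eval_superset:
  assumes "finite A" "Poly_Mapping.keys p \<subseteq> A"
  shows "poly_eval \<kappa> \<phi> p = (\<Sum>m\<in>A. \<kappa> (Poly_Mapping.lookup p m) *
    (\<Prod>i\<in>Poly_Mapping.keys m. \<phi> i ^ Poly_Mapping.lookup m i))"
  unfolding poly_eval_def using assms
  by (intro sum.mono_neutral_left) (auto simp: in_keys_iff hom_0)

lemma poly_eval_add: "poly_eval \<kappa> \<phi> (p + q) = poly_eval \<kappa> \<phi> p + poly_eval \<kappa> \<phi> q"
proof -
  let ?A = "Poly_Mapping.keys p \<union> Poly_Mapping.keys q"
  have "Poly_Mapping.keys (p + q) \<subseteq> ?A" by (rule keys_add)
  then show ?thesis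
    by (simp add: poly_eval_superset[of ?A] lookup_add hom_add algebra_simps sum.distrib)
qed

lemma monomial_add:
  fixes \<phi> :: "'i \<Rightarrow> 'r"
  shows "(\<Prod>i\<in>Poly_Mapping.keys (m + n). \<phi> i ^ Poly_Mapping.lookup (m + n) i) =
   (\<Prod>i\<in>Poly_Mapping.keys m. \<phi> i ^ Poly_Mapping.lookup m i) *
   (\<Prod>i\<in>Poly_Mapping.keys n. \<phi> i ^ Poly_Mapping.lookup n i)"
proof -
  let ?A = "Poly_Mapping.keys m \<union> Poly_Mapping.keys n"
  have *: "(\<Prod>i\<in>Poly_Mapping.keys k. \<phi> i ^ Poly_Mapping.lookup k i) =
      (\<Prod>i\<in>?A. \<phi> i ^ Poly_Mapping.lookup k i)" if "Poly_Mapping.keys k \<subseteq> ?A" for k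
    using that by (intro prod.mono_neutral_left) (auto simp: in_keys_iff)
  show ?thesis
    unfolding *[OF keys_add] *[of m, OF Un_upper1] *[of n, OF Un_upper2]
    by (simp add: lookup_add power_add prod.distrib)
qed

lemma poly_eval_mult: "poly_eval \<kappa> \<phi> (p * q) = poly_eval \<kappa> \<phi> p * poly_eval \<kappa> \<phi> q"
proof (induction p rule: poly_mapping_additive_induct)
  case (single m c)
  show ?case
    by (induction q rule: poly_mapping_additive_induct)
      (auto simp: mult_single poly_eval_single poly_eval_add monomial_add hom_mult algebra_simps)
qed (simp add: distrib_right poly_eval_add)

lemma poly_eval_Const: "poly_eval \<kappa> \<phi> (Const c) = \<kappa> c"
  by (simp add: poly_eval_single)

lemma poly_eval_Var: "poly_eval \<kappa> \<phi> (Var i) = \<phi> i"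
  by (simp add: Var_def poly_eval_single hom_1)

end

lemma coefficient_hom_Const:
  "coefficient_hom (Const :: 'a::comm_ring_1 \<Rightarrow> ('i \<Rightarrow>\<^sub>0 nat) \<Rightarrow>\<^sub>0 'a)"
  by unfold_locales (auto simp: single_add mult_single)

definition subst :: "('i \<Rightarrow> ('j \<Rightarrow>\<^sub>0 nat) \<Rightarrow>\<^sub>0 'a) \<Rightarrow> (('i \<Rightarrow>\<^sub>0 nat) \<Rightarrow>\<^sub>0 'a::comm_ring_1) \<Rightarrow> ('j \<Rightarrow>\<^sub>0 nat) \<Rightarrow>\<^sub>0 'a" where
  "subst = poly_eval Const"

lemma subst_Const [simp]: "subst \<phi> (Const c) = Const c"
  and subst_Var [simp]: "subst \<phi> (Var i) = \<phi> i"
  and subst_add [simp]: "subst \<phi> (p + q) = subst \<phi> p + subst \<phi> q"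
  and subst_mult [simp]: "subst \<phi> (p * q) = subst \<phi> p * subst \<phi> q"
  unfolding subst_def
  by (simp_all add: coefficient_hom.poly_eval_Const coefficient_hom.poly_eval_Var
      coefficient_hom.poly_eval_add coefficient_hom.poly_eval_mult coefficient_hom_Const)

lemma subst_0 [simp]: "subst \<phi> 0 = 0"
  using subst_Const[of \<phi> 0] by (simp del: subst_Const)

lemma subst_1 [simp]: "subst \<phi> 1 = 1"
  using subst_Const[of \<phi> 1] by (simp del: subst_Const)

lemma subst_uminus [simp]: "subst \<phi> (- p) = - subst \<phi> p"
  using subst_add[of \<phi> p "- p"] by (simp del: subst_add add: add_eq_0_iff)

lemma subst_diff [simp]: "subst \<phi> (p - q) = subst \<phi> p - subst \<phi> q"
  using subst_add[of \<phi> p "- q"] by (simp del: subst_add)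

lemma subst_sum [simp]: "subst \<phi> (sum f A) = (\<Sum>a\<in>A. subst \<phi> (f a))"
  by (induction A rule: infinite_finite_induct) auto

lemma subst_prod [simp]: "subst \<phi> (prod f A) = (\<Prod>a\<in>A. subst \<phi> (f a))"
  by (induction A rule: infinite_finite_induct) auto

lemma subst_subst: "subst \<phi> (subst \<theta> p) = subst (\<lambda>i. subst \<phi> (\<theta> i)) p"
  by (induction p rule: poly_algebra_induct) auto

lemma subst_ident [simp]: "subst Var p = p"
  by (induction p rule: poly_algebra_induct) auto

text \<open>Modulo \<open>d\<close> a substitution depends only on the classes of the polynomials that
  are substituted. With \<open>d = X\<^sub>i - t\<close> this says that a polynomial is
  congruent to the result of replacing \<open>X\<^sub>i\<close> by \<open>t\<close>.\<close>

lemma subst_cong_mod: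
  assumes "\<And>i. d dvd \<phi> i - \<theta> i"
  shows "d dvd subst \<phi> p - subst \<theta> p"
proof (induction p rule: poly_algebra_induct)
  case (add p q)
  then show ?case by (simp add: add_diff_add)
next
  case (mult p q)
  have "subst \<phi> p * subst \<phi> q - subst \<theta> p * subst \<theta> q =
      subst \<phi> p * (subst \<phi> q - subst \<theta> q) + (subst \<phi> p - subst \<theta> p) * subst \<theta> q"
    by (simp add: algebra_simps)
  with mult show ?case by simp
qed (use assms in auto)

text \<open>Polynomial rings over linearly ordered index types are integral domains, by comparing
  leading monomials. An arbitrary finite index type is embedded into the natural numbers.\<close>

lemma sym_alg_mult_eq_0:
  fixes p q :: "('k::field, 'm::finite) sym_alg"
  shows "p * q = 0 \<longleftrightarrow> p = 0 \<or> q = 0"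
proof
  obtain f :: "'m \<Rightarrow> nat" where f: "inj f"
    using finite_imp_inj_to_nat_seg[OF finite[of "UNIV :: 'm set"]] by blast
  let ?F = "subst (\<lambda>i. Var (f i)) :: ('k, 'm) sym_alg \<Rightarrow> ('k, nat) sym_alg"
  let ?G = "subst (\<lambda>n. Var (inv f n)) :: ('k, nat) sym_alg \<Rightarrow> ('k, 'm) sym_alg"
  have GF: "?G (?F r) = r" for r
    using f by (simp add: subst_subst)
  assume "p * q = 0"
  then have "?F p * ?F q = 0" by (simp flip: subst_mult)
  then have "?F p = 0 \<or> ?F q = 0" by simp
  then show "p = 0 \<or> q = 0" by (metis GF subst_0)
qed auto

section \<open>Linear forms\<close>

notation scalar_product (infixl "\<cdot>" 75)

lemma scalar_product_simps [simp]:
  fixes \<alpha> \<beta> :: "'k::field ^ 'm::finite"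
  shows "(\<alpha> + \<beta>) \<cdot> v = \<alpha> \<cdot> v + \<beta> \<cdot> v" "(\<alpha> - \<beta>) \<cdot> v = \<alpha> \<cdot> v - \<beta> \<cdot> v"
    "(- \<alpha>) \<cdot> v = - (\<alpha> \<cdot> v)" "(c *s \<alpha>) \<cdot> v = c * (\<alpha> \<cdot> v)"
    "v \<cdot> (\<alpha> + \<beta>) = v \<cdot> \<alpha> + v \<cdot> \<beta>" "v \<cdot> (\<alpha> - \<beta>) = v \<cdot> \<alpha> - v \<cdot> \<beta>"
    "v \<cdot> (- \<alpha>) = - (v \<cdot> \<alpha>)" "v \<cdot> (c *s \<alpha>) = c * (v \<cdot> \<alpha>)" "0 \<cdot> v = 0" "v \<cdot> 0 = 0"
  by (simp_all add: scalar_product_def algebra_simps sum.distrib sum_subtractf sum_negf sum_distrib_left)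

lemma scalar_product_axis [simp]:
  fixes v :: "'k::field ^ 'm::finite"
  shows "axis i c \<cdot> v = c * v $ i" "v \<cdot> axis i c = v $ i * c"
  by (simp_all add: scalar_product_def axis_def if_distrib if_distribR cong: if_cong)

lemma form_kernel_iff: "v \<in> form_kernel \<alpha> \<longleftrightarrow> \<alpha> \<cdot> v = 0"
  by (simp add: form_kernel_def)

lemma nonzero_form_value_1:
  fixes \<alpha> :: "'k::field ^ 'm::finite"
  assumes "\<alpha> \<noteq> 0" obtains p where "\<alpha> \<cdot> p = 1"
proof -
  obtain j where "\<alpha> $ j \<noteq> 0" using assms by (auto simp: vec_eq_iff)
  then have "\<alpha> \<cdot> axis j (1 / \<alpha> $ j) = 1" by simp
  then show thesis by (rule that)
qed

lemma form_eq_0I: "(\<And>v. \<alpha> \<cdot> v = 0) \<Longrightarrow> \<alpha> = (0 :: 'k::field ^ 'm::finite)"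
  by (metis nonzero_form_value_1 zero_neq_one)

text \<open>Subtracting from \<open>\<beta>\<close> its value at a point \<open>p\<close> with
  \<open>\<alpha>(p) = 1\<close>, times \<open>\<alpha>\<close>, leaves a form that vanishes
  on the kernel of \<open>\<alpha>\<close> and at \<open>p\<close>, hence everywhere.\<close>

lemma form_kernel_subsetD:
  fixes \<alpha> \<beta> :: "'k::field ^ 'm::finite"
  assumes "form_kernel \<alpha> \<subseteq> form_kernel \<beta>"
  shows "\<exists>t. \<beta> = t *s \<alpha>"
proof (cases "\<alpha> = 0")
  case True
  then have "\<beta> = 0" using assms by (intro form_eq_0I) (auto simp: form_kernel_def)
  then show ?thesis using True by simp
next
  case False
  then obtain p where p: "\<alpha> \<cdot> p = 1" by (rule nonzero_form_value_1)
  have "\<beta> - (\<beta> \<cdot> p) *s \<alpha> = 0"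
  proof (rule form_eq_0I)
    fix v
    have "v - (\<alpha> \<cdot> v) *s p \<in> form_kernel \<alpha>" using p by (simp add: form_kernel_iff)
    then have "v - (\<alpha> \<cdot> v) *s p \<in> form_kernel \<beta>" using assms by blast
    then have "\<beta> \<cdot> (v - (\<alpha> \<cdot> v) *s p) = 0" by (simp only: form_kernel_iff)
    then show "(\<beta> - (\<beta> \<cdot> p) *s \<alpha>) \<cdot> v = 0" by (simp add: algebra_simps)
  qed
  then show ?thesis by (intro exI[of _ "\<beta> \<cdot> p"]) simp
qed

lemma form_kernel_subset_eqD:
  fixes \<alpha> \<beta> :: "'k::field ^ 'm::finite"
  assumes "form_kernel \<alpha> \<subseteq> form_kernel \<beta>" "\<beta> \<noteq> 0"
  shows "form_kernel \<alpha> = form_kernel \<beta>"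
proof -
  obtain t where "\<beta> = t *s \<alpha>" using form_kernel_subsetD[OF assms(1)] by blast
  with assms(2) show ?thesis by (auto simp: form_kernel_def)
qed

text \<open>The restrictions of \<open>\<beta>\<close> and \<open>\<gamma>\<close> to the kernel of
  \<open>\<alpha>\<close> reduce this to the case of a single form.\<close>

lemma form_kernel_Int_subsetD:
  fixes \<alpha> \<beta> \<gamma> :: "'k::field ^ 'm::finite"
  assumes "form_kernel \<alpha> \<inter> form_kernel \<beta> \<subseteq> form_kernel \<gamma>"
  shows "\<exists>s t. \<gamma> = s *s \<alpha> + t *s \<beta>"
proof (cases "\<alpha> = 0")
  case True
  then have "form_kernel \<beta> \<subseteq> form_kernel \<gamma>" using assms by (auto simp: form_kernel_def)
  then obtain t where "\<gamma> = t *s \<beta>" using form_kernel_subsetD by blast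
  then show ?thesis using True by (intro exI[of _ 0] exI[of _ t]) simp
next
  case False
  then obtain p where p: "\<alpha> \<cdot> p = 1" by (rule nonzero_form_value_1)
  have "form_kernel (\<beta> - (\<beta> \<cdot> p) *s \<alpha>) \<subseteq> form_kernel (\<gamma> - (\<gamma> \<cdot> p) *s \<alpha>)"
  proof
    fix v assume "v \<in> form_kernel (\<beta> - (\<beta> \<cdot> p) *s \<alpha>)"
    then have "v - (\<alpha> \<cdot> v) *s p \<in> form_kernel \<alpha> \<inter> form_kernel \<beta>"
      using p by (auto simp: form_kernel_iff algebra_simps)
    then have "v - (\<alpha> \<cdot> v) *s p \<in> form_kernel \<gamma>" using assms by blast
    then have "\<gamma> \<cdot> (v - (\<alpha> \<cdot> v) *s p) = 0" by (simp only: form_kernel_iff)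
    then show "v \<in> form_kernel (\<gamma> - (\<gamma> \<cdot> p) *s \<alpha>)" by (simp add: form_kernel_iff algebra_simps)
  qed
  then obtain t where "\<gamma> - (\<gamma> \<cdot> p) *s \<alpha> = t *s (\<beta> - (\<beta> \<cdot> p) *s \<alpha>)"
    using form_kernel_subsetD by blast
  then have "\<gamma> = (\<gamma> \<cdot> p - t * (\<beta> \<cdot> p)) *s \<alpha> + t *s \<beta>"
    by (simp add: vec_eq_iff algebra_simps)
  then show ?thesis by blast
qed

section \<open>Linear forms in the symmetric algebra\<close>

text \<open>A derivation is determined by its values \<open>g i\<close> at the indeterminates. On linear
  forms it is the \<open>K\<close>-linear map \<open>lin_ext g\<close>; substitutions have the
  same description.\<close>

definition lin_ext :: "('m \<Rightarrow> ('k, 'n) sym_alg) \<Rightarrow> 'k::field ^ 'm::finite \<Rightarrow> ('k, 'n) sym_alg" where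
  "lin_ext g \<alpha> = (\<Sum>i\<in>UNIV. Const (\<alpha> $ i) * g i)"

lemma lin_ext_simps [simp]:
  "lin_ext g (\<alpha> + \<beta>) = lin_ext g \<alpha> + lin_ext g \<beta>" "lin_ext g (\<alpha> - \<beta>) = lin_ext g \<alpha> - lin_ext g \<beta>"
  "lin_ext g (- \<alpha>) = - lin_ext g \<alpha>" "lin_ext g (c *s \<alpha>) = Const c * lin_ext g \<alpha>" "lin_ext g 0 = 0"
  by (simp_all add: lin_ext_def algebra_simps sum.distrib sum_subtractf sum_negf sum_distrib_left
      single_add single_diff single_uminus mult_single flip: mult.assoc)

lemma lin_ext_axis [simp]: "lin_ext g (axis i c) = Const c * g i"
proof -
  have "lin_ext g (axis i c) = (\<Sum>j\<in>UNIV. if j = i then Const c * g i else 0)"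
    unfolding lin_ext_def by (intro sum.cong) (auto simp: axis_def)
  then show ?thesis by simp
qed

lemma lin_ext_comb:
  "lin_ext (\<lambda>i. a * g i + b * h i) \<alpha> = a * lin_ext g \<alpha> + b * lin_ext h \<alpha>"
  by (simp add: lin_ext_def sum.distrib sum_distrib_left algebra_simps)

lemma form_poly_lin_ext: "form_poly \<alpha> = lin_ext Var \<alpha>"
  by (simp add: form_poly_def lin_ext_def Var_def mult_single)

lemma form_poly_simps [simp]:
  "form_poly (\<alpha> + \<beta>) = form_poly \<alpha> + form_poly \<beta>" "form_poly (\<alpha> - \<beta>) = form_poly \<alpha> - form_poly \<beta>"
  "form_poly (- \<alpha>) = - form_poly \<alpha>" "form_poly (c *s \<alpha>) = Const c * form_poly \<alpha>" "form_poly 0 = 0"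
  "form_poly (axis i c) = Const c * Var i"
  by (simp_all add: form_poly_lin_ext)

lemma subst_form_poly: "subst \<phi> (form_poly \<alpha>) = lin_ext \<phi> \<alpha>"
  by (simp add: form_poly_lin_ext lin_ext_def)

lemma single_index_eq_iff:
  "Poly_Mapping.single i (1 :: nat) = Poly_Mapping.single j 1 \<longleftrightarrow> i = j"
  by (metis keys_single singleton_inject zero_neq_one)

lemma form_poly_eq_0 [simp]: "form_poly \<alpha> = 0 \<longleftrightarrow> \<alpha> = 0"
proof
  assume 0: "form_poly \<alpha> = 0"
  have "\<alpha> $ j = 0" for j
  proof -
    have "Poly_Mapping.lookup (form_poly \<alpha>) (Poly_Mapping.single j 1) =
        (\<Sum>i\<in>UNIV. if i = j then \<alpha> $ i else 0)"
      unfolding form_poly_def lookup_sum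
      by (intro sum.cong) (auto simp: lookup_single when_def single_index_eq_iff simp del: One_nat_def)
    then show ?thesis by (simp add: 0)
  qed
  then show "\<alpha> = 0" by (simp add: vec_eq_iff)
qed simp

text \<open>Restriction of polynomials to the kernel of \<open>\<alpha>\<close>, pulled back along the projection with direction \<open>p\<close>.\<close>

definition restr :: "'k::field ^ 'm::finite \<Rightarrow> 'k ^ 'm \<Rightarrow> ('k, 'm) sym_alg \<Rightarrow> ('k, 'm) sym_alg" where
  "restr \<alpha> p = subst (\<lambda>i. form_poly (axis i 1 - (p $ i) *s \<alpha>))"

lemma restr_form_poly:
  fixes \<alpha> :: "'k::field ^ 'm::finite"
  shows "restr \<alpha> p (form_poly \<beta>) = form_poly (\<beta> - (\<beta> \<cdot> p) *s \<alpha>)"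
proof -
  have "restr \<alpha> p (form_poly \<beta>) = (\<Sum>i\<in>UNIV. Const (\<beta> $ i) * Var i - Const (\<beta> $ i * p $ i) * form_poly \<alpha>)"
    unfolding restr_def subst_form_poly lin_ext_def
    by (simp add: algebra_simps mult_single flip: mult.assoc)
  also have "\<dots> = form_poly \<beta> - (\<Sum>i\<in>UNIV. Const (\<beta> $ i * p $ i)) * form_poly \<alpha>"
    by (simp add: form_poly_lin_ext lin_ext_def sum_subtractf sum_distrib_right)
  also have "(\<Sum>i\<in>UNIV. Const (\<beta> $ i * p $ i)) = (Const (\<beta> \<cdot> p) :: ('k, 'm) sym_alg)"
    unfolding scalar_product_def by (induction rule: infinite_finite_induct) (auto simp: single_add)
  finally show ?thesis by simp
qed

lemma form_poly_dvd_diff_restr: "form_poly \<alpha> dvd f - restr \<alpha> p f"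
  using subst_cong_mod[of "form_poly \<alpha>" Var "\<lambda>i. form_poly (axis i 1 - (p $ i) *s \<alpha>)" f]
  by (simp add: restr_def)

lemma form_poly_dvd_iff_restr:
  assumes "\<alpha> \<cdot> p = 1"
  shows "form_poly \<alpha> dvd f \<longleftrightarrow> restr \<alpha> p f = 0"
proof
  assume "form_poly \<alpha> dvd f"
  then obtain q where "f = form_poly \<alpha> * q" by blast
  then have "restr \<alpha> p f = restr \<alpha> p (form_poly \<alpha>) * restr \<alpha> p q" by (simp add: restr_def)
  then show "restr \<alpha> p f = 0" using assms by (simp add: restr_form_poly)
next
  assume "restr \<alpha> p f = 0"
  then show "form_poly \<alpha> dvd f" using form_poly_dvd_diff_restr[of \<alpha> f p] by simp
qed

text \<open>A linear form divides exactly the polynomials in the kernel of a ring endomorphism of the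
  integral domain \<open>S\<close>.\<close>

lemma prime_elem_form_poly:
  assumes "\<alpha> \<noteq> 0" shows "prime_elem (form_poly \<alpha>)"
proof -
  obtain p where p: "\<alpha> \<cdot> p = 1" using assms by (rule nonzero_form_value_1)
  show ?thesis
    using assms by (auto simp: prime_elem_def form_poly_dvd_iff_restr[OF p] sym_alg_mult_eq_0 restr_def)
qed

lemma form_poly_dvd_form_poly_iff:
  assumes "\<alpha> \<noteq> 0" shows "form_poly \<alpha> dvd form_poly \<beta> \<longleftrightarrow> (\<exists>t. \<beta> = t *s \<alpha>)"
proof
  obtain p where p: "\<alpha> \<cdot> p = 1" using assms by (rule nonzero_form_value_1)
  assume "form_poly \<alpha> dvd form_poly \<beta>"
  then have "form_poly (\<beta> - (\<beta> \<cdot> p) *s \<alpha>) = 0" by (simp only: form_poly_dvd_iff_restr[OF p] restr_form_poly)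
  then have "\<beta> - (\<beta> \<cdot> p) *s \<alpha> = 0" by (simp only: form_poly_eq_0)
  then show "\<exists>t. \<beta> = t *s \<alpha>" by (intro exI[of _ "\<beta> \<cdot> p"]) simp
qed auto

lemma sym_alg_mult_dvd_cancel:
  fixes p q r :: "('k::field, 'm::finite) sym_alg"
  assumes "r \<noteq> 0" shows "r * p dvd r * q \<longleftrightarrow> p dvd q"
proof
  assume "r * p dvd r * q"
  then obtain s where "r * q = r * p * s" by blast
  then have "r * (q - p * s) = 0" by (simp add: algebra_simps)
  then have "q - p * s = 0" using assms by (simp only: sym_alg_mult_eq_0) simp
  then show "p dvd q" by (intro dvdI[of _ _ s]) simp
qed (simp add: mult_dvd_mono)

lemma prod_primes_dvd_cofactor:
  fixes Q R :: "('k::field, 'm::finite) sym_alg"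
  assumes "finite A" "\<And>a. a \<in> A \<Longrightarrow> prime_elem (f a)" "\<And>a. a \<in> A \<Longrightarrow> \<not> f a dvd Q"
    and "(\<Prod>a\<in>A. f a) dvd Q * R"
  shows "(\<Prod>a\<in>A. f a) dvd R"
  using assms
proof (induction A rule: finite_induct)
  case (insert a A)
  let ?P = "\<Prod>a\<in>A. f a"
  have P0: "?P \<noteq> 0"
  proof
    assume "?P = 0"
    moreover have nz: "f a \<noteq> 0" if "a \<in> A" for a
      using insert.prems(1)[of a] that by auto
    have "(\<Prod>a\<in>B. f a) \<noteq> 0" if "finite B" "B \<subseteq> A" for B
      using that by (induction B rule: finite_induct) (auto simp: sym_alg_mult_eq_0 nz)
    ultimately show False using insert.hyps by blast
  qed
  have "?P dvd R" using insert by (auto intro!: insert.IH elim: dvd_mult_right)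
  then obtain R' where R': "R = ?P * R'" by blast
  have "?P * f a dvd ?P * (Q * R')" using insert.prems(3) insert.hyps by (simp add: R' algebra_simps)
  then have "f a dvd Q * R'" by (simp only: sym_alg_mult_dvd_cancel[OF P0])
  then have "f a dvd R'" using insert.prems(1,2) by (auto simp: prime_elem_dvd_mult_iff)
  then show ?case using insert.hyps P0 by (simp add: R' mult.commute[of _ "?P"] sym_alg_mult_dvd_cancel)
qed simp

lemma prime_elem_dvd_prodD:
  "finite A \<Longrightarrow> prime_elem p \<Longrightarrow> p dvd prod f A \<Longrightarrow> \<exists>a\<in>A. p dvd (f a :: 'a::comm_semiring_1)"
  by (induction A rule: finite_induct) (auto simp: prime_elem_dvd_mult_iff dest: prime_elem_not_unit)

text \<open>Nonproportional linear forms are nonassociated primes, so a product of linear forms divides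
  \<open>R\<close> as soon as, for each class of proportional factors, the product over this
  class does.\<close>

lemma prod_form_poly_dvd_classwise:
  fixes f :: "'b \<Rightarrow> 'k::field ^ 'm::finite"
  assumes "finite A" "\<And>a. a \<in> A \<Longrightarrow> f a \<noteq> 0"
    and "\<And>a. a \<in> A \<Longrightarrow> (\<Prod>b\<in>{b\<in>A. \<exists>t. f b = t *s f a}. form_poly (f b)) dvd R"
  shows "(\<Prod>a\<in>A. form_poly (f a)) dvd R"
  using assms
proof (induction "card A" arbitrary: A R rule: less_induct)
  case less
  show ?case
  proof (cases "A = {}")
    case False
    then obtain a where a: "a \<in> A" by blast
    let ?A1 = "{b\<in>A. \<exists>t. f b = t *s f a}" and ?A2 = "{b\<in>A. \<nexists>t. f b = t *s f a}"
    have same_class: "{c\<in>?A2. \<exists>t. f c = t *s f b} = {c\<in>A. \<exists>t. f c = t *s f b}" if b: "b \<in> ?A2" for b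
    proof -
      have False if c: "f c = t *s f b" "f c = u *s f a" "c \<in> A" for c t u
      proof -
        have "t \<noteq> 0" using c less.prems(2) by auto
        then have "f b = (u / t) *s f a" using c by (simp add: vec_eq_iff field_simps)
        then show False using b by blast
      qed
      then show ?thesis by blast
    qed
    have "(\<Prod>b\<in>?A2. form_poly (f b)) dvd R"
    proof (rule less.hyps)
      show "card ?A2 < card A"
      proof (rule psubset_card_mono)
        have "f a = 1 *s f a" by simp
        then have "a \<notin> ?A2" by blast
        with a show "?A2 \<subset> A" by blast
      qed (rule less.prems(1))
    qed (use less.prems same_class in auto)
    then obtain R' where R': "R = (\<Prod>b\<in>?A2. form_poly (f b)) * R'" by blast
    have "(\<Prod>b\<in>?A1. form_poly (f b)) dvd R'"
    proof (rule prod_primes_dvd_cofactor)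
      show "\<not> form_poly (f b) dvd (\<Prod>b\<in>?A2. form_poly (f b))" if b: "b \<in> ?A1" for b
      proof
        assume "form_poly (f b) dvd (\<Prod>b\<in>?A2. form_poly (f b))"
        moreover have "finite ?A2" using less.prems(1) by simp
        ultimately obtain c where c: "c \<in> ?A2" "form_poly (f b) dvd form_poly (f c)"
          using b less.prems(2) prime_elem_dvd_prodD[OF _ prime_elem_form_poly] by blast
        then obtain t where "f c = t *s f b"
          using b less.prems(2) by (auto simp: form_poly_dvd_form_poly_iff)
        moreover obtain u where "f b = u *s f a" using b by blast
        ultimately have "f c = (t * u) *s f a" by simp
        then show False using c by blast
      qed
      show "(\<Prod>b\<in>?A1. form_poly (f b)) dvd (\<Prod>b\<in>?A2. form_poly (f b)) * R'"
        using less.prems(3)[OF a] by (simp add: R')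
    qed (use less.prems prime_elem_form_poly in auto)
    then have "(\<Prod>b\<in>?A2. form_poly (f b)) * (\<Prod>b\<in>?A1. form_poly (f b)) dvd R"
      by (simp add: R' mult_dvd_mono)
    moreover have "(\<Prod>b\<in>A. form_poly (f b)) = (\<Prod>b\<in>?A2 \<union> ?A1. form_poly (f b))"
      by (intro prod.cong) auto
    moreover have "(\<Prod>b\<in>?A2 \<union> ?A1. form_poly (f b)) =
        (\<Prod>b\<in>?A2. form_poly (f b)) * (\<Prod>b\<in>?A1. form_poly (f b))"
      using less.prems(1) by (intro prod.union_disjoint) auto
    ultimately show ?thesis by simp
  qed simp
qed

section \<open>Derivations\<close>

text \<open>Evaluation at the points \<open>X\<^sub>i + t g\<^sub>i\<close>. The coefficient of
  \<open>t\<close> is the derivation with the values \<open>g\<^sub>i\<close>, and the product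
  rule becomes the multiplicativity of evaluation.\<close>

definition dual_eval :: "('m \<Rightarrow> ('k, 'm) sym_alg) \<Rightarrow> ('k::field, 'm) sym_alg \<Rightarrow> ('k, 'm) sym_alg poly" where
  "dual_eval g = poly_eval (\<lambda>c. [:Const c:]) (\<lambda>i. [:Var i, g i:])"

definition der :: "('m \<Rightarrow> ('k, 'm) sym_alg) \<Rightarrow> ('k::field, 'm) sym_alg \<Rightarrow> ('k, 'm) sym_alg" where
  "der g f = coeff (dual_eval g f) 1"

lemma coefficient_hom_dual:
  "coefficient_hom (\<lambda>c :: 'k::field. [:Const c :: ('k, 'm) sym_alg:])"
  by unfold_locales (auto simp: single_add mult_single one_pCons mult.commute)

lemma dual_eval_simps:
  "dual_eval g (Const c) = [:Const c:]" "dual_eval g (Var i) = [:Var i, g i:]"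
  "dual_eval g (p + q) = dual_eval g p + dual_eval g q"
  "dual_eval g (p * q) = dual_eval g p * dual_eval g q"
  by (simp_all only: dual_eval_def coefficient_hom.poly_eval_Const[OF coefficient_hom_dual]
      coefficient_hom.poly_eval_Var[OF coefficient_hom_dual]
      coefficient_hom.poly_eval_add[OF coefficient_hom_dual]
      coefficient_hom.poly_eval_mult[OF coefficient_hom_dual])

lemma coeff_0_dual_eval: "coeff (dual_eval g p) 0 = p"
  by (induction p rule: poly_algebra_induct) (auto simp: dual_eval_simps coeff_mult_0)

lemma der_Const [simp]: "der g (Const c) = 0"
  and der_Var [simp]: "der g (Var i) = g i"
  and der_add [simp]: "der g (p + q) = der g p + der g q"
  and der_mult: "der g (p * q) = der g p * q + p * der g q"
  by (simp_all add: der_def dual_eval_simps coeff_mult coeff_0_dual_eval algebra_simps)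

lemma der_zero [simp]: "der g 0 = 0"
  using der_Const[of g 0] by (simp del: der_Const)

lemma vector_space_scalar_mult: "vector_space (scalar_mult :: 'k::field \<Rightarrow> ('k, 'm) sym_alg \<Rightarrow> _)"
  by unfold_locales (auto simp: scalar_mult_def algebra_simps single_add mult_single simp flip: mult.assoc)

lemma derivation_iff:
  "derivation \<theta> \<longleftrightarrow> (\<forall>p q. \<theta> (p + q) = \<theta> p + \<theta> q) \<and> (\<forall>c. \<theta> (Const c) = 0) \<and>
    (\<forall>p q. \<theta> (p * q) = \<theta> p * q + p * \<theta> q)"
  (is "_ \<longleftrightarrow> ?rhs")
proof
  assume d: "derivation \<theta>"
  have "\<theta> 1 = \<theta> (1 * 1)" by simp
  also have "\<dots> = \<theta> 1 * 1 + 1 * \<theta> 1" using d unfolding derivation_def by blast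
  finally have "\<theta> 1 = 0" by simp
  moreover have "\<theta> (scalar_mult c 1) = scalar_mult c (\<theta> 1)" for c
    using d unfolding derivation_def Vector_Spaces.linear_iff by blast
  then have "\<theta> (Const c * 1) = Const c * \<theta> 1" for c
    by (simp add: scalar_mult_def)
  ultimately show ?rhs using d by (simp add: derivation_def Vector_Spaces.linear_iff)
next
  assume ?rhs
  then show "derivation \<theta>"
    by (simp add: derivation_def Vector_Spaces.linear_iff vector_space_scalar_mult) (simp add: scalar_mult_def)
qed

lemma derivation_der: "derivation (der g)"
  by (simp add: derivation_iff der_mult)

lemma derivation_eq_der:
  assumes "derivation \<theta>" shows "\<theta> = der (\<lambda>i. \<theta> (Var i))"
proof
  fix p
  show "\<theta> p = der (\<lambda>i. \<theta> (Var i)) p"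
    using assms by (induction p rule: poly_algebra_induct) (auto simp: derivation_iff der_mult)
qed

lemma der_form_poly: "der g (form_poly \<alpha>) = lin_ext g \<alpha>"
proof -
  have "der g (\<Sum>i\<in>A. Const (\<alpha> $ i) * Var i) = (\<Sum>i\<in>A. Const (\<alpha> $ i) * g i)" for A
    by (induction A rule: infinite_finite_induct) (auto simp: der_mult der_zero)
  then show ?thesis by (simp add: form_poly_lin_ext lin_ext_def)
qed

lemma der_comb: "der (\<lambda>i. a * g i + b * h i) p = a * der g p + b * der h p"
  by (induction p rule: poly_algebra_induct) (auto simp: der_mult algebra_simps)

lemma der_0 [simp]: "der (\<lambda>i. 0) p = 0"
  by (induction p rule: poly_algebra_induct) (auto simp: der_mult)

definition log_fields :: "('k::field ^ 'm::finite) set \<Rightarrow> ('m \<Rightarrow> ('k, 'm) sym_alg) set" where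
  "log_fields \<Phi> = {g. \<forall>\<alpha>\<in>\<Phi>. form_poly \<alpha> dvd lin_ext g \<alpha>}"

text \<open>Two nonzero forms with the same kernel are proportional by a unit, so one defining form for
  each hyperplane decides whether a derivation is logarithmic.\<close>

lemma log_derivations_eq_der_log_fields:
  assumes "0 \<notin> \<Phi>"
  shows "log_derivations (form_kernel ` \<Phi>) = der ` log_fields \<Phi>"
proof (intro equalityI subsetI)
  fix \<theta> assume \<theta>: "\<theta> \<in> log_derivations (form_kernel ` \<Phi>)"
  then have "\<theta> = der (\<lambda>i. \<theta> (Var i))" by (intro derivation_eq_der) (simp add: log_derivations_def)
  moreover from this have "(\<lambda>i. \<theta> (Var i)) \<in> log_fields \<Phi>"
    using \<theta> unfolding log_derivations_def log_fields_def by (simp flip: der_form_poly)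
  ultimately show "\<theta> \<in> der ` log_fields \<Phi>" by blast
next
  fix \<theta> assume "\<theta> \<in> der ` log_fields \<Phi>"
  then obtain g where g: "\<theta> = der g" "g \<in> log_fields \<Phi>" by blast
  have "form_poly \<beta> dvd \<theta> (form_poly \<beta>)" if \<alpha>: "\<alpha> \<in> \<Phi>" "form_kernel \<beta> = form_kernel \<alpha>" for \<alpha> \<beta>
  proof -
    obtain t where t: "\<alpha> = t *s \<beta>" using form_kernel_subsetD[of \<beta> \<alpha>] \<alpha> by auto
    with assms \<alpha> have "t \<noteq> 0" by auto
    moreover have "form_poly \<alpha> dvd lin_ext g \<alpha>" using g \<alpha> by (simp add: log_fields_def)
    moreover from this have "Const t \<noteq> (0 :: ('a, 'b) sym_alg)"
      using \<open>t \<noteq> 0\<close> by (metis lookup_single_eq lookup_zero)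
    ultimately show ?thesis
      unfolding g t der_form_poly lin_ext_simps form_poly_simps by (simp add: sym_alg_mult_dvd_cancel)
  qed
  then show "\<theta> \<in> log_derivations (form_kernel ` \<Phi>)"
    by (auto simp: log_derivations_def g(1) derivation_der)
qed

section \<open>Free arrangements\<close>

lemma sum_fun_apply: "(\<Sum>a\<in>A. f a) x = (\<Sum>a\<in>A. f a x :: 'b::comm_monoid_add)"
  by (induction A rule: infinite_finite_induct) auto

lemma lin_ext_sum:
  "lin_ext (\<lambda>i. \<Sum>k\<in>A. u k * g k i) \<alpha> = (\<Sum>k\<in>A. u k * lin_ext (g k) \<alpha>)"
proof (induction A rule: infinite_finite_induct)
  case (insert k A)
  then show ?case using lin_ext_comb[of "u k" "g k" 1 "\<lambda>i. \<Sum>k\<in>A. u k * g k i" \<alpha>] by simp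
qed (auto simp: lin_ext_def)

lemma der_sum:
  "der (\<lambda>i. \<Sum>k\<in>A. u k * g k i) p = (\<Sum>k\<in>A. u k * der (g k) p)"
proof (induction A rule: infinite_finite_induct)
  case (insert k A)
  then show ?case using der_comb[of "u k" "g k" 1 "\<lambda>i. \<Sum>k\<in>A. u k * g k i" p] by simp
qed auto

lemma log_fields_sum:
  "(\<And>k. k \<in> A \<Longrightarrow> g k \<in> log_fields \<Phi>) \<Longrightarrow> (\<lambda>i. \<Sum>k\<in>A. u k * g k i) \<in> log_fields \<Phi>"
  by (auto simp: log_fields_def lin_ext_sum intro!: dvd_sum dvd_mult)

lemma free_arrangementI:
  fixes \<theta> :: "nat \<Rightarrow> 'm::finite \<Rightarrow> ('k::field, 'm) sym_alg"
  assumes nz: "0 \<notin> \<Phi>" and mem: "\<And>k. k < n \<Longrightarrow> \<theta> k \<in> log_fields \<Phi>"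
    and span: "\<And>g. g \<in> log_fields \<Phi> \<Longrightarrow> \<exists>u. g = (\<lambda>i. \<Sum>k<n. u k * \<theta> k i)"
    and indep: "\<And>u. (\<And>i. (\<Sum>k<n. u k * \<theta> k i) = 0) \<Longrightarrow> \<forall>k<n. u k = 0"
  shows "free_arrangement (form_kernel ` \<Phi>)"
proof -
  define B where "B = (\<lambda>k. der (\<theta> k)) ` {..<n}"
  have inj: "inj_on (\<lambda>k. der (\<theta> k)) {..<n}"
  proof (rule inj_onI, rule ccontr)
    fix j k assume jk: "j \<in> {..<n}" "k \<in> {..<n}" "der (\<theta> j) = der (\<theta> k)" "j \<noteq> k"
    have eq: "\<theta> j i = \<theta> k i" for i using jk(3) by (metis der_Var)
    let ?u = "\<lambda>l. (if l = j then 1 else 0) - (if l = k then 1 else 0) :: ('k, 'm) sym_alg"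
    have "(\<Sum>l<n. ?u l * \<theta> l i) = 0" for i
    proof -
      have "(\<Sum>l<n. ?u l * \<theta> l i) =
          (\<Sum>l<n. (if l = j then \<theta> j i else 0) - (if l = k then \<theta> k i else 0))"
        by (rule sum.cong) auto
      also have "\<dots> = 0" unfolding sum_subtractf using jk by (simp add: eq)
      finally show ?thesis .
    qed
    then have "?u j = 0" using indep[of ?u] jk by blast
    then show False using jk(4) by simp
  qed
  have sum_B: "(\<Sum>v\<in>B. (\<lambda>f. u v * v f)) = der (\<lambda>i. \<Sum>k<n. u (der (\<theta> k)) * \<theta> k i)" for u
    unfolding B_def sum.reindex[OF inj] by (simp add: fun_eq_iff sum_fun_apply der_sum)
  have finB: "finite B" by (simp add: B_def)
  have "S_mod.span B = der ` log_fields \<Phi>"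
  proof (intro equalityI subsetI)
    fix \<eta> assume "\<eta> \<in> S_mod.span B"
    then obtain u where "\<eta> = (\<Sum>v\<in>B. (\<lambda>f. u v * v f))" using S_mod.span_finite[OF finB] by auto
    then show "\<eta> \<in> der ` log_fields \<Phi>" unfolding sum_B by (auto intro!: imageI log_fields_sum mem)
  next
    fix \<eta> assume "\<eta> \<in> der ` log_fields \<Phi>"
    then obtain g where g: "\<eta> = der g" "g \<in> log_fields \<Phi>" by blast
    obtain u where u: "g = (\<lambda>i. \<Sum>k<n. u k * \<theta> k i)" using span[OF g(2)] by blast
    let ?u = "\<lambda>v. u (the_inv_into {..<n} (\<lambda>k. der (\<theta> k)) v)"
    have "\<eta> = (\<Sum>v\<in>B. (\<lambda>f. ?u v * v f))"
      unfolding sum_B g(1) u using the_inv_into_f_f[OF inj] by (intro arg_cong[where f = der] ext sum.cong) auto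
    then show "\<eta> \<in> S_mod.span B" unfolding S_mod.span_finite[OF finB] by (rule image_eqI[where x = ?u, OF _ UNIV_I])
  qed
  moreover have "S_mod.independent B"
    unfolding S_mod.dependent_finite[OF finB]
  proof safe
    fix u v assume uv: "v \<in> B" "u v \<noteq> 0" "(\<Sum>v\<in>B. (\<lambda>f. u v * v f)) = 0"
    then have "der (\<lambda>i. \<Sum>k<n. u (der (\<theta> k)) * \<theta> k i) (Var i) = 0" for i by (simp add: sum_B)
    then have "\<forall>k<n. u (der (\<theta> k)) = 0" by (intro indep) simp
    then show False using uv by (auto simp: B_def)
  qed
  ultimately show ?thesis
    unfolding free_arrangement_def log_derivations_eq_der_log_fields[OF nz] by blast
qed

subsection \<open>Regular triples and saturation\<close>

text \<open>In an integral domain this says that none of \<open>y1\<close>, \<open>y2\<close>,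
  \<open>y3\<close> is a zero divisor modulo the ideal generated by the preceding ones.\<close>

definition regular_triple :: "'a::comm_ring_1 \<Rightarrow> 'a \<Rightarrow> 'a \<Rightarrow> bool" where
  "regular_triple y1 y2 y3 \<longleftrightarrow> y1 \<noteq> 0 \<and> (\<forall>f. y1 dvd y2 * f \<longrightarrow> y1 dvd f) \<and>
     (\<forall>f a b. y3 * f = y1 * a + y2 * b \<longrightarrow> (\<exists>s t. f = y1 * s + y2 * t))"

text \<open>The Koszul complex of a regular triple is exact at its second exterior power.\<close>

lemma koszul_exact:
  fixes y1 y2 y3 :: "('k::field, 'm::finite) sym_alg"
  assumes "regular_triple y1 y2 y3" "y3 * r12 + y1 * r23 + y2 * r31 = 0"
  shows "\<exists>s1 s2 s3. r12 = y2 * s1 - y1 * s2 \<and> r23 = y3 * s2 - y2 * s3 \<and> r31 = y1 * s3 - y3 * s1"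
proof -
  have "y3 * r12 = y1 * (- r23) + y2 * (- r31)" using assms(2) by (simp add: algebra_simps eq_neg_iff_add_eq_0)
  then obtain a s1 where s1: "r12 = y1 * a + y2 * s1" using assms(1) unfolding regular_triple_def by blast
  define s2 where "s2 = - a"
  have r12: "r12 = y2 * s1 - y1 * s2" by (simp add: s1 s2_def)
  have *: "y1 * (r23 - y3 * s2) + y2 * (r31 + y3 * s1) = 0" using assms(2) by (simp add: r12 algebra_simps)
  then have "y2 * (r31 + y3 * s1) = y1 * (- (r23 - y3 * s2))" by (simp add: eq_neg_iff_add_eq_0 algebra_simps)
  then have "y1 dvd r31 + y3 * s1" using assms(1) unfolding regular_triple_def by (metis dvd_triv_left)
  then obtain s3 where s3: "r31 + y3 * s1 = y1 * s3" by blast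
  have "y1 * (r23 - y3 * s2 + y2 * s3) = 0" using * unfolding s3 by (simp add: algebra_simps)
  then have "r23 - y3 * s2 + y2 * s3 = 0"
    using assms(1) by (simp only: sym_alg_mult_eq_0 regular_triple_def) simp
  then have "r23 = y3 * s2 - y2 * s3" by (simp add: algebra_simps)
  moreover have "r31 = y1 * s3 - y3 * s1" using s3 by (simp add: algebra_simps)
  ultimately show ?thesis using r12 by blast
qed

text \<open>With respect to a basis, the three logarithmic derivations in the assumptions have
  coefficient vectors that form a Koszul cycle. Koszul exactness, applied to each coefficient,
  yields logarithmic corrections \<open>d s1\<close>, \<open>d s2\<close>, \<open>d s3\<close>
  such that the differences \<open>\<eta>\<^sub>i - d s\<^sub>i\<close> are proportional to
  \<open>y\<^sub>i\<close> with a common factor \<open>\<xi>\<close>.\<close>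

lemma free_koszul_lift:
  fixes \<Phi> :: "('k::field ^ 'm::finite) set"
  assumes free: "free_arrangement (form_kernel ` \<Phi>)" and nz: "0 \<notin> \<Phi>"
    and reg: "regular_triple y1 y2 y3"
    and u12: "(\<lambda>i. y2 * \<eta>1 i - y1 * \<eta>2 i) \<in> log_fields \<Phi>"
    and u23: "(\<lambda>i. y3 * \<eta>2 i - y2 * \<eta>3 i) \<in> log_fields \<Phi>"
    and u31: "(\<lambda>i. y1 * \<eta>3 i - y3 * \<eta>1 i) \<in> log_fields \<Phi>"
  shows "\<exists>\<xi>. (\<lambda>i. \<eta>1 i - y1 * \<xi> i) \<in> log_fields \<Phi> \<and> (\<lambda>i. \<eta>2 i - y2 * \<xi> i) \<in> log_fields \<Phi> \<and>
    (\<lambda>i. \<eta>3 i - y3 * \<xi> i) \<in> log_fields \<Phi>"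
proof -
  obtain B where ind: "S_mod.independent B" and span: "S_mod.span B = der ` log_fields \<Phi>"
    using free unfolding free_arrangement_def log_derivations_eq_der_log_fields[OF nz] by blast
  let ?U12 = "der (\<lambda>i. y2 * \<eta>1 i - y1 * \<eta>2 i)" and ?U23 = "der (\<lambda>i. y3 * \<eta>2 i - y2 * \<eta>3 i)"
    and ?U31 = "der (\<lambda>i. y1 * \<eta>3 i - y3 * \<eta>1 i)"
  have in_span: "?U12 \<in> S_mod.span B" "?U23 \<in> S_mod.span B" "?U31 \<in> S_mod.span B"
    using u12 u23 u31 unfolding span by blast+
  let ?r12 = "S_mod.representation B ?U12" and ?r23 = "S_mod.representation B ?U23"
    and ?r31 = "S_mod.representation B ?U31"
  define F where "F = {b. ?r12 b \<noteq> 0} \<union> {b. ?r23 b \<noteq> 0} \<union> {b. ?r31 b \<noteq> 0}"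
  have finF: "finite F" unfolding F_def by (simp add: S_mod.finite_representation)
  have FB: "F \<subseteq> B" unfolding F_def using S_mod.representation_ne_zero by blast
  have expand: "(\<Sum>b\<in>F. (\<lambda>f. S_mod.representation B U b * b f)) = U"
    if "U \<in> S_mod.span B" "{b. S_mod.representation B U b \<noteq> 0} \<subseteq> F" for U
  proof -
    have "(\<Sum>b\<in>F. (\<lambda>f. S_mod.representation B U b * b f)) =
        (\<Sum>b | S_mod.representation B U b \<noteq> 0. (\<lambda>f. S_mod.representation B U b * b f))"
      by (rule sum.mono_neutral_right[OF finF that(2)]) (auto simp: fun_eq_iff)
    then show ?thesis using S_mod.sum_nonzero_representation_eq[OF ind that(1)] by simp
  qed
  have rel: "y3 * ?r12 b + y1 * ?r23 b + y2 * ?r31 b = 0" for b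
  proof -
    have comb: "der (\<lambda>i. a * g i - c * h i) p = a * der g p - c * der h p" for a c g h p
      using der_comb[of a g "- c" h p] by simp
    have "(\<lambda>f. y3 * ?U12 f) + (\<lambda>f. y1 * ?U23 f) + (\<lambda>f. y2 * ?U31 f) = 0"
      by (simp add: fun_eq_iff comb algebra_simps)
    then have "S_mod.representation B ((\<lambda>f. y3 * ?U12 f) + (\<lambda>f. y1 * ?U23 f) + (\<lambda>f. y2 * ?U31 f)) b = 0"
      by (simp add: S_mod.representation_zero)
    moreover note S_mod.span_scale[OF in_span(1), of y3] S_mod.span_scale[OF in_span(2), of y1]
      S_mod.span_scale[OF in_span(3), of y2]
    ultimately show ?thesis
      by (simp add: S_mod.representation_add[OF ind] S_mod.representation_scale[OF ind] in_span
          S_mod.span_add)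
  qed
  have "\<exists>s. ?r12 b = y2 * fst s - y1 * fst (snd s) \<and> ?r23 b = y3 * fst (snd s) - y2 * snd (snd s) \<and>
      ?r31 b = y1 * snd (snd s) - y3 * fst s" for b
    using koszul_exact[OF reg rel[of b]] by auto
  then obtain S where S: "\<And>b. ?r12 b = y2 * fst (S b) - y1 * fst (snd (S b)) \<and>
      ?r23 b = y3 * fst (snd (S b)) - y2 * snd (snd (S b)) \<and>
      ?r31 b = y1 * snd (snd (S b)) - y3 * fst (S b)"
    using choice[of "\<lambda>b s. ?r12 b = y2 * fst s - y1 * fst (snd s) \<and>
      ?r23 b = y3 * fst (snd s) - y2 * snd (snd s) \<and> ?r31 b = y1 * snd (snd s) - y3 * fst s"] by blast
  define s1 s2 s3 where "s1 = (\<lambda>b. fst (S b))" and "s2 = (\<lambda>b. fst (snd (S b)))" and "s3 = (\<lambda>b. snd (snd (S b)))"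
  have s: "?r12 b = y2 * s1 b - y1 * s2 b" "?r31 b = y1 * s3 b - y3 * s1 b" for b
    using S[of b] by (simp_all only: s1_def s2_def s3_def)
  have "(\<Sum>b\<in>F. (\<lambda>f. t b * b f)) \<in> S_mod.span B" for t
    using FB by (intro S_mod.span_sum S_mod.span_scale S_mod.span_base) blast
  then have "(\<Sum>b\<in>F. (\<lambda>f. t b * b f)) \<in> der ` log_fields \<Phi>" for t by (simp only: span)
  then have ex: "\<exists>g\<in>log_fields \<Phi>. (\<Sum>b\<in>F. (\<lambda>f. t b * b f)) = der g" for t by blast
  define d where "d t i = (\<Sum>b\<in>F. t b * b (Var i))" for t i
  have d: "d t \<in> log_fields \<Phi>" for t
  proof -
    obtain g where g: "g \<in> log_fields \<Phi>" "(\<Sum>b\<in>F. (\<lambda>f. t b * b f)) = der g" using ex by blast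
    have "d t i = g i" for i
      using fun_cong[OF g(2), of "Var i"] by (simp only: sum_fun_apply der_Var d_def)
    then have "d t = g" by (simp add: fun_eq_iff)
    with g(1) show ?thesis by simp
  qed
  have sub: "{b. ?r12 b \<noteq> 0} \<subseteq> F" "{b. ?r31 b \<noteq> 0} \<subseteq> F" by (auto simp: F_def)
  have lin: "(\<Sum>b\<in>F. (a * t b - c * t' b) * b (Var i)) = a * d t i - c * d t' i" for a c t t' i
    by (simp add: algebra_simps sum_subtractf sum_distrib_left d_def)
  have e12: "y2 * \<eta>1 i - y1 * \<eta>2 i = y2 * d s1 i - y1 * d s2 i" for i
  proof -
    have "(\<Sum>b\<in>F. ?r12 b * b (Var i)) = y2 * \<eta>1 i - y1 * \<eta>2 i"
      using fun_cong[OF expand[OF in_span(1) sub(1)], of "Var i"] by (simp only: sum_fun_apply der_Var)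
    then show ?thesis using lin[of y2 s1 y1 s2 i] by (simp only: s)
  qed
  have e31: "y1 * \<eta>3 i - y3 * \<eta>1 i = y1 * d s3 i - y3 * d s1 i" for i
  proof -
    have "(\<Sum>b\<in>F. ?r31 b * b (Var i)) = y1 * \<eta>3 i - y3 * \<eta>1 i"
      using fun_cong[OF expand[OF in_span(3) sub(2)], of "Var i"] by (simp only: sum_fun_apply der_Var)
    then show ?thesis using lin[of y1 s3 y3 s1 i] by (simp only: s)
  qed
  have "y1 dvd \<eta>1 i - d s1 i" for i
  proof -
    have "y2 * (\<eta>1 i - d s1 i) = y1 * (\<eta>2 i - d s2 i)" using e12[of i] by (simp add: algebra_simps)
    then show ?thesis using reg unfolding regular_triple_def by (metis dvd_triv_left)
  qed
  then obtain \<xi> where \<xi>: "\<And>i. \<eta>1 i - d s1 i = y1 * \<xi> i" unfolding dvd_def by metis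
  have y1: "y1 \<noteq> 0" using reg by (simp add: regular_triple_def)
  have "\<eta>2 i - d s2 i = y2 * \<xi> i" for i
  proof -
    have "y1 * (\<eta>2 i - d s2 i - y2 * \<xi> i) = y2 * (y1 * \<xi> i) - y1 * (y2 * \<xi> i)"
      using e12[of i] by (simp add: algebra_simps flip: \<xi>)
    then show ?thesis using y1 by (simp add: sym_alg_mult_eq_0)
  qed
  moreover have "\<eta>3 i - d s3 i = y3 * \<xi> i" for i
  proof -
    have "y1 * (\<eta>3 i - d s3 i - y3 * \<xi> i) = y3 * (y1 * \<xi> i) - y1 * (y3 * \<xi> i)"
      using e31[of i] by (simp add: algebra_simps flip: \<xi>)
    then show ?thesis using y1 by (simp add: sym_alg_mult_eq_0)
  qed
  ultimately have "(\<lambda>i. \<eta>1 i - y1 * \<xi> i) = d s1" "(\<lambda>i. \<eta>2 i - y2 * \<xi> i) = d s2"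
    "(\<lambda>i. \<eta>3 i - y3 * \<xi> i) = d s3"
    using \<xi> by (simp_all add: fun_eq_iff diff_eq_eq algebra_simps)
  then have "(\<lambda>i. \<eta>1 i - y1 * \<xi> i) \<in> log_fields \<Phi>" "(\<lambda>i. \<eta>2 i - y2 * \<xi> i) \<in> log_fields \<Phi>"
    "(\<lambda>i. \<eta>3 i - y3 * \<xi> i) \<in> log_fields \<Phi>"
    by (simp_all only: d)
  then show ?thesis by blast
qed

text \<open>In the cokernel of \<open>\<theta> \<mapsto> (\<theta>(\<alpha>) mod \<alpha>)\<close> for a
  free arrangement, an element \<open>g\<close> that is annihilated by a regular triple is
  zero: the derivations \<open>\<eta>\<^sub>i\<close> witness that \<open>y\<^sub>i g\<close>
  is zero, and \<open>\<xi>\<close> witnesses that \<open>g\<close> is.\<close>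

lemma free_saturated:
  fixes \<Phi> :: "('k::field ^ 'm::finite) set"
  assumes free: "free_arrangement (form_kernel ` \<Phi>)" and nz: "0 \<notin> \<Phi>"
    and reg: "regular_triple y1 y2 y3"
    and \<eta>1: "\<And>\<alpha>. \<alpha> \<in> \<Phi> \<Longrightarrow> form_poly \<alpha> dvd lin_ext \<eta>1 \<alpha> - y1 * g \<alpha>"
    and \<eta>2: "\<And>\<alpha>. \<alpha> \<in> \<Phi> \<Longrightarrow> form_poly \<alpha> dvd lin_ext \<eta>2 \<alpha> - y2 * g \<alpha>"
    and \<eta>3: "\<And>\<alpha>. \<alpha> \<in> \<Phi> \<Longrightarrow> form_poly \<alpha> dvd lin_ext \<eta>3 \<alpha> - y3 * g \<alpha>"
  shows "\<exists>\<xi>. \<forall>\<alpha>\<in>\<Phi>. form_poly \<alpha> dvd lin_ext \<xi> \<alpha> - g \<alpha>"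
proof -
  have cocycle: "(\<lambda>i. y * \<eta> i - y' * \<eta>' i) \<in> log_fields \<Phi>"
    if \<eta>: "\<And>\<alpha>. \<alpha> \<in> \<Phi> \<Longrightarrow> form_poly \<alpha> dvd lin_ext \<eta> \<alpha> - y' * g \<alpha>"
      and \<eta>': "\<And>\<alpha>. \<alpha> \<in> \<Phi> \<Longrightarrow> form_poly \<alpha> dvd lin_ext \<eta>' \<alpha> - y * g \<alpha>" for \<eta> \<eta>' y y'
  proof -
    have "form_poly \<alpha> dvd lin_ext (\<lambda>i. y * \<eta> i - y' * \<eta>' i) \<alpha>" if "\<alpha> \<in> \<Phi>" for \<alpha>
    proof -
      have "lin_ext (\<lambda>i. y * \<eta> i - y' * \<eta>' i) \<alpha> =
          y * (lin_ext \<eta> \<alpha> - y' * g \<alpha>) - y' * (lin_ext \<eta>' \<alpha> - y * g \<alpha>)"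
        using lin_ext_comb[of y \<eta> "- y'" \<eta>' \<alpha>] by (simp add: algebra_simps)
      then show ?thesis using \<eta>[OF that] \<eta>'[OF that] by (simp add: dvd_diff dvd_mult)
    qed
    then show ?thesis by (simp add: log_fields_def)
  qed
  obtain \<xi> where \<xi>: "(\<lambda>i. \<eta>1 i - y1 * \<xi> i) \<in> log_fields \<Phi>" "(\<lambda>i. \<eta>2 i - y2 * \<xi> i) \<in> log_fields \<Phi>"
    using free_koszul_lift[OF free nz reg cocycle[OF \<eta>1 \<eta>2] cocycle[OF \<eta>2 \<eta>3] cocycle[OF \<eta>3 \<eta>1]]
    by blast
  have "form_poly \<alpha> dvd lin_ext \<xi> \<alpha> - g \<alpha>" if \<alpha>: "\<alpha> \<in> \<Phi>" for \<alpha>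
  proof -
    have prime: "prime_elem (form_poly \<alpha>)" using nz \<alpha> by (intro prime_elem_form_poly) auto
    have "form_poly \<alpha> dvd y * (lin_ext \<xi> \<alpha> - g \<alpha>)"
      if "form_poly \<alpha> dvd lin_ext \<eta> \<alpha> - y * g \<alpha>" "(\<lambda>i. \<eta> i - y * \<xi> i) \<in> log_fields \<Phi>" for \<eta> y
    proof -
      have "lin_ext (\<lambda>i. \<eta> i - y * \<xi> i) \<alpha> = lin_ext \<eta> \<alpha> - y * lin_ext \<xi> \<alpha>"
        using lin_ext_comb[of 1 \<eta> "- y" \<xi> \<alpha>] by simp
      then have "y * (lin_ext \<xi> \<alpha> - g \<alpha>) =
          (lin_ext \<eta> \<alpha> - y * g \<alpha>) - lin_ext (\<lambda>i. \<eta> i - y * \<xi> i) \<alpha>"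
        by (simp add: algebra_simps)
      then show ?thesis using that \<alpha> by (simp add: log_fields_def dvd_diff)
    qed
    from this[OF \<eta>1[OF \<alpha>] \<xi>(1)] this[OF \<eta>2[OF \<alpha>] \<xi>(2)]
    have *: "form_poly \<alpha> dvd lin_ext \<xi> \<alpha> - g \<alpha> \<or> (form_poly \<alpha> dvd y1 \<and> form_poly \<alpha> dvd y2)"
      using prime by (simp add: prime_elem_dvd_mult_iff) blast
    \<comment> \<open>a common prime factor of y1 and y2 would contradict the regularity of the pair\<close>
    have False if "form_poly \<alpha> dvd y1" "form_poly \<alpha> dvd y2"
    proof -
      obtain c1 c2 where c: "y1 = form_poly \<alpha> * c1" "y2 = form_poly \<alpha> * c2" using \<open>form_poly \<alpha> dvd y1\<close> \<open>form_poly \<alpha> dvd y2\<close> by (auto elim!: dvdE)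
      then have "y2 * c1 = y1 * c2" by (simp add: algebra_simps)
      then have "y1 dvd c1" using reg unfolding regular_triple_def by (metis dvd_triv_left)
      then have "c1 * form_poly \<alpha> dvd c1 * 1" by (simp add: c algebra_simps)
      moreover have "c1 \<noteq> 0" using reg c by (auto simp: regular_triple_def)
      ultimately have "form_poly \<alpha> dvd 1" using sym_alg_mult_dvd_cancel[of c1 "form_poly \<alpha>" 1] by blast
      then show False using prime prime_elem_not_unit by blast
    qed
    with * show ?thesis by blast
  qed
  then show ?thesis by blast
qed

text \<open>Successive restriction to the kernels of \<open>\<alpha>\<close> and \<open>\<beta>\<close>
  identifies \<open>S/(\<alpha>, \<beta>)\<close> with a subring of the integral domain
  \<open>S\<close>, so that \<open>y\<close> only has to be nonzero there.\<close>

lemma regular_tripleI: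
  assumes p: "\<alpha> \<cdot> p = 1" and q: "\<beta> \<cdot> q = 1" and 21: "\<beta> \<cdot> p = 0"
    and y: "restr \<beta> q (restr \<alpha> p y) \<noteq> 0"
  shows "regular_triple (form_poly \<alpha>) (form_poly \<beta>) y"
  unfolding regular_triple_def
proof (intro conjI allI impI)
  have hom: "restr \<alpha> p (a * b) = restr \<alpha> p a * restr \<alpha> p b" "restr \<alpha> p (a + b) = restr \<alpha> p a + restr \<alpha> p b"
    for \<alpha> p :: "'a ^ 'b" and a b by (simp_all add: restr_def)
  show "form_poly \<alpha> \<noteq> 0" using p by auto
  fix f
  {
    assume "form_poly \<alpha> dvd form_poly \<beta> * f"
    then have "form_poly \<beta> * restr \<alpha> p f = 0"
      using 21 by (simp add: form_poly_dvd_iff_restr[OF p] hom restr_form_poly)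
    moreover have "form_poly \<beta> \<noteq> 0" using q by auto
    ultimately show "form_poly \<alpha> dvd f"
      by (simp only: form_poly_dvd_iff_restr[OF p] sym_alg_mult_eq_0) simp
  }
  fix a b assume "y * f = form_poly \<alpha> * a + form_poly \<beta> * b"
  then have "restr \<beta> q (restr \<alpha> p y) * restr \<beta> q (restr \<alpha> p f) =
      restr \<beta> q (restr \<alpha> p (form_poly \<alpha> * a + form_poly \<beta> * b))"
    by (simp flip: hom)
  also have "\<dots> = 0" using p q 21 by (simp add: hom restr_form_poly)
  finally have "restr \<beta> q (restr \<alpha> p f) = 0" using y by (simp only: sym_alg_mult_eq_0) simp
  then have "form_poly \<beta> dvd restr \<alpha> p f" by (simp only: form_poly_dvd_iff_restr[OF q])
  then obtain t where t: "restr \<alpha> p f = form_poly \<beta> * t" by blast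
  obtain s where "f - restr \<alpha> p f = form_poly \<alpha> * s" using form_poly_dvd_diff_restr by blast
  then have "f = form_poly \<alpha> * s + form_poly \<beta> * t" using t by (simp add: algebra_simps)
  then show "\<exists>s t. f = form_poly \<alpha> * s + form_poly \<beta> * t" by blast
qed

section \<open>Modular rankings\<close>

text \<open>If the arrangement is supersolvable and \<open>V = X\<^sub>0 \<supset> X\<^sub>1 \<supset>
  \<dots>\<close> is a modular maximal chain of its lattice, then the least \<open>k\<close>
  with \<open>X\<^sub>k \<subseteq> H\<close> is such a ranking. The first condition expresses
  modularity, the second one that the rank of the lattice grows with each new value of
  \<open>\<rho>\<close>.\<close>

definition modular_ranking :: "('k::field ^ 'm::finite) set set \<Rightarrow> (('k ^ 'm) set \<Rightarrow> nat) \<Rightarrow> bool" where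
  "modular_ranking \<A> \<rho> \<longleftrightarrow>
     (\<forall>H\<in>\<A>. \<forall>H'\<in>\<A>. H \<noteq> H' \<and> \<rho> H = \<rho> H' \<longrightarrow> (\<exists>H''\<in>\<A>. \<rho> H'' < \<rho> H \<and> H \<inter> H' \<subseteq> H'')) \<and>
     (\<forall>H\<in>\<A>. \<not> \<Inter>{H'\<in>\<A>. \<rho> H' < \<rho> H} \<subseteq> H)"

definition hyperplane_arrangement :: "('k::field ^ 'm::finite) set set \<Rightarrow> bool" where
  "hyperplane_arrangement \<A> \<longleftrightarrow> finite \<A> \<and> (\<forall>H\<in>\<A>. \<exists>\<alpha>. \<alpha> \<noteq> 0 \<and> H = form_kernel \<alpha>)"

section \<open>Interpolation\<close>

text \<open>Newton interpolation in the variable \<open>\<gamma>\<close>: the nodes are the forms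
  \<open>\<beta> \<in> N\<close>, and the value prescribed at \<open>\<beta>\<close> is
  \<open>lin_ext g \<beta>\<close>. A new node \<open>\<beta>0\<close> can be added if the
  error \<open>R\<close> of the old interpolant at \<open>\<beta>0\<close> is divisible by the
  product of the differences \<open>\<beta>0 - \<beta>\<close>. The compatibility assumption
  gives divisibility by each difference alone. If several differences are proportional, their
  product is needed; it divides \<open>R\<close> because the prescribed values are linear
  along the line through \<open>\<beta>0\<close> that contains the nodes in question.\<close>

lemma interpolation:
  fixes \<gamma> p :: "'k::field ^ 'm::finite"
  assumes "finite N" and p: "\<gamma> \<cdot> p = 1" "\<And>\<beta>. \<beta> \<in> N \<Longrightarrow> \<beta> \<cdot> p = 0"
    and compat: "\<And>\<beta> \<beta>'. \<beta> \<in> N \<Longrightarrow> \<beta>' \<in> N \<Longrightarrow> form_poly (\<beta> - \<beta>') dvd lin_ext g (\<beta> - \<beta>')"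
  shows "\<exists>w. \<forall>\<beta>\<in>N. form_poly (\<gamma> - \<beta>) dvd w - lin_ext g \<beta>"
  using assms(1,3,4)
proof (induction N rule: finite_induct)
  case (insert \<beta>0 N)
  have "\<exists>w. \<forall>\<beta>\<in>N. form_poly (\<gamma> - \<beta>) dvd w - lin_ext g \<beta>"
    by (rule insert.IH) (blast intro: insert.prems)+
  then obtain w where w: "\<And>\<beta>. \<beta> \<in> N \<Longrightarrow> form_poly (\<gamma> - \<beta>) dvd w - lin_ext g \<beta>" by blast
  have p0: "(\<gamma> - \<beta>0) \<cdot> p = 1" using insert.prems(1) p(1) by simp
  let ?\<sigma> = "restr (\<gamma> - \<beta>0) p"
  have hom: "?\<sigma> (a * b) = ?\<sigma> a * ?\<sigma> b" "?\<sigma> (a + b) = ?\<sigma> a + ?\<sigma> b" "?\<sigma> (a - b) = ?\<sigma> a - ?\<sigma> b"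
      "?\<sigma> (prod f A) = (\<Prod>a\<in>A. ?\<sigma> (f a))" for a b A and f :: "'k ^ 'm \<Rightarrow> _"
    by (simp_all add: restr_def)
  have \<sigma>_form: "?\<sigma> (form_poly (\<gamma> - \<beta>)) = form_poly (\<beta>0 - \<beta>)" if "\<beta> \<in> N" for \<beta>
    using that insert.prems(1) p(1) unfolding restr_form_poly by simp
  define R where "R = ?\<sigma> (lin_ext g \<beta>0 - w)"
  have "(\<Prod>\<beta>\<in>N. form_poly (\<beta>0 - \<beta>)) dvd R"
  proof (rule prod_form_poly_dvd_classwise)
    show "finite N" by fact
    show "\<beta>0 - \<beta> \<noteq> 0" if "\<beta> \<in> N" for \<beta> using that insert.hyps by auto
    fix \<beta> assume \<beta>: "\<beta> \<in> N"
    let ?C = "{b \<in> N. \<exists>t. \<beta>0 - b = t *s (\<beta>0 - \<beta>)}"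
    have "form_poly (\<beta>0 - \<beta>) dvd lin_ext g (\<beta>0 - \<beta>)" using insert.prems(2) \<beta> by blast
    then obtain q where q: "lin_ext g (\<beta>0 - \<beta>) = form_poly (\<beta>0 - \<beta>) * q" by blast
    \<comment> \<open>w0 interpolates at all nodes on the line through \<open>\<beta>0\<close> and \<open>\<beta>\<close>, and is exact at \<open>\<beta>0\<close>\<close>
    define w0 where "w0 = lin_ext g \<beta>0 + form_poly (\<gamma> - \<beta>0) * q"
    have each: "form_poly (\<gamma> - b) dvd w - w0" if b: "b \<in> ?C" for b
    proof -
      obtain t where t: "\<beta>0 - b = t *s (\<beta>0 - \<beta>)" using b by blast
      have "lin_ext g (\<beta>0 - b) = form_poly (\<beta>0 - b) * q"
        unfolding t lin_ext_simps(4) form_poly_simps(4) q by (simp add: mult.assoc)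
      then have "w0 - lin_ext g b = form_poly (\<gamma> - b) * q"
        by (simp add: w0_def algebra_simps)
      then have eq: "w - w0 = (w - lin_ext g b) - form_poly (\<gamma> - b) * q" by (simp add: algebra_simps)
      have "b \<in> N" using b by simp
      from dvd_diff[OF w[OF this] dvd_triv_left] show ?thesis unfolding eq .
    qed
    have "(\<Prod>b\<in>?C. form_poly (\<gamma> - b)) dvd w - w0"
    proof (rule prod_form_poly_dvd_classwise)
      show "finite ?C" using insert.hyps by simp
      show "\<gamma> - b \<noteq> 0" if "b \<in> ?C" for b
        using that p(1) insert.prems(1)[of b] by auto
      fix b assume b: "b \<in> ?C"
      have "c = b" if c: "c \<in> ?C" "\<gamma> - c = t *s (\<gamma> - b)" for c t
      proof -
        have "(\<gamma> - c) \<cdot> p = t * ((\<gamma> - b) \<cdot> p)" by (simp only: c(2) scalar_product_simps)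
        then have "t = 1" using c(1) b p(1) insert.prems(1) by simp
        then show ?thesis using c(2) by simp
      qed
      moreover have "\<exists>t. \<gamma> - b = t *s (\<gamma> - b)" by (rule exI[of _ 1]) simp
      ultimately have "{c \<in> ?C. \<exists>t. \<gamma> - c = t *s (\<gamma> - b)} = {b}" using b by blast
      then show "(\<Prod>c\<in>{c \<in> ?C. \<exists>t. \<gamma> - c = t *s (\<gamma> - b)}. form_poly (\<gamma> - c)) dvd w - w0"
        using each[OF b] by simp
    qed
    then obtain r where "w - w0 = (\<Prod>b\<in>?C. form_poly (\<gamma> - b)) * r" by blast
    then have "?\<sigma> (w - w0) = (\<Prod>b\<in>?C. ?\<sigma> (form_poly (\<gamma> - b))) * ?\<sigma> r" by (simp only: hom)
    also have "(\<Prod>b\<in>?C. ?\<sigma> (form_poly (\<gamma> - b))) = (\<Prod>b\<in>?C. form_poly (\<beta>0 - b))"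
      by (rule prod.cong) (auto simp: \<sigma>_form simp del: form_poly_simps)
    also have "?\<sigma> (w - w0) = - R"
    proof -
      have "?\<sigma> (form_poly (\<gamma> - \<beta>0)) = 0" unfolding restr_form_poly p0 by simp
      then show ?thesis by (simp add: w0_def R_def hom del: form_poly_simps)
    qed
    finally have eq: "- R = (\<Prod>b\<in>?C. form_poly (\<beta>0 - b)) * ?\<sigma> r" .
    have "(\<Prod>b\<in>?C. form_poly (\<beta>0 - b)) dvd - R" unfolding eq by (rule dvd_triv_left)
    then show "(\<Prod>b\<in>?C. form_poly (\<beta>0 - b)) dvd R" by (simp only: dvd_minus_iff)
  qed
  then obtain \<tau> where \<tau>: "R = (\<Prod>\<beta>\<in>N. form_poly (\<beta>0 - \<beta>)) * \<tau>" by blast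
  define P where "P = (\<Prod>\<beta>\<in>N. form_poly (\<gamma> - \<beta>))"
  have \<sigma>P: "?\<sigma> P = (\<Prod>\<beta>\<in>N. form_poly (\<beta>0 - \<beta>))"
    unfolding P_def hom by (rule prod.cong) (auto simp: \<sigma>_form simp del: form_poly_simps)
  have "form_poly (\<gamma> - \<beta>) dvd (w + P * \<tau>) - lin_ext g \<beta>" if "\<beta> \<in> insert \<beta>0 N" for \<beta>
  proof (cases "\<beta> = \<beta>0")
    case True
    have "(w + P * \<tau>) - lin_ext g \<beta>0 =
        (P - ?\<sigma> P) * \<tau> - ((lin_ext g \<beta>0 - w) - ?\<sigma> (lin_ext g \<beta>0 - w))"
      using \<tau> by (simp add: \<sigma>P R_def algebra_simps)
    then show ?thesis unfolding True
      by (simp only:) (intro dvd_diff dvd_mult2 form_poly_dvd_diff_restr)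
  next
    case False
    with that have \<beta>: "\<beta> \<in> N" by simp
    have "form_poly (\<gamma> - \<beta>) dvd P" unfolding P_def using insert.hyps(1) \<beta> by (intro dvd_prodI)
    then have "form_poly (\<gamma> - \<beta>) dvd (w - lin_ext g \<beta>) + P * \<tau>" using w[OF \<beta>] by (intro dvd_add dvd_mult2)
    then show ?thesis by (simp add: algebra_simps)
  qed
  then show ?case by blast
qed simp

section \<open>Dual bases\<close>

definition dual_bases :: "nat \<Rightarrow> (nat \<Rightarrow> 'k::field ^ 'm::finite) \<Rightarrow> (nat \<Rightarrow> 'k ^ 'm) \<Rightarrow> bool" where
  "dual_bases n b p \<longleftrightarrow> (\<forall>j<n. \<forall>k<n. b j \<cdot> p k = (if j = k then 1 else 0)) \<and>
     (\<forall>\<alpha>. \<alpha> = (\<Sum>k<n. (\<alpha> \<cdot> p k) *s b k))"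

lemma independent_of_triangular:
  fixes b q :: "nat \<Rightarrow> 'k::field ^ 'm::finite"
  assumes "\<And>k. k < s \<Longrightarrow> b k \<cdot> q k \<noteq> 0" "\<And>j k. j < k \<Longrightarrow> k < s \<Longrightarrow> b j \<cdot> q k = 0"
  shows "vec.independent (b ` {..<s}) \<and> inj_on b {..<s}"
  using assms
proof (induction s)
  case (Suc s)
  have IH: "vec.independent (b ` {..<s})" "inj_on b {..<s}" using Suc by simp_all
  have "vec.span (b ` {..<s}) \<subseteq> {\<alpha>. \<alpha> \<cdot> q s = 0}"
    using Suc.prems(2) by (intro vec.span_minimal) (auto simp: vec.subspace_def)
  then have "b s \<notin> vec.span (b ` {..<s})" using Suc.prems(1)[of s] by auto
  moreover from this have "b s \<notin> b ` {..<s}" by (metis vec.span_base)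
  ultimately show ?case using IH by (simp add: lessThan_Suc vec.independent_insert)
qed (simp add: vec.independent_empty)

text \<open>A triangular matrix of values makes the forms independent. They are completed to a basis,
  and \<open>p k\<close> collects the values of the \<open>k\<close>-th coordinate function of
  that basis.\<close>

lemma dual_bases_extend:
  fixes b q :: "nat \<Rightarrow> 'k::field ^ 'm::finite"
  assumes "\<And>k. k < s \<Longrightarrow> b k \<cdot> q k \<noteq> 0" "\<And>j k. j < k \<Longrightarrow> k < s \<Longrightarrow> b j \<cdot> q k = 0"
  shows "\<exists>n b' p. s \<le> n \<and> (\<forall>k<s. b' k = b k) \<and> dual_bases n b' p"
proof -
  let ?B0 = "b ` {..<s}"
  have ind0: "vec.independent ?B0" and inj0: "inj_on b {..<s}"
    using independent_of_triangular[OF assms] by simp_all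
  define B where "B = vec.extend_basis ?B0"
  have B: "vec.independent B" "?B0 \<subseteq> B" "vec.span B = UNIV"
    unfolding B_def using vec.independent_extend_basis[OF ind0] vec.extend_basis_superset[OF ind0]
      vec.span_extend_basis[OF ind0] by auto
  have finB: "finite B" using B(1) vec.finiteI_independent by blast
  obtain xs where xs: "set xs = B - ?B0" "distinct xs" using finB finite_distinct_list[of "B - ?B0"] by auto
  define n where "n = s + length xs"
  define b' where "b' k = (if k < s then b k else xs ! (k - s))" for k
  have b'_bij: "bij_betw b' {..<n} B"
  proof -
    have "inj_on b' {..<n}"
    proof (rule inj_onI)
      fix j k assume jk: "j \<in> {..<n}" "k \<in> {..<n}" "b' j = b' k"
      have mem: "xs ! (i - s) \<notin> ?B0" if "i < n" "\<not> i < s" for i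
        using xs(1) nth_mem[of "i - s" xs] that by (auto simp: n_def)
      show "j = k"
      proof (cases "j < s"; cases "k < s")
        assume "j < s" "k < s"
        then show ?thesis using jk(3) inj0 by (auto simp: b'_def dest: inj_onD)
      next
        assume "j < s" "\<not> k < s"
        then have "xs ! (k - s) = b j" using jk(3) by (simp add: b'_def)
        then have "b j \<notin> ?B0" using mem[of k] jk(2) \<open>\<not> k < s\<close> by auto
        then show ?thesis using \<open>j < s\<close> by blast
      next
        assume "\<not> j < s" "k < s"
        then have "xs ! (j - s) = b k" using jk(3) by (simp add: b'_def)
        then have "b k \<notin> ?B0" using mem[of j] jk(1) \<open>\<not> j < s\<close> by auto
        then show ?thesis using \<open>k < s\<close> by blast
      next
        assume "\<not> j < s" "\<not> k < s"
        then show ?thesis using jk xs(2) by (auto simp: b'_def n_def nth_eq_iff_index_eq)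
      qed
    qed
    moreover have "b' ` {..<n} = B"
    proof (intro equalityI subsetI)
      fix v assume "v \<in> b' ` {..<n}"
      then show "v \<in> B" using B(2) xs(1) nth_mem[of _ xs] by (fastforce simp: b'_def n_def split: if_splits)
    next
      fix v assume v: "v \<in> B"
      show "v \<in> b' ` {..<n}"
      proof (cases "v \<in> ?B0")
        case True
        then obtain k where "k < s" "v = b k" by blast
        then have "v = b' k" "k \<in> {..<n}" by (auto simp: b'_def n_def)
        then show ?thesis by (rule image_eqI)
      next
        case False
        then obtain i where "i < length xs" "v = xs ! i" using v xs(1) by (metis DiffI in_set_conv_nth)
        then have "v = b' (s + i)" "s + i \<in> {..<n}" by (auto simp: b'_def n_def)
        then show ?thesis by (rule image_eqI)
      qed
    qed
    ultimately show ?thesis by (simp add: bij_betw_def)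
  qed
  define p where "p k = (\<chi> i. vec.representation B (axis i 1) (b' k))" for k
  have rep: "\<alpha> \<cdot> p k = vec.representation B \<alpha> (b' k)" for \<alpha> k
  proof -
    have "\<alpha> = (\<Sum>i\<in>UNIV. (\<alpha> $ i) *s axis i 1)" by (simp add: basis_expansion)
    then have "vec.representation B \<alpha> (b' k) = vec.representation B (\<Sum>i\<in>UNIV. (\<alpha> $ i) *s axis i 1) (b' k)"
      by simp
    also have "\<dots> = (\<Sum>i\<in>UNIV. \<alpha> $ i * vec.representation B (axis i 1) (b' k))"
      using B by (simp add: vec.representation_sum vec.representation_scale)
    finally show ?thesis by (simp add: scalar_product_def p_def)
  qed
  have "dual_bases n b' p"
    unfolding dual_bases_def
  proof (intro conjI allI impI)
    fix j k assume jk: "j < n" "k < n"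
    then have "b' j \<in> B" using b'_bij by (auto simp: bij_betw_def)
    then show "b' j \<cdot> p k = (if j = k then 1 else 0)"
      using jk b'_bij unfolding rep vec.representation_basis[OF B(1) \<open>b' j \<in> B\<close>]
      by (auto simp: bij_betw_def dest: inj_onD)
  next
    fix \<alpha>
    have "(\<Sum>v\<in>B. vec.representation B \<alpha> v *s v) = \<alpha>"
      using B finB by (intro vec.sum_representation_eq) auto
    then show "\<alpha> = (\<Sum>k<n. (\<alpha> \<cdot> p k) *s b' k)"
      unfolding rep using sum.reindex_bij_betw[OF b'_bij, of "\<lambda>v. vec.representation B \<alpha> v *s v"] by simp
  qed
  then show ?thesis by (intro exI[of _ n] exI[of _ b'] exI[of _ p]) (auto simp: n_def b'_def)
qed

section \<open>Triangular arrangements are free\<close>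

text \<open>The hyperplanes with index \<open>k\<close> are the kernels of \<open>b k - \<beta>\<close>,
  where \<open>\<beta> \<in> N k\<close> is a combination of \<open>b 0, \<dots>, b (k -
  1)\<close>. The last assumption is the first condition of a modular ranking: the difference
  of two forms with index \<open>k\<close> defines a hyperplane with smaller index.\<close>

locale triangular_forms =
  fixes n :: nat and b p :: "nat \<Rightarrow> 'k::field ^ 'm::finite" and N :: "nat \<Rightarrow> ('k ^ 'm) set"
  assumes dual: "dual_bases n b p"
    and fin: "k < n \<Longrightarrow> finite (N k)"
    and low: "k < n \<Longrightarrow> \<beta> \<in> N k \<Longrightarrow> k \<le> j \<Longrightarrow> j < n \<Longrightarrow> \<beta> \<cdot> p j = 0"
    and closed: "k < n \<Longrightarrow> \<beta> \<in> N k \<Longrightarrow> \<beta>' \<in> N k \<Longrightarrow> \<beta> \<noteq> \<beta>' \<Longrightarrow>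
      \<exists>t j \<beta>''. j < k \<and> \<beta>'' \<in> N j \<and> \<beta> - \<beta>' = t *s (b j - \<beta>'')"
begin

lemma pair: "j < n \<Longrightarrow> k < n \<Longrightarrow> b j \<cdot> p k = (if j = k then 1 else 0)"
  using dual by (auto simp: dual_bases_def)

lemma expand: "\<alpha> = (\<Sum>k<n. (\<alpha> \<cdot> p k) *s b k)"
  using dual unfolding dual_bases_def by blast

lemma lin_ext_expand: "lin_ext g \<alpha> = (\<Sum>k<n. Const (\<alpha> \<cdot> p k) * lin_ext g (b k))"
proof -
  have *: "lin_ext g (\<Sum>k\<in>A. c k *s b k) = (\<Sum>k\<in>A. Const (c k) * lin_ext g (b k))" for A c
    by (induction A rule: infinite_finite_induct) auto
  show ?thesis by (subst expand[of \<alpha>]) (rule *)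
qed

definition log_upto :: "nat \<Rightarrow> ('m \<Rightarrow> ('k, 'm) sym_alg) \<Rightarrow> bool" where
  "log_upto k g \<longleftrightarrow> (\<forall>j<k. \<forall>\<beta>\<in>N j. form_poly (b j - \<beta>) dvd lin_ext g (b j - \<beta>))"

text \<open>Adds \<open>u\<close> to the value at \<open>b k\<close> and keeps the values at the other
  members of the basis.\<close>

definition shift :: "('m \<Rightarrow> ('k, 'm) sym_alg) \<Rightarrow> nat \<Rightarrow> ('k, 'm) sym_alg \<Rightarrow> 'm \<Rightarrow> ('k, 'm) sym_alg" where
  "shift g k u i = g i + Const (p k $ i) * u"

lemma lin_ext_shift: "lin_ext (shift g k u) \<alpha> = lin_ext g \<alpha> + Const (\<alpha> \<cdot> p k) * u"
proof -
  have "(\<Sum>i\<in>UNIV. Const (\<alpha> $ i * p k $ i)) = (Const (\<alpha> \<cdot> p k) :: ('k, 'm) sym_alg)"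
    unfolding scalar_product_def by (induction rule: infinite_finite_induct) (auto simp: single_add)
  then have "lin_ext (\<lambda>i. Const (p k $ i) * u) \<alpha> = Const (\<alpha> \<cdot> p k) * u"
    by (simp add: lin_ext_def mult_single flip: mult.assoc sum_distrib_right)
  then show ?thesis
    using lin_ext_comb[of 1 g 1 "\<lambda>i. Const (p k $ i) * u" \<alpha>] by (simp add: shift_def[abs_def])
qed

lemma low_form: "j < n \<Longrightarrow> \<beta> \<in> N j \<Longrightarrow> j < k \<Longrightarrow> k < n \<Longrightarrow> (b j - \<beta>) \<cdot> p k = 0"
  using low[of j \<beta> k] by (simp add: pair)

lemma top_form: "k < n \<Longrightarrow> \<beta> \<in> N k \<Longrightarrow> (b k - \<beta>) \<cdot> p k = 1"
  by (simp add: pair low)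

text \<open>The value at \<open>b k\<close> is prescribed modulo each form \<open>b k - \<beta>\<close>
  with \<open>\<beta> \<in> N k\<close>, which is an interpolation problem; its compatibility
  condition is \<open>log_upto k g\<close>.\<close>

lemma extend_step:
  assumes "k < n" "log_upto k g"
  shows "\<exists>g'. log_upto (Suc k) g' \<and> (\<forall>j<n. j \<noteq> k \<longrightarrow> lin_ext g' (b j) = lin_ext g (b j))"
proof -
  have "\<exists>w. \<forall>\<beta>\<in>N k. form_poly (b k - \<beta>) dvd w - lin_ext g \<beta>"
  proof (rule interpolation)
    fix \<beta> \<beta>' assume \<beta>: "\<beta> \<in> N k" "\<beta>' \<in> N k"
    show "form_poly (\<beta> - \<beta>') dvd lin_ext g (\<beta> - \<beta>')"
    proof (cases "\<beta> = \<beta>'")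
      case False
      then obtain t j \<beta>'' where "j < k" "\<beta>'' \<in> N j" and t: "\<beta> - \<beta>' = t *s (b j - \<beta>'')"
        using closed assms(1) \<beta> by blast
      then have "form_poly (b j - \<beta>'') dvd lin_ext g (b j - \<beta>'')" using assms(2) by (auto simp: log_upto_def)
      then show ?thesis unfolding t lin_ext_simps(4) form_poly_simps(4) by (rule mult_dvd_mono[OF dvd_refl])
    qed simp
  qed (use assms fin low pair in auto)
  then obtain w where w: "\<And>\<beta>. \<beta> \<in> N k \<Longrightarrow> form_poly (b k - \<beta>) dvd w - lin_ext g \<beta>" by blast
  let ?g = "shift g k (w - lin_ext g (b k))"
  have "form_poly (b j - \<beta>) dvd lin_ext ?g (b j - \<beta>)" if "j < Suc k" "\<beta> \<in> N j" for j \<beta>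
  proof (cases "j = k")
    case True
    then have "lin_ext ?g (b j - \<beta>) = w - lin_ext g \<beta>"
      using that assms(1) top_form[of k \<beta>] unfolding lin_ext_shift by simp
    then show ?thesis using w that True by simp
  next
    case False
    then show ?thesis
      using that assms low_form[of j \<beta> k] unfolding lin_ext_shift by (auto simp: log_upto_def)
  qed
  then have "log_upto (Suc k) ?g" by (simp add: log_upto_def)
  moreover have "\<forall>j<n. j \<noteq> k \<longrightarrow> lin_ext ?g (b j) = lin_ext g (b j)"
    using assms(1) by (simp add: lin_ext_shift pair)
  ultimately show ?thesis by blast
qed

lemma extend:
  assumes "k + d \<le> n" "log_upto k g"
  shows "\<exists>g'. log_upto (k + d) g' \<and> (\<forall>j<k. lin_ext g' (b j) = lin_ext g (b j))"
  using assms(1)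
proof (induction d)
  case 0
  then show ?case using assms(2) by auto
next
  case (Suc d)
  then obtain g1 where g1: "log_upto (k + d) g1" "\<forall>j<k. lin_ext g1 (b j) = lin_ext g (b j)" by auto
  obtain g2 where "log_upto (Suc (k + d)) g2" "\<forall>j<n. j \<noteq> k + d \<longrightarrow> lin_ext g2 (b j) = lin_ext g1 (b j)"
    using extend_step[of "k + d" g1] g1(1) Suc.prems by auto
  then show ?case using g1(2) Suc.prems by (intro exI[of _ g2]) auto
qed

definition top_prod :: "nat \<Rightarrow> ('k, 'm) sym_alg" where
  "top_prod k = (\<Prod>\<beta>\<in>N k. form_poly (b k - \<beta>))"

lemma top_form_nonzero: "k < n \<Longrightarrow> \<beta> \<in> N k \<Longrightarrow> b k - \<beta> \<noteq> 0"
  using top_form[of k \<beta>] by auto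

lemma top_prod_nonzero:
  assumes "k < n" shows "top_prod k \<noteq> 0"
proof -
  have "(\<Prod>\<beta>\<in>A. form_poly (b k - \<beta>)) \<noteq> 0" if "finite A" "A \<subseteq> N k" for A
    using that
  proof (induction A rule: finite_induct)
    case (insert \<beta> A)
    then have "form_poly (b k - \<beta>) \<noteq> 0" using top_form_nonzero[OF assms] unfolding form_poly_eq_0 by blast
    with insert show ?case by (simp add: sym_alg_mult_eq_0 del: form_poly_simps)
  qed simp
  then show ?thesis using fin[OF assms] by (simp add: top_prod_def)
qed

lemma top_prod_dvd:
  assumes k: "k < n" and g: "log_upto (Suc k) g" and 0: "\<And>j. j < k \<Longrightarrow> lin_ext g (b j) = 0"
  shows "top_prod k dvd lin_ext g (b k)"
  unfolding top_prod_def
proof (rule prod_form_poly_dvd_classwise)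
  fix \<beta> assume \<beta>: "\<beta> \<in> N k"
  have "c = \<beta>" if c: "c \<in> N k" "b k - c = t *s (b k - \<beta>)" for c t
  proof -
    have "(b k - c) \<cdot> p k = t * ((b k - \<beta>) \<cdot> p k)" by (simp only: c(2) scalar_product_simps)
    then have "t = 1" using top_form[OF k c(1)] top_form[OF k \<beta>] by simp
    then show ?thesis using c(2) by simp
  qed
  moreover have "\<exists>t. b k - \<beta> = t *s (b k - \<beta>)" by (rule exI[of _ 1]) simp
  ultimately have single: "{c \<in> N k. \<exists>t. b k - c = t *s (b k - \<beta>)} = {\<beta>}" using \<beta> by blast
  have "lin_ext g \<beta> = (\<Sum>j<n. Const (\<beta> \<cdot> p j) * lin_ext g (b j))" by (rule lin_ext_expand)
  also have "\<dots> = 0" using low[OF k \<beta>] 0 by (intro sum.neutral) (metis lessThan_iff mult_zero_left mult_zero_right not_le single_zero)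
  finally have "lin_ext g (b k - \<beta>) = lin_ext g (b k)" by simp
  moreover have "form_poly (b k - \<beta>) dvd lin_ext g (b k - \<beta>)" using g \<beta> by (simp add: log_upto_def)
  ultimately show "(\<Prod>c\<in>{c \<in> N k. \<exists>t. b k - c = t *s (b k - \<beta>)}. form_poly (b k - c)) dvd lin_ext g (b k)"
    unfolding single by simp
qed (use fin k top_form_nonzero in auto)

definition forms :: "('k ^ 'm) set" where
  "forms = {b k - \<beta> | k \<beta>. k < n \<and> \<beta> \<in> N k}"

lemma log_fields_forms: "log_fields forms = {g. log_upto n g}"
  unfolding log_fields_def forms_def log_upto_def by blast

lemma basis_field:
  assumes "k < n"
  shows "\<exists>\<theta>. log_upto n \<theta> \<and> (\<forall>j<k. lin_ext \<theta> (b j) = 0) \<and> lin_ext \<theta> (b k) = top_prod k"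
proof -
  let ?g = "shift (\<lambda>i. 0) k (top_prod k)"
  have lin: "lin_ext ?g \<alpha> = Const (\<alpha> \<cdot> p k) * top_prod k" for \<alpha>
    unfolding lin_ext_shift by (simp add: lin_ext_def)
  have "form_poly (b j - \<beta>) dvd lin_ext ?g (b j - \<beta>)" if "j < Suc k" "\<beta> \<in> N j" for j \<beta>
  proof (cases "j = k")
    case True
    then show ?thesis using that assms fin unfolding lin by (simp only: top_form top_prod_def) (auto intro!: dvd_prodI)
  next
    case False
    then show ?thesis using that assms low_form[of j \<beta> k] unfolding lin by simp
  qed
  then have "log_upto (Suc k) ?g" by (simp add: log_upto_def)
  moreover have "Suc k + (n - Suc k) = n" using assms by simp
  ultimately obtain \<theta> where "log_upto n \<theta>" "\<forall>j<Suc k. lin_ext \<theta> (b j) = lin_ext ?g (b j)"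
    using extend[of "Suc k" "n - Suc k" ?g] by auto
  moreover have "lin_ext ?g (b j) = (if j = k then top_prod k else 0)" if "j < Suc k" for j
    using that assms unfolding lin by (simp add: pair)
  ultimately show ?thesis by (intro exI[of _ \<theta>]) auto
qed

text \<open>The \<open>k\<close>-th basis element vanishes on \<open>b 0, \<dots>, b (k - 1)\<close> and
  has the value \<open>top_prod k\<close> at \<open>b k\<close>, which divides the value there
  of every logarithmic derivation that vanishes on \<open>b 0, \<dots>, b (k - 1)\<close>.
  Spanning and independence follow by elimination along the triangular shape.\<close>

lemma free_forms: "free_arrangement (form_kernel ` forms)"
proof -
  obtain \<theta> where \<theta>: "\<And>k. k < n \<Longrightarrow> log_upto n (\<theta> k)" "\<And>j k. k < n \<Longrightarrow> j < k \<Longrightarrow> lin_ext (\<theta> k) (b j) = 0"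
      "\<And>k. k < n \<Longrightarrow> lin_ext (\<theta> k) (b k) = top_prod k"
    using basis_field by metis
  show ?thesis
  proof (rule free_arrangementI[where \<theta> = \<theta> and n = n])
    show "0 \<notin> forms" using top_form_nonzero by (auto simp: forms_def)
    show "\<theta> k \<in> log_fields forms" if "k < n" for k using \<theta>(1) that by (simp add: log_fields_forms)
  next
    fix g assume "g \<in> log_fields forms"
    then have g: "log_upto n g" by (simp add: log_fields_forms)
    have "\<exists>u. \<forall>j<m. lin_ext (\<lambda>i. g i - (\<Sum>k<m. u k * \<theta> k i)) (b j) = 0" if "m \<le> n" for m
      using that
    proof (induction m)
      case (Suc m)
      then obtain u where u: "\<forall>j<m. lin_ext (\<lambda>i. g i - (\<Sum>k<m. u k * \<theta> k i)) (b j) = 0" by auto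
      let ?g = "\<lambda>i. g i - (\<Sum>k<m. u k * \<theta> k i)"
      have lin: "lin_ext ?g \<alpha> = lin_ext g \<alpha> - (\<Sum>k<m. u k * lin_ext (\<theta> k) \<alpha>)" for \<alpha>
        using lin_ext_comb[of 1 g "- 1" "\<lambda>i. \<Sum>k<m. u k * \<theta> k i" \<alpha>] by (simp add: lin_ext_sum)
      have "log_upto (Suc m) ?g"
        using g \<theta>(1) Suc.prems unfolding log_upto_def lin
        by (intro allI impI ballI dvd_diff dvd_sum dvd_mult) (auto simp: log_upto_def)
      then obtain v where v: "lin_ext ?g (b m) = top_prod m * v"
        using top_prod_dvd[of m ?g] u Suc.prems by auto
      let ?u = "u(m := v)"
      have new: "lin_ext (\<lambda>i. g i - (\<Sum>k<Suc m. ?u k * \<theta> k i)) \<alpha> = lin_ext ?g \<alpha> - v * lin_ext (\<theta> m) \<alpha>" for \<alpha>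
        using lin_ext_comb[of 1 ?g "- v" "\<theta> m" \<alpha>] by (simp add: algebra_simps)
      have "\<forall>j<Suc m. lin_ext (\<lambda>i. g i - (\<Sum>k<Suc m. ?u k * \<theta> k i)) (b j) = 0"
        unfolding new using u v \<theta>(2,3)[of m] Suc.prems by (auto simp: less_Suc_eq mult.commute)
      then show ?case by blast
    qed simp
    then obtain u where u: "\<And>j. j < n \<Longrightarrow> lin_ext (\<lambda>i. g i - (\<Sum>k<n. u k * \<theta> k i)) (b j) = 0" by blast
    have "lin_ext (\<lambda>i. g i - (\<Sum>k<n. u k * \<theta> k i)) (axis i 1) = 0" for i
      by (subst lin_ext_expand) (simp add: u)
    then show "\<exists>u. g = (\<lambda>i. \<Sum>k<n. u k * \<theta> k i)" by (intro exI[of _ u]) (simp add: fun_eq_iff)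
  next
    fix u assume "\<And>i. (\<Sum>k<n. u k * \<theta> k i) = 0"
    then have 0: "(\<Sum>k<n. u k * lin_ext (\<theta> k) \<alpha>) = 0" for \<alpha>
      using lin_ext_sum[of u \<theta> "{..<n}" \<alpha>] by (simp add: lin_ext_def)
    have "u j = 0" if "j < n" for j
      using that
    proof (induction j rule: less_induct)
      case (less j)
      have "(\<Sum>k<n. u k * lin_ext (\<theta> k) (b j)) = (\<Sum>k<n. if k = j then u j * top_prod j else 0)"
      proof (rule sum.cong)
        fix k assume "k \<in> {..<n}"
        then show "u k * lin_ext (\<theta> k) (b j) = (if k = j then u j * top_prod j else 0)"
          using less \<theta>(2)[of k j] \<theta>(3)[of j] by (cases k j rule: linorder_cases) auto
      qed simp
      then have "u j * top_prod j = 0" using less.prems by (simp add: 0)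
      then show ?case using top_prod_nonzero[OF less.prems] by (simp add: sym_alg_mult_eq_0)
    qed
    then show "\<forall>k<n. u k = 0" by blast
  qed
qed

end

section \<open>Ranked arrangements are free\<close>

text \<open>For each value of the ranking one hyperplane \<open>h k\<close> is selected. The second
  ranking condition makes the selected forms triangular, hence part of a basis
  \<open>b\<close>. By the first condition every other form of the same rank as \<open>h
  k\<close> is a combination of \<open>b k\<close> and a form of smaller rank, so that the
  arrangement is triangular with respect to \<open>b\<close>.\<close>

theorem free_if_modular_ranking:
  fixes \<A> :: "('k::field ^ 'm::finite) set set"
  assumes hyp: "hyperplane_arrangement \<A>" and rank: "modular_ranking \<A> \<rho>"
  shows "free_arrangement \<A>"
proof -
  have finA: "finite \<A>" using hyp by (simp add: hyperplane_arrangement_def)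
  obtain a where a: "\<And>H. H \<in> \<A> \<Longrightarrow> a H \<noteq> 0" "\<And>H. H \<in> \<A> \<Longrightarrow> form_kernel (a H) = H"
    using hyp unfolding hyperplane_arrangement_def by metis
  have R1: "\<exists>H''\<in>\<A>. \<rho> H'' < \<rho> H \<and> H \<inter> H' \<subseteq> H''" if "H \<in> \<A>" "H' \<in> \<A>" "H \<noteq> H'" "\<rho> H = \<rho> H'" for H H'
    using rank that unfolding modular_ranking_def by simp
  have R2: "\<exists>v. v \<notin> H \<and> (\<forall>H'\<in>\<A>. \<rho> H' < \<rho> H \<longrightarrow> v \<in> H')" if "H \<in> \<A>" for H
  proof -
    have "\<not> \<Inter>{H'\<in>\<A>. \<rho> H' < \<rho> H} \<subseteq> H" using rank that unfolding modular_ranking_def by simp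
    then show ?thesis by blast
  qed
  define rs where "rs = sorted_list_of_set (\<rho> ` \<A>)"
  define s where "s = length rs"
  have rs: "set rs = \<rho> ` \<A>" "sorted_wrt (<) rs" using finA by (auto simp: rs_def)
  have rs_less: "rs ! j < rs ! k" if "j < k" "k < s" for j k
    using rs(2) that by (simp add: s_def sorted_wrt_nth_less)
  have rs_less_iff: "rs ! j < rs ! k \<longleftrightarrow> j < k" if "j < s" "k < s" for j k
    using rs_less that by (metis less_asym linorder_neqE_nat)
  have idx: "\<exists>k<s. \<rho> H = rs ! k" if "H \<in> \<A>" for H
    using that rs(1) by (metis imageI in_set_conv_nth s_def)
  have "\<exists>H. k < s \<longrightarrow> H \<in> \<A> \<and> \<rho> H = rs ! k" for k
    using rs(1) nth_mem[of k rs] unfolding s_def by (metis imageE)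
  then obtain h where h: "\<And>k. k < s \<Longrightarrow> h k \<in> \<A>" "\<And>k. k < s \<Longrightarrow> \<rho> (h k) = rs ! k" by metis
  have "\<exists>v. k < s \<longrightarrow> v \<notin> h k \<and> (\<forall>H'\<in>\<A>. \<rho> H' < rs ! k \<longrightarrow> v \<in> H')" for k
    using R2[of "h k"] h by auto
  then obtain q where q: "\<And>k. k < s \<Longrightarrow> q k \<notin> h k"
      "\<And>k H. k < s \<Longrightarrow> H \<in> \<A> \<Longrightarrow> \<rho> H < rs ! k \<Longrightarrow> q k \<in> H" by metis
  have "\<exists>n b' p. s \<le> n \<and> (\<forall>k<s. b' k = a (h k)) \<and> dual_bases n b' p"
  proof (rule dual_bases_extend)
    show "a (h k) \<cdot> q k \<noteq> 0" if "k < s" for k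
      using q(1)[OF that] a(2)[OF h(1)[OF that]] form_kernel_iff by blast
    show "a (h j) \<cdot> q k = 0" if "j < k" "k < s" for j k
      using q(2)[OF that(2), of "h j"] a(2)[of "h j"] h[of j] rs_less that by (auto simp flip: form_kernel_iff)
  qed
  then obtain n b p where sn: "s \<le> n" and b: "\<And>k. k < s \<Longrightarrow> b k = a (h k)" and dual: "dual_bases n b p"
    by blast
  have pair: "b j \<cdot> p k = (if j = k then 1 else 0)" if "j < n" "k < n" for j k
    using dual that by (auto simp: dual_bases_def)
  have expand: "\<alpha> = (\<Sum>k<n. (\<alpha> \<cdot> p k) *s b k)" for \<alpha>
    using dual unfolding dual_bases_def by blast
  \<comment> \<open>p k and p j extract coefficients: a form of the k-th rank has leading term b k\<close>
  have lead: "a H \<cdot> p k \<noteq> 0 \<and> (\<forall>j. k < j \<and> j < n \<longrightarrow> a H \<cdot> p j = 0)" if "H \<in> \<A>" "\<rho> H = rs ! k" "k < s" for H k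
    using that
  proof (induction k arbitrary: H rule: less_induct)
    case (less k)
    have kn: "k < n" using less.prems sn by simp
    show ?case
    proof (cases "H = h k")
      case True
      then show ?thesis using less.prems kn pair[of k] b[of k] by auto
    next
      case False
      then obtain H'' where H'': "H'' \<in> \<A>" "\<rho> H'' < \<rho> H" "H \<inter> h k \<subseteq> H''"
        using R1[of H "h k"] less.prems h by auto
      then obtain k'' where k'': "k'' < s" "\<rho> H'' = rs ! k''" using idx by blast
      have k''k: "k'' < k" using H''(2) k'' less.prems rs_less_iff by simp
      have low'': "a H'' \<cdot> p j = 0" if "k'' < j" "j < n" for j
        using less.IH[OF k''k H''(1) k''(2,1)] that by blast
      have "form_kernel (a H) \<inter> form_kernel (b k) \<subseteq> form_kernel (a H'')"
        using H''(3) a(2) less.prems h b H''(1) by simp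
      then obtain c d where cd: "a H'' = c *s a H + d *s b k" using form_kernel_Int_subsetD by blast
      have "c \<noteq> 0"
      proof
        assume "c = 0"
        then have eq: "a H'' = d *s b k" using cd by simp
        then have "d = 0" using low''[OF k''k kn] pair[OF kn kn] by simp
        then show False using eq a(1)[OF H''(1)] by simp
      qed
      have high: "a H \<cdot> p j = 0" if "k < j" "j < n" for j
      proof -
        have "a H'' \<cdot> p j = c * (a H \<cdot> p j) + d * (b k \<cdot> p j)" by (simp add: cd)
        then show ?thesis using low''[of j] k''k that kn pair[of k j] \<open>c \<noteq> 0\<close> by simp
      qed
      moreover have "a H \<cdot> p k \<noteq> 0"
      proof
        assume 0: "a H \<cdot> p k = 0"
        obtain v where v: "v \<notin> H" "\<forall>H'\<in>\<A>. \<rho> H' < \<rho> H \<longrightarrow> v \<in> H'" using R2[OF less.prems(1)] by blast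
        have "((a H \<cdot> p j) *s b j) \<cdot> v = 0" if "j < n" for j
        proof (cases "j < k")
          case True
          then have "v \<in> h j" using v(2) h[of j] less.prems rs_less by auto
          then have "b j \<cdot> v = 0" using a(2)[OF h(1)[of j]] b[of j] True less.prems form_kernel_iff by auto
          then show ?thesis by simp
        next
          case False
          then have "a H \<cdot> p j = 0" using 0 high that by (cases "j = k") auto
          then show ?thesis by simp
        qed
        moreover have "sum f A \<cdot> v = (\<Sum>j\<in>A. f j \<cdot> v)" for f :: "nat \<Rightarrow> 'k ^ 'm" and A
          by (induction A rule: infinite_finite_induct) auto
        ultimately have "a H \<cdot> v = 0" by (subst expand) (auto intro!: sum.neutral)
        then show False using v(1) a(2)[OF less.prems(1)] form_kernel_iff by blast
      qed
      ultimately show ?thesis by blast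
    qed
  qed
  \<comment> \<open>rescaling the form of H so that b k has the coefficient 1 leaves \<open>b k - \<nu> k H\<close>\<close>
  define \<nu> where "\<nu> k H = b k - (1 / (a H \<cdot> p k)) *s a H" for k H
  define N where "N k = (if k < s then \<nu> k ` {H \<in> \<A>. \<rho> H = rs ! k} else {})" for k
  have \<nu>_form: "b k - \<nu> k H = (1 / (a H \<cdot> p k)) *s a H" for k H by (simp add: \<nu>_def)
  have \<nu>_kernel: "form_kernel (b k - \<nu> k H) = H" if "H \<in> \<A>" "\<rho> H = rs ! k" "k < s" for k H
    using lead[OF that] a(2)[OF that(1)] unfolding \<nu>_form by (auto simp: form_kernel_iff)
  interpret triangular_forms n b p N
  proof
    show "dual_bases n b p" by fact
    show "finite (N k)" for k using finA by (simp add: N_def)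
    show low: "\<beta> \<cdot> p j = 0" if "k < n" "\<beta> \<in> N k" "k \<le> j" "j < n" for k \<beta> j
      using that lead[of _ k] pair[of k j] by (cases "k = j") (auto simp: N_def \<nu>_def split: if_splits)
    fix k \<beta> \<beta>' assume k: "k < n" "\<beta> \<in> N k" "\<beta>' \<in> N k" "\<beta> \<noteq> \<beta>'"
    then have ks: "k < s" by (auto simp: N_def split: if_splits)
    obtain H H' where H: "H \<in> \<A>" "\<rho> H = rs ! k" "\<beta> = \<nu> k H" and H': "H' \<in> \<A>" "\<rho> H' = rs ! k" "\<beta>' = \<nu> k H'"
      using k ks by (auto simp: N_def)
    have "H \<noteq> H'" using k(4) H(3) H'(3) by blast
    then obtain H'' where H'': "H'' \<in> \<A>" "\<rho> H'' < rs ! k" "H \<inter> H' \<subseteq> H''" using R1[OF H(1) H'(1)] H(2) H'(2) by auto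
    then obtain k'' where k'': "k'' < s" "\<rho> H'' = rs ! k''" using idx by blast
    have k''k: "k'' < k" using H''(2) k'' ks rs_less_iff by simp
    define \<beta>'' where "\<beta>'' = \<nu> k'' H''"
    have "form_kernel (b k - \<beta>) \<inter> form_kernel (b k - \<beta>') \<subseteq> form_kernel (b k'' - \<beta>'')"
      using \<nu>_kernel[OF H(1,2) ks] \<nu>_kernel[OF H'(1,2) ks] \<nu>_kernel[OF H''(1) k''(2,1)] H(3) H'(3) H''(3)
      by (simp add: \<beta>''_def)
    then obtain c d where cd: "b k'' - \<beta>'' = c *s (b k - \<beta>) + d *s (b k - \<beta>')"
      using form_kernel_Int_subsetD by blast
    have mem'': "\<beta>'' \<in> N k''" using H''(1) k'' by (auto simp: N_def \<beta>''_def)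
    have "(b k'' - \<beta>'') \<cdot> p k = c * ((b k - \<beta>) \<cdot> p k) + d * ((b k - \<beta>') \<cdot> p k)"
      by (simp only: cd scalar_product_simps)
    then have "c + d = 0"
      using low[OF _ mem'', of k] low[OF k(1,2), of k] low[OF k(1,3), of k] k''k k(1) pair[of k'' k] pair[of k k]
      by simp
    then have d: "d = - c" by (simp add: add_eq_0_iff)
    have eq: "b k'' - \<beta>'' = (- c) *s (\<beta> - \<beta>')" by (simp add: cd d vec_eq_iff algebra_simps)
    have "(b k'' - \<beta>'') \<cdot> p k'' = 1"
      using low[OF _ mem'', of k''] pair[of k'' k''] k''k k(1) by simp
    then have "c \<noteq> 0" unfolding eq by auto
    then have "\<beta> - \<beta>' = (- (1 / c)) *s (b k'' - \<beta>'')" unfolding eq by simp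
    then show "\<exists>t j \<beta>''. j < k \<and> \<beta>'' \<in> N j \<and> \<beta> - \<beta>' = t *s (b j - \<beta>'')"
      using k''k mem'' by blast
  qed
  have "form_kernel ` forms = \<A>"
  proof (intro equalityI subsetI)
    fix H assume "H \<in> form_kernel ` forms"
    then show "H \<in> \<A>" using \<nu>_kernel by (auto simp: forms_def N_def split: if_splits)
  next
    fix H assume H: "H \<in> \<A>"
    then obtain k where k: "k < s" "\<rho> H = rs ! k" using idx by blast
    then have "b k - \<nu> k H \<in> forms" using H sn by (auto simp: forms_def N_def)
    then show "H \<in> form_kernel ` forms" using \<nu>_kernel[OF H k(2,1)] by (metis imageI)
  qed
  then show ?thesis using free_forms by simp
qed

section \<open>The intersection lattice\<close>

definition flats :: "'a set set \<Rightarrow> 'a set set" where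
  "flats \<A> = {\<Inter>\<B> | \<B>. \<B> \<subseteq> \<A>}"

lemma carrier_intersection_lattice [simp]: "carrier (intersection_lattice \<A>) = flats \<A>"
  and le_intersection_lattice [simp]: "le (intersection_lattice \<A>) X Y \<longleftrightarrow> Y \<subseteq> X"
  and eq_intersection_lattice [simp]: "eq (intersection_lattice \<A>) X Y \<longleftrightarrow> X = Y"
  by (simp_all add: intersection_lattice_def flats_def)

lemma flats_UNIV: "UNIV \<in> flats \<A>"
  unfolding flats_def by (rule CollectI, rule exI[of _ "{}"]) simp

lemma flats_hyperplane: "H \<in> \<A> \<Longrightarrow> H \<in> flats \<A>"
  unfolding flats_def by (rule CollectI, rule exI[of _ "{H}"]) simp

lemma flats_Inter: "\<F> \<subseteq> flats \<A> \<Longrightarrow> \<Inter>\<F> \<in> flats \<A>"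
proof -
  assume F: "\<F> \<subseteq> flats \<A>"
  have "X = \<Inter>{H \<in> \<A>. X \<subseteq> H}" if "X \<in> flats \<A>" for X
    using that by (auto simp: flats_def)
  then have "\<Inter>\<F> = \<Inter>{H \<in> \<A>. \<exists>X\<in>\<F>. X \<subseteq> H}" using F by blast
  then show ?thesis unfolding flats_def by blast
qed

lemma flats_Int: "X \<in> flats \<A> \<Longrightarrow> Y \<in> flats \<A> \<Longrightarrow> X \<inter> Y \<in> flats \<A>"
  using flats_Inter[of "{X, Y}" \<A>] by simp

lemma flats_eq_Inter: "X \<in> flats \<A> \<Longrightarrow> X = \<Inter>{H \<in> \<A>. X \<subseteq> H}"
  by (auto simp: flats_def)

lemma finite_flats: "finite \<A> \<Longrightarrow> finite (flats \<A>)"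
  unfolding flats_def by (rule finite_subset[of _ "Inter ` Pow \<A>"]) auto

lemma lattice_intersection_lattice: "Lattice.lattice (intersection_lattice \<A>)"
proof -
  interpret partial_order "intersection_lattice \<A>"
    by unfold_locales (auto simp: fun_eq_iff)
  show ?thesis
  proof unfold_locales
    fix X Y assume XY: "X \<in> carrier (intersection_lattice \<A>)" "Y \<in> carrier (intersection_lattice \<A>)"
    then have "least (intersection_lattice \<A>) (X \<inter> Y) (Upper (intersection_lattice \<A>) {X, Y})"
      by (auto simp: least_def Upper_def flats_Int)
    then show "\<exists>s. least (intersection_lattice \<A>) s (Upper (intersection_lattice \<A>) {X, Y})" ..
    let ?M = "\<Inter>{Z \<in> flats \<A>. X \<subseteq> Z \<and> Y \<subseteq> Z}"
    have "?M \<in> flats \<A>" by (rule flats_Inter) auto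
    with XY have "greatest (intersection_lattice \<A>) ?M (Lower (intersection_lattice \<A>) {X, Y})"
      by (auto simp: greatest_def Lower_def)
    then show "\<exists>s. greatest (intersection_lattice \<A>) s (Lower (intersection_lattice \<A>) {X, Y})" ..
  qed
qed

lemma join_intersection_lattice:
  assumes "X \<in> flats \<A>" "Y \<in> flats \<A>"
  shows "X \<squnion>\<^bsub>intersection_lattice \<A>\<^esub> Y = X \<inter> Y"
proof -
  interpret Lattice.lattice "intersection_lattice \<A>" by (rule lattice_intersection_lattice)
  let ?J = "X \<squnion>\<^bsub>intersection_lattice \<A>\<^esub> Y"
  have "?J \<subseteq> X" "?J \<subseteq> Y" using join_left[of X Y] join_right[of X Y] assms by simp_all
  moreover have "X \<inter> Y \<subseteq> ?J" using join_le[of X "X \<inter> Y" Y] assms flats_Int[OF assms] by simp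
  ultimately show ?thesis by blast
qed

lemma meet_intersection_lattice:
  assumes "X \<in> flats \<A>" "Y \<in> flats \<A>"
  shows "X \<sqinter>\<^bsub>intersection_lattice \<A>\<^esub> Y \<in> flats \<A>"
    "X \<union> Y \<subseteq> X \<sqinter>\<^bsub>intersection_lattice \<A>\<^esub> Y"
    "\<And>Z. Z \<in> flats \<A> \<Longrightarrow> X \<union> Y \<subseteq> Z \<Longrightarrow> X \<sqinter>\<^bsub>intersection_lattice \<A>\<^esub> Y \<subseteq> Z"
proof -
  interpret Lattice.lattice "intersection_lattice \<A>" by (rule lattice_intersection_lattice)
  let ?M = "X \<sqinter>\<^bsub>intersection_lattice \<A>\<^esub> Y"
  show "?M \<in> flats \<A>" using meet_closed[of X Y] assms by simp
  show "X \<union> Y \<subseteq> ?M" using meet_left[of X Y] meet_right[of X Y] assms by simp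
  show "?M \<subseteq> Z" if "Z \<in> flats \<A>" "X \<union> Y \<subseteq> Z" for Z
    using meet_le[of Z X Y] assms that by simp
qed

section \<open>Supersolvable arrangements have a modular ranking\<close>

lemma finite_chain_least:
  assumes "finite (C :: 'a set set)" "C \<noteq> {}" "\<And>X Y. X \<in> C \<Longrightarrow> Y \<in> C \<Longrightarrow> X \<subseteq> Y \<or> Y \<subseteq> X"
  shows "\<exists>M\<in>C. \<forall>X\<in>C. M \<subseteq> X"
  using assms
proof (induction C rule: finite_ne_induct)
  case (insert Z C)
  then obtain M where "M \<in> C" "\<forall>X\<in>C. M \<subseteq> X" by auto
  then show ?case using insert.prems[of M Z] by auto
qed auto

lemma finite_chain_greatest:
  assumes "finite (C :: 'a set set)" "C \<noteq> {}" "\<And>X Y. X \<in> C \<Longrightarrow> Y \<in> C \<Longrightarrow> X \<subseteq> Y \<or> Y \<subseteq> X"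
  shows "\<exists>M\<in>C. \<forall>X\<in>C. X \<subseteq> M"
  using assms
proof (induction C rule: finite_ne_induct)
  case (insert Z C)
  then obtain M where "M \<in> C" "\<forall>X\<in>C. X \<subseteq> M" by auto
  then show ?case using insert.prems[of M Z] by auto
qed auto

lemma order_chain_intersection_lattice:
  "order_chain (intersection_lattice \<A>) C \<longleftrightarrow> C \<subseteq> flats \<A> \<and> (\<forall>X\<in>C. \<forall>Y\<in>C. X \<subseteq> Y \<or> Y \<subseteq> X)"
  by (auto simp: order_chain_def)

text \<open>Adding an element that is comparable with the whole chain gives a chain.\<close>

lemma maximal_chain_mem:
  assumes D: "maximal_order_chain (intersection_lattice \<A>) D"
    and Z: "Z \<in> flats \<A>" "\<And>X. X \<in> D \<Longrightarrow> X \<subseteq> Z \<or> Z \<subseteq> X"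
  shows "Z \<in> D"
proof -
  have "order_chain (intersection_lattice \<A>) (insert Z D)"
    using D Z unfolding maximal_order_chain_def order_chain_intersection_lattice by blast
  then have "insert Z D = D" using D unfolding maximal_order_chain_def by blast
  then show ?thesis by blast
qed

text \<open>The rank of \<open>H\<close> is the number of members of the chain that are not contained in
  \<open>H\<close>; let \<open>M\<close> be the smallest of them. All hyperplanes of smaller
  rank contain \<open>M\<close>, which gives the second condition. For the first, let
  \<open>H'\<close> have the same rank. By maximality \<open>H \<inter> M\<close> is the next
  member of the chain, so it lies in \<open>H'\<close> as well. Distributivity for the
  two-element chain of \<open>H\<close> and \<open>X = H \<inter> H'\<close> shows that
  \<open>X\<close> is the intersection of \<open>H\<close> with the meet of \<open>X\<close>
  and \<open>M\<close>. Hence this meet is not the whole space, and any hyperplane above it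
  contains \<open>X\<close> and \<open>M\<close>.\<close>

theorem modular_ranking_if_supersolvable:
  fixes \<A> :: "('k::field ^ 'm::finite) set set"
  assumes hyp: "hyperplane_arrangement \<A>" and ss: "supersolvable_arrangement \<A>"
  shows "\<exists>\<rho>. modular_ranking \<A> \<rho>"
proof -
  let ?L = "intersection_lattice \<A>"
  obtain D where D: "maximal_order_chain ?L D"
      and dist: "\<And>C. order_chain ?L C \<Longrightarrow> distributive_on ?L (generated_sublattice ?L (C \<union> D))"
    using ss unfolding supersolvable_arrangement_def supersolvable_lattice_def by blast
  have finA: "finite \<A>" using hyp by (simp add: hyperplane_arrangement_def)
  have chain: "D \<subseteq> flats \<A>" "\<And>X Y. X \<in> D \<Longrightarrow> Y \<in> D \<Longrightarrow> X \<subseteq> Y \<or> Y \<subseteq> X"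
    using D unfolding maximal_order_chain_def order_chain_intersection_lattice by blast+
  have finD: "finite D" using chain(1) finite_flats[OF finA] by (rule finite_subset)
  have UNIV_D: "UNIV \<in> D" by (rule maximal_chain_mem[OF D flats_UNIV]) auto
  have proper: "\<not> UNIV \<subseteq> H" if H: "H \<in> \<A>" for H
  proof -
    obtain \<alpha> where \<alpha>: "\<alpha> \<noteq> 0" "H = form_kernel \<alpha>" using hyp H unfolding hyperplane_arrangement_def by blast
    obtain p where "\<alpha> \<cdot> p = 1" using nonzero_form_value_1[OF \<alpha>(1)] .
    then have "p \<notin> H" by (simp add: \<alpha>(2) form_kernel_iff)
    then show ?thesis by blast
  qed
  have antichain: "H = H'" if H: "H \<in> \<A>" "H' \<in> \<A>" "H \<subseteq> H'" for H H'
  proof -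
    obtain \<alpha> \<beta> where "H = form_kernel \<alpha>" "\<beta> \<noteq> 0" "H' = form_kernel \<beta>"
      using hyp H unfolding hyperplane_arrangement_def by meson
    then show ?thesis using form_kernel_subset_eqD H(3) by blast
  qed
  define Up where "Up H = {X \<in> D. \<not> X \<subseteq> H}" for H
  define \<rho> where "\<rho> H = card (Up H)" for H
  have finUp: "finite (Up H)" for H using finD by (simp add: Up_def)
  have Up_nested: "Up H \<subseteq> Up H' \<or> Up H' \<subseteq> Up H" for H H'
  proof (rule ccontr)
    assume "\<not> ?thesis"
    then obtain X Y where "X \<in> Up H" "X \<notin> Up H'" "Y \<in> Up H'" "Y \<notin> Up H" by blast
    then show False using chain(2)[of X Y] by (auto simp: Up_def)
  qed
  have Up_eq: "Up H = Up H'" if "\<rho> H = \<rho> H'" for H H'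
    using Up_nested[of H H'] that finUp card_subset_eq[of "Up H" "Up H'"] card_subset_eq[of "Up H'" "Up H"]
    by (auto simp: \<rho>_def)
  have Up_less: "Up H' \<subset> Up H" if "\<rho> H' < \<rho> H" for H H'
    using Up_nested[of H H'] that card_mono[OF finUp, of "Up H" H'] by (auto simp: \<rho>_def)
  have least: "\<exists>M\<in>Up H. \<forall>X\<in>Up H. M \<subseteq> X" if "H \<in> \<A>" for H
  proof (rule finite_chain_least[OF finUp])
    show "Up H \<noteq> {}" using UNIV_D proper[OF that] by (auto simp: Up_def)
    show "X \<subseteq> Y \<or> Y \<subseteq> X" if "X \<in> Up H" "Y \<in> Up H" for X Y using that chain(2) by (auto simp: Up_def)
  qed
  have "modular_ranking \<A> \<rho>"
    unfolding modular_ranking_def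
  proof (intro conjI ballI impI)
    fix H assume H: "H \<in> \<A>"
    obtain M where M: "M \<in> Up H" "\<And>X. X \<in> Up H \<Longrightarrow> M \<subseteq> X" using least[OF H] by blast
    have "M \<subseteq> H'" if "H' \<in> \<A>" "\<rho> H' < \<rho> H" for H'
    proof (rule ccontr)
      assume "\<not> M \<subseteq> H'"
      then have "Up H \<subseteq> Up H'" using M by (auto simp: Up_def)
      then show False using Up_less[OF that(2)] by blast
    qed
    then have "M \<subseteq> \<Inter>{H'\<in>\<A>. \<rho> H' < \<rho> H}" by blast
    then show "\<not> \<Inter>{H'\<in>\<A>. \<rho> H' < \<rho> H} \<subseteq> H" using M(1) unfolding Up_def by blast
  next
    fix H H' assume H: "H \<in> \<A>" "H' \<in> \<A>" "H \<noteq> H' \<and> \<rho> H = \<rho> H'"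
    obtain M where M: "M \<in> Up H" "\<And>X. X \<in> Up H \<Longrightarrow> M \<subseteq> X" using least[OF H(1)] by blast
    have M_flat: "M \<in> flats \<A>" and MD: "M \<in> D" using M(1) chain(1) by (auto simp: Up_def)
    have UpH': "Up H' = Up H" using Up_eq H(3) by metis
    have flH: "H \<in> flats \<A>" "H' \<in> flats \<A>" using H flats_hyperplane by blast+
    have HM: "H \<inter> M \<in> D"
    proof (rule maximal_chain_mem[OF D flats_Int[OF flH(1) M_flat]])
      fix X assume X: "X \<in> D"
      show "X \<subseteq> H \<inter> M \<or> H \<inter> M \<subseteq> X"
      proof (cases "X \<in> Up H")
        case False
        then have "X \<subseteq> H" using X by (simp add: Up_def)
        moreover have "X \<subseteq> M" using chain(2)[OF X MD] M(1) \<open>X \<subseteq> H\<close> by (auto simp: Up_def)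
        ultimately show ?thesis by blast
      qed (use M(2) in blast)
    qed
    then have "H \<inter> M \<notin> Up H'" unfolding UpH' by (auto simp: Up_def)
    then have HMX: "H \<inter> M \<subseteq> H \<inter> H'" using HM by (auto simp: Up_def)
    let ?X = "H \<inter> H'"
    have flX: "?X \<in> flats \<A>" using flats_Int[OF flH] .
    have "order_chain ?L {H, ?X}" using flH flX by (auto simp: order_chain_intersection_lattice)
    from dist[OF this] have "?X \<sqinter>\<^bsub>?L\<^esub> (H \<squnion>\<^bsub>?L\<^esub> M) = (?X \<sqinter>\<^bsub>?L\<^esub> H) \<squnion>\<^bsub>?L\<^esub> (?X \<sqinter>\<^bsub>?L\<^esub> M)"
      unfolding distributive_on_def using MD
      by (auto intro: generated_sublattice.generator)
    moreover have "?X \<sqinter>\<^bsub>?L\<^esub> (H \<squnion>\<^bsub>?L\<^esub> M) = ?X"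
      unfolding join_intersection_lattice[OF flH(1) M_flat]
    proof
      note m = meet_intersection_lattice[OF flX flats_Int[OF flH(1) M_flat]]
      show "?X \<sqinter>\<^bsub>?L\<^esub> (H \<inter> M) \<subseteq> ?X" using HMX by (intro m(3)[OF flX]) simp
      show "?X \<subseteq> ?X \<sqinter>\<^bsub>?L\<^esub> (H \<inter> M)" using m(2) by blast
    qed
    moreover have "?X \<sqinter>\<^bsub>?L\<^esub> H = H"
    proof
      note m = meet_intersection_lattice[OF flX flH(1)]
      show "?X \<sqinter>\<^bsub>?L\<^esub> H \<subseteq> H" by (intro m(3)[OF flH(1)]) simp
      show "H \<subseteq> ?X \<sqinter>\<^bsub>?L\<^esub> H" using m(2) by blast
    qed
    moreover note XM = meet_intersection_lattice[OF flX M_flat]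
    ultimately have eq: "?X = H \<inter> (?X \<sqinter>\<^bsub>?L\<^esub> M)" using join_intersection_lattice[OF flH(1) XM(1)] by simp
    have "?X \<sqinter>\<^bsub>?L\<^esub> M \<noteq> UNIV"
    proof
      assume "?X \<sqinter>\<^bsub>?L\<^esub> M = UNIV"
      then have "H \<subseteq> H'" using eq by blast
      then show False using antichain H by blast
    qed
    then obtain H'' where H'': "H'' \<in> \<A>" "?X \<sqinter>\<^bsub>?L\<^esub> M \<subseteq> H''"
      using flats_eq_Inter[OF XM(1)] by blast
    have "M \<subseteq> H''" "?X \<subseteq> H''" using H''(2) XM(2) by blast+
    have "Up H'' \<subseteq> Up H"
    proof
      fix Y assume Y: "Y \<in> Up H''"
      then have "\<not> Y \<subseteq> M" using \<open>M \<subseteq> H''\<close> by (auto simp: Up_def)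
      then have "M \<subseteq> Y" using chain(2)[of Y M] Y MD by (auto simp: Up_def)
      then show "Y \<in> Up H" using Y M(1) by (auto simp: Up_def)
    qed
    moreover have "M \<notin> Up H''" using \<open>M \<subseteq> H''\<close> by (simp add: Up_def)
    ultimately have "Up H'' \<subset> Up H" using M(1) by blast
    then have "\<rho> H'' < \<rho> H" unfolding \<rho>_def using finUp by (intro psubset_card_mono)
    then show "\<exists>H''\<in>\<A>. \<rho> H'' < \<rho> H \<and> H \<inter> H' \<subseteq> H''" using H''(1) \<open>?X \<subseteq> H''\<close> by blast
  qed
  then show ?thesis by blast
qed

section \<open>A basis adapted to two chains of subspaces\<close>

text \<open>Vectors of \<open>P\<close> outside the span of \<open>Q\<close> are added one at a time.
  Each step preserves the assumption that \<open>P\<close> meets the span of \<open>Q\<close>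
  in the span of \<open>Q \<inter> P\<close>, and the dimension bounds the number of steps.\<close>

lemma adapted_extension:
  fixes Q P :: "('k::field ^ 'm::finite) set"
  assumes "vec.independent Q" "vec.subspace P" "P \<inter> vec.span Q \<subseteq> vec.span (Q \<inter> P)"
  shows "\<exists>N\<subseteq>P. vec.independent (Q \<union> N) \<and> P \<subseteq> vec.span ((Q \<union> N) \<inter> P)"
  using assms
proof (induction "vec.dim (UNIV :: ('k ^ 'm) set) - card Q" arbitrary: Q rule: less_induct)
  case less
  show ?case
  proof (cases "P \<subseteq> vec.span (Q \<inter> P)")
    case True
    then show ?thesis using less.prems by (intro exI[of _ "{}"]) simp
  next
    case False
    then obtain p where p: "p \<in> P" "p \<notin> vec.span Q" using less.prems(3) by blast
    then have pQ: "p \<notin> Q" using vec.span_base by auto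
    have ind: "vec.independent (insert p Q)" using p(2) less.prems(1) by (rule vec.independent_insertI)
    have "card (insert p Q) \<le> vec.dim (UNIV :: ('k ^ 'm) set)"
      using vec.independent_card_le_dim[OF _ ind] by blast
    then have smaller: "vec.dim (UNIV :: ('k ^ 'm) set) - card (insert p Q) < vec.dim (UNIV :: ('k ^ 'm) set) - card Q"
      using pQ vec.finiteI_independent[OF less.prems(1)] by simp
    have "P \<inter> vec.span (insert p Q) \<subseteq> vec.span (insert p Q \<inter> P)"
    proof
      fix x assume x: "x \<in> P \<inter> vec.span (insert p Q)"
      then obtain c where c: "x - c *s p \<in> vec.span Q" using vec.span_breakdown_eq by blast
      have "x - c *s p \<in> P" using x p(1) less.prems(2) by (simp add: vec.subspace_diff vec.subspace_scale)
      then have "x - c *s p \<in> vec.span (Q \<inter> P)" using c less.prems(3) by blast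
      then have "x \<in> vec.span (insert p (Q \<inter> P))" unfolding vec.span_breakdown_eq by blast
      then show "x \<in> vec.span (insert p Q \<inter> P)" using p(1) by simp
    qed
    from less.hyps[OF smaller ind less.prems(2) this] obtain N where
      "N \<subseteq> P" "vec.independent (insert p Q \<union> N)" "P \<subseteq> vec.span ((insert p Q \<union> N) \<inter> P)" by blast
    then show ?thesis using p(1) by (intro exI[of _ "insert p N"]) simp
  qed
qed

text \<open>Going up the chain \<open>D\<close>, a basis of \<open>c' \<inter> d\<close> and the part of
  the new basis found so far are completed to a basis of \<open>c \<inter> d\<close>; the
  modular law guarantees that no linear relation appears.\<close>

lemma adapted_extension_chain:
  fixes B c c' :: "('k::field ^ 'm::finite) set"
  assumes B: "vec.independent B" "B \<subseteq> c'" and c: "vec.subspace c" "vec.subspace c'" "c' \<subseteq> c"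
    and "finite D" "\<And>d. d \<in> D \<Longrightarrow> vec.subspace d" "\<And>d. d \<in> D \<Longrightarrow> c' \<inter> d \<subseteq> vec.span (B \<inter> d)"
    and "\<And>X Y. X \<in> D \<Longrightarrow> Y \<in> D \<Longrightarrow> X \<subseteq> Y \<or> Y \<subseteq> X"
  shows "\<exists>N\<subseteq>c \<inter> \<Union>D. vec.independent (B \<union> N) \<and> (\<forall>d\<in>D. c \<inter> d \<subseteq> vec.span ((B \<union> N) \<inter> d))"
  using assms(6-9)
proof (induction "card D" arbitrary: D)
  case 0
  then show ?case using B by (intro exI[of _ "{}"]) simp
next
  case (Suc k)
  then have "D \<noteq> {}" by auto
  then obtain d where d: "d \<in> D" "\<And>X. X \<in> D \<Longrightarrow> X \<subseteq> d"
    using finite_chain_greatest[OF Suc.prems(1) _ Suc.prems(4)] by blast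
  let ?D0 = "D - {d}"
  have "k = card ?D0" using Suc.hyps(2) d(1) Suc.prems(1) by simp
  then obtain N0 where N0: "N0 \<subseteq> c \<inter> \<Union>?D0" "vec.independent (B \<union> N0)"
      "\<And>e. e \<in> ?D0 \<Longrightarrow> c \<inter> e \<subseteq> vec.span ((B \<union> N0) \<inter> e)"
    using Suc.hyps(1)[of ?D0] Suc.prems by auto
  have N0d: "N0 \<subseteq> c \<inter> d" using N0(1) d(2) by blast
  have subP: "vec.subspace (c \<inter> d)" using c(1) Suc.prems(2)[OF d(1)] by (rule vec.subspace_inter)
  have "(c \<inter> d) \<inter> vec.span (B \<union> N0) \<subseteq> vec.span ((B \<union> N0) \<inter> (c \<inter> d))"
  proof
    fix x assume x: "x \<in> (c \<inter> d) \<inter> vec.span (B \<union> N0)"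
    then obtain u v where uv: "x = u + v" "u \<in> vec.span B" "v \<in> vec.span N0"
      unfolding vec.span_Un by blast
    have "v \<in> c \<inter> d" using vec.span_minimal[OF N0d subP] uv(3) by blast
    then have "u \<in> d" using x uv(1) vec.subspace_diff[OF subP, of x v] by auto
    moreover have "u \<in> c'" using vec.span_minimal[OF B(2) c(2)] uv(2) by blast
    ultimately have "u \<in> vec.span (B \<inter> d)" using Suc.prems(3)[OF d(1)] by blast
    moreover have "B \<inter> d \<subseteq> (B \<union> N0) \<inter> (c \<inter> d)" "N0 \<subseteq> (B \<union> N0) \<inter> (c \<inter> d)" using B(2) c(3) N0d by blast+
    ultimately have "u \<in> vec.span ((B \<union> N0) \<inter> (c \<inter> d))" "v \<in> vec.span ((B \<union> N0) \<inter> (c \<inter> d))"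
      using vec.span_mono uv(3) by blast+
    then show "x \<in> vec.span ((B \<union> N0) \<inter> (c \<inter> d))" unfolding uv(1) by (rule vec.span_add)
  qed
  from adapted_extension[OF N0(2) subP this] obtain N1 where N1: "N1 \<subseteq> c \<inter> d"
      "vec.independent ((B \<union> N0) \<union> N1)" "c \<inter> d \<subseteq> vec.span (((B \<union> N0) \<union> N1) \<inter> (c \<inter> d))" by blast
  show ?case
  proof (intro exI[of _ "N0 \<union> N1"] conjI ballI)
    show "N0 \<union> N1 \<subseteq> c \<inter> \<Union>D" using N0d N1(1) d(1) by blast
    show "vec.independent (B \<union> (N0 \<union> N1))" using N1(2) by (simp add: Un_assoc)
    fix e assume e: "e \<in> D"
    show "c \<inter> e \<subseteq> vec.span ((B \<union> (N0 \<union> N1)) \<inter> e)"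
    proof (cases "e = d")
      case True
      have "((B \<union> N0) \<union> N1) \<inter> (c \<inter> d) \<subseteq> (B \<union> (N0 \<union> N1)) \<inter> d" by blast
      then show ?thesis using N1(3) vec.span_mono True by blast
    next
      case False
      have "(B \<union> N0) \<inter> e \<subseteq> (B \<union> (N0 \<union> N1)) \<inter> e" by blast
      then show ?thesis using N0(3)[of e] e False vec.span_mono by blast
    qed
  qed
qed

lemma adapted_basis_cells:
  fixes C D :: "('k::field ^ 'm::finite) set set"
  assumes "finite C" "\<And>c. c \<in> C \<Longrightarrow> vec.subspace c" "\<And>X Y. X \<in> C \<Longrightarrow> Y \<in> C \<Longrightarrow> X \<subseteq> Y \<or> Y \<subseteq> X"
    and D: "finite D" "\<And>d. d \<in> D \<Longrightarrow> vec.subspace d" "\<And>X Y. X \<in> D \<Longrightarrow> Y \<in> D \<Longrightarrow> X \<subseteq> Y \<or> Y \<subseteq> X"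
      "UNIV \<in> D"
  shows "\<exists>B\<subseteq>\<Union>C. vec.independent B \<and> (\<forall>c\<in>C. \<forall>d\<in>D. c \<inter> d \<subseteq> vec.span (B \<inter> c \<inter> d))"
  using assms(1-3)
proof (induction "card C" arbitrary: C)
  case 0
  then show ?case by (intro exI[of _ "{}"]) (simp add: vec.independent_empty)
next
  case (Suc k)
  then have "C \<noteq> {}" by auto
  then obtain c where c: "c \<in> C" "\<And>X. X \<in> C \<Longrightarrow> X \<subseteq> c"
    using finite_chain_greatest[OF Suc.prems(1) _ Suc.prems(3)] by blast
  let ?C0 = "C - {c}"
  have "k = card ?C0" using Suc.hyps(2) c(1) Suc.prems(1) by simp
  then obtain B where B: "B \<subseteq> \<Union>?C0" "vec.independent B"
      "\<And>e d. e \<in> ?C0 \<Longrightarrow> d \<in> D \<Longrightarrow> e \<inter> d \<subseteq> vec.span (B \<inter> e \<inter> d)"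
    using Suc.hyps(1)[of ?C0] Suc.prems by auto
  have "\<exists>c'. vec.subspace c' \<and> c' \<subseteq> c \<and> B \<subseteq> c' \<and> (\<forall>d\<in>D. c' \<inter> d \<subseteq> vec.span (B \<inter> d))"
  proof (cases "?C0 = {}")
    case True
    then have "B = {}" using B(1) unfolding True by simp
    then show ?thesis
      using Suc.prems(2)[OF c(1)] by (intro exI[of _ "{0}"]) (auto simp: vec.subspace_0 vec.subspace_single_0)
  next
    case False
    have "\<exists>M\<in>?C0. \<forall>X\<in>?C0. X \<subseteq> M"
      using False Suc.prems(1) by (intro finite_chain_greatest) (auto dest: Suc.prems(3))
    then obtain c' where c': "c' \<in> ?C0" "\<And>X. X \<in> ?C0 \<Longrightarrow> X \<subseteq> c'" by blast
    have "c' \<inter> d \<subseteq> vec.span (B \<inter> d)" if "d \<in> D" for d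
    proof -
      have "B \<inter> c' \<inter> d \<subseteq> B \<inter> d" by blast
      then show ?thesis using B(3)[OF c'(1) that] vec.span_mono by blast
    qed
    moreover have "vec.subspace c'" "c' \<subseteq> c" using c'(1) c(2) Suc.prems(2) by simp_all
    moreover have "B \<subseteq> c'" using B(1) c'(2) by blast
    ultimately show ?thesis by blast
  qed
  then obtain c' where c': "vec.subspace c'" "c' \<subseteq> c" "B \<subseteq> c'" "\<And>d. d \<in> D \<Longrightarrow> c' \<inter> d \<subseteq> vec.span (B \<inter> d)"
    by blast
  obtain N where N: "N \<subseteq> c" "vec.independent (B \<union> N)" "\<And>d. d \<in> D \<Longrightarrow> c \<inter> d \<subseteq> vec.span ((B \<union> N) \<inter> d)"
    using adapted_extension_chain[OF B(2) c'(3) Suc.prems(2)[OF c(1)] c'(1,2) D(1,2) c'(4) D(3)] by blast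
  show ?case
  proof (intro exI[of _ "B \<union> N"] conjI ballI)
    show "B \<union> N \<subseteq> \<Union>C" using B(1) N(1) c(1) by blast
    show "vec.independent (B \<union> N)" by fact
    fix e d assume e: "e \<in> C" and d: "d \<in> D"
    show "e \<inter> d \<subseteq> vec.span ((B \<union> N) \<inter> e \<inter> d)"
    proof (cases "e = c")
      case True
      have "(B \<union> N) \<inter> d \<subseteq> (B \<union> N) \<inter> c \<inter> d" using c'(2,3) N(1) by blast
      then show ?thesis using N(3)[OF d] vec.span_mono True by blast
    next
      case False
      have "B \<inter> e \<inter> d \<subseteq> (B \<union> N) \<inter> e \<inter> d" by blast
      then show ?thesis using B(3)[of e d] e d False vec.span_mono by blast
    qed
  qed
qed

text \<open>The vectors of \<open>B\<close> are chosen along the cells \<open>c \<inter> d\<close> of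
  the two chains in lexicographic order, which is the argument behind the Zassenhaus lemma and
  the Bruhat decomposition. Adding the whole space to both chains makes every member of either
  chain a cell.\<close>

theorem adapted_basis:
  fixes C D :: "('k::field ^ 'm::finite) set set"
  assumes C: "finite C" "\<And>c. c \<in> C \<Longrightarrow> vec.subspace c" "\<And>X Y. X \<in> C \<Longrightarrow> Y \<in> C \<Longrightarrow> X \<subseteq> Y \<or> Y \<subseteq> X"
    and D: "finite D" "\<And>d. d \<in> D \<Longrightarrow> vec.subspace d" "\<And>X Y. X \<in> D \<Longrightarrow> Y \<in> D \<Longrightarrow> X \<subseteq> Y \<or> Y \<subseteq> X"
  shows "\<exists>B. vec.independent B \<and> vec.span B = UNIV \<and> (\<forall>X\<in>C \<union> D. vec.span (B \<inter> X) = X)"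
proof -
  have "\<exists>B\<subseteq>\<Union>(insert UNIV C). vec.independent B \<and>
      (\<forall>c\<in>insert UNIV C. \<forall>d\<in>insert UNIV D. c \<inter> d \<subseteq> vec.span (B \<inter> c \<inter> d))"
  proof (rule adapted_basis_cells)
    show "vec.subspace c" if "c \<in> insert UNIV C" for c using C(2) that by (auto simp: vec.subspace_UNIV)
    show "vec.subspace d" if "d \<in> insert UNIV D" for d using D(2) that by (auto simp: vec.subspace_UNIV)
    show "X \<subseteq> Y \<or> Y \<subseteq> X" if "X \<in> insert UNIV C" "Y \<in> insert UNIV C" for X Y using C(3) that by blast
    show "X \<subseteq> Y \<or> Y \<subseteq> X" if "X \<in> insert UNIV D" "Y \<in> insert UNIV D" for X Y using D(3) that by blast
  qed (use C(1) D(1) in auto)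
  then obtain B where B: "vec.independent B"
      and cells: "\<forall>c\<in>insert UNIV C. \<forall>d\<in>insert UNIV D. c \<inter> d \<subseteq> vec.span (B \<inter> c \<inter> d)" by blast
  have "vec.span B = UNIV" using cells by auto
  moreover have "vec.span (B \<inter> X) = X" if X: "X \<in> C \<union> D" for X
  proof
    show "vec.span (B \<inter> X) \<subseteq> X" using C(2) D(2) X by (intro vec.span_minimal) auto
    show "X \<subseteq> vec.span (B \<inter> X)" using cells X by auto
  qed
  ultimately show ?thesis using B by blast
qed

lemma span_Inter_independent:
  fixes B :: "('k::field ^ 'm::finite) set"
  assumes B: "vec.independent B" "vec.span B = UNIV" and F: "\<And>S. S \<in> F \<Longrightarrow> S \<subseteq> B"
  shows "vec.span (B \<inter> \<Inter>F) = \<Inter>(vec.span ` F)"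
proof
  show "vec.span (B \<inter> \<Inter>F) \<subseteq> \<Inter>(vec.span ` F)"
    by (intro INF_greatest vec.span_mono) blast
  show "\<Inter>(vec.span ` F) \<subseteq> vec.span (B \<inter> \<Inter>F)"
  proof
    fix x assume x: "x \<in> \<Inter>(vec.span ` F)"
    let ?r = "vec.representation B x"
    have "b \<in> S" if "?r b \<noteq> 0" "S \<in> F" for b S
    proof -
      have "?r = vec.representation S x"
        using x that(2) F by (intro vec.representation_extend[OF B(1)]) auto
      then show ?thesis using that(1) vec.representation_ne_zero by metis
    qed
    then have "b \<in> B \<inter> \<Inter>F" if "?r b \<noteq> 0" for b using that vec.representation_ne_zero by blast
    then have "(\<Sum>b | ?r b \<noteq> 0. ?r b *s b) \<in> vec.span (B \<inter> \<Inter>F)"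
      by (intro vec.span_sum vec.span_scale vec.span_base) blast
    moreover have "(\<Sum>b | ?r b \<noteq> 0. ?r b *s b) = x"
      using B by (intro vec.sum_nonzero_representation_eq) auto
    ultimately show "x \<in> vec.span (B \<inter> \<Inter>F)" by simp
  qed
qed

section \<open>Ranked arrangements are supersolvable\<close>

lemma subspace_flat:
  assumes hyp: "hyperplane_arrangement \<A>" and X: "X \<in> flats \<A>"
  shows "vec.subspace X"
proof -
  have "vec.subspace H" if "H \<in> \<A>" for H
    using hyp that unfolding hyperplane_arrangement_def
    by (auto simp: vec.subspace_def form_kernel_def)
  then show ?thesis using X unfolding flats_def by (auto intro: vec.subspace_Inter)
qed

text \<open>In an adapted basis \<open>B\<close> all members of both chains are spanned by subsets of
  \<open>B\<close>, and spans of subsets of \<open>B\<close> intersect and add like the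
  subsets themselves. It remains to see that the subspaces generated by the chains under
  intersection and sum are flats, since then lattice meets are sums. The unions of members of
  the two chains (the set \<open>K\<close> of clauses) span flats by modularity. Every set
  generated from the chains is an intersection of clauses (the set \<open>T\<close>, a
  conjunctive normal form), and intersections of flats are flats.\<close>

lemma distributive_on_of_modular_chain:
  fixes \<A> :: "('k::field ^ 'm::finite) set set"
  assumes hyp: "hyperplane_arrangement \<A>"
    and C: "order_chain (intersection_lattice \<A>) C" and D: "order_chain (intersection_lattice \<A>) D"
    and modular: "\<And>X Y. X \<in> D \<Longrightarrow> Y \<in> flats \<A> \<Longrightarrow> vec.span (X \<union> Y) \<in> flats \<A>"
  shows "distributive_on (intersection_lattice \<A>) (generated_sublattice (intersection_lattice \<A>) (C \<union> D))"
proof -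
  let ?L = "intersection_lattice \<A>"
  have finA: "finite \<A>" using hyp by (simp add: hyperplane_arrangement_def)
  have C': "C \<subseteq> flats \<A>" "\<And>X Y. X \<in> C \<Longrightarrow> Y \<in> C \<Longrightarrow> X \<subseteq> Y \<or> Y \<subseteq> X"
    and D': "D \<subseteq> flats \<A>" "\<And>X Y. X \<in> D \<Longrightarrow> Y \<in> D \<Longrightarrow> X \<subseteq> Y \<or> Y \<subseteq> X"
    using C D unfolding order_chain_intersection_lattice by blast+
  have sub: "vec.subspace X" if "X \<in> flats \<A>" for X using subspace_flat[OF hyp that] .
  have fin: "finite C" "finite D" using C'(1) D'(1) finite_flats[OF finA] finite_subset by blast+
  have "\<exists>B. vec.independent B \<and> vec.span B = UNIV \<and> (\<forall>X\<in>C \<union> D. vec.span (B \<inter> X) = X)"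
    using sub C' D' by (intro adapted_basis fin) auto
  then obtain B where B: "vec.independent B" "vec.span B = UNIV"
      and BX: "\<And>X. X \<in> C \<union> D \<Longrightarrow> vec.span (B \<inter> X) = X" by blast
  \<comment> \<open>the empty set stands for an absent member of either chain; the clause that is empty altogether is excluded, as its span need not be a flat\<close>
  define K where "K = {B \<inter> (c \<union> d) | c d. c \<in> insert {} C \<and> d \<in> insert {} D \<and> c \<union> d \<noteq> {}}"
  define T where "T = {B \<inter> \<Inter>F | F. F \<subseteq> K}"
  have KB: "S \<subseteq> B" if "S \<in> K" for S using that by (auto simp: K_def)
  have K_flat: "vec.span S \<in> flats \<A>" if SK: "S \<in> K" for S
  proof -
    obtain c d where cd: "S = B \<inter> (c \<union> d)" "c \<in> insert {} C" "d \<in> insert {} D" "c \<union> d \<noteq> {}"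
      using SK unfolding K_def by blast
    show ?thesis
    proof (cases "c = {} \<or> d = {}")
      case True
      then have "c \<union> d \<in> C \<union> D" using cd(2-4) by auto
      then show ?thesis using BX[of "c \<union> d"] C'(1) D'(1) unfolding cd(1) by auto
    next
      case False
      then have cd': "c \<in> C" "d \<in> D" using cd by auto
      have "vec.span S = vec.span (d \<union> c)"
      proof
        show "vec.span S \<subseteq> vec.span (d \<union> c)" unfolding cd(1) by (rule vec.span_mono) blast
        have "vec.span (B \<inter> c) \<subseteq> vec.span S" "vec.span (B \<inter> d) \<subseteq> vec.span S"
          unfolding cd(1) by (rule vec.span_mono, blast)+
        then have "d \<union> c \<subseteq> vec.span S" using BX[of c] BX[of d] cd' by simp
        then show "vec.span (d \<union> c) \<subseteq> vec.span S" by (rule vec.span_minimal) (rule vec.subspace_span)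
      qed
      then show ?thesis using modular[OF cd'(2)] cd'(1) C'(1) by auto
    qed
  qed
  have K_Un: "S \<union> S' \<in> K" if SS': "S \<in> K" "S' \<in> K" for S S'
  proof -
    obtain c d where cd: "S = B \<inter> (c \<union> d)" "c \<in> insert {} C" "d \<in> insert {} D" "c \<union> d \<noteq> {}"
      using SS'(1) unfolding K_def by blast
    obtain c' d' where cd': "S' = B \<inter> (c' \<union> d')" "c' \<in> insert {} C" "d' \<in> insert {} D"
      using SS'(2) unfolding K_def by blast
    have "c \<union> c' = c \<or> c \<union> c' = c'" using C'(2)[of c c'] cd(2) cd'(2) by blast
    then have 1: "c \<union> c' \<in> insert {} C" using cd(2) cd'(2) by metis
    have "d \<union> d' = d \<or> d \<union> d' = d'" using D'(2)[of d d'] cd(3) cd'(3) by blast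
    then have 2: "d \<union> d' \<in> insert {} D" using cd(3) cd'(3) by metis
    have "S \<union> S' = B \<inter> ((c \<union> c') \<union> (d \<union> d'))" unfolding cd(1) cd'(1) by blast
    then show ?thesis unfolding K_def using 1 2 cd(4) by blast
  qed
  have T_B: "S \<subseteq> B" if "S \<in> T" for S using that by (auto simp: T_def)
  have T_flat: "vec.span S \<in> flats \<A>" if "S \<in> T" for S
  proof -
    obtain F where F: "S = B \<inter> \<Inter>F" "F \<subseteq> K" using \<open>S \<in> T\<close> by (auto simp: T_def)
    have "vec.span S = \<Inter>(vec.span ` F)" unfolding F(1) using F(2) KB by (intro span_Inter_independent[OF B]) blast
    moreover have "vec.span ` F \<subseteq> flats \<A>" using F(2) K_flat by blast
    ultimately show ?thesis by (simp only: flats_Inter)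
  qed
  have T_Int: "S \<inter> S' \<in> T" if SS': "S \<in> T" "S' \<in> T" for S S'
  proof -
    obtain F F' where F: "S = B \<inter> \<Inter>F" "F \<subseteq> K" "S' = B \<inter> \<Inter>F'" "F' \<subseteq> K" using SS' by (auto simp: T_def)
    then have "S \<inter> S' = B \<inter> \<Inter>(F \<union> F')" "F \<union> F' \<subseteq> K" by blast+
    then show ?thesis unfolding T_def by blast
  qed
  have T_Un: "S \<union> S' \<in> T" if SS': "S \<in> T" "S' \<in> T" for S S'
  proof -
    obtain F F' where F: "S = B \<inter> \<Inter>F" "F \<subseteq> K" "S' = B \<inter> \<Inter>F'" "F' \<subseteq> K" using SS' by (auto simp: T_def)
    let ?G = "{f \<union> f' | f f'. f \<in> F \<and> f' \<in> F'}"
    have "S \<union> S' = B \<inter> \<Inter>?G" unfolding F(1,3) by blast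
    moreover have "?G \<subseteq> K" using F(2,4) K_Un by blast
    ultimately show ?thesis unfolding T_def by blast
  qed
  have join_T: "vec.span S \<squnion>\<^bsub>?L\<^esub> vec.span S' = vec.span (S \<inter> S')" if SS': "S \<in> T" "S' \<in> T" for S S'
  proof -
    have "vec.span (B \<inter> \<Inter>{S, S'}) = \<Inter>(vec.span ` {S, S'})"
      using SS' T_B by (intro span_Inter_independent[OF B]) auto
    moreover have "B \<inter> \<Inter>{S, S'} = S \<inter> S'" using T_B SS' by auto
    ultimately show ?thesis using join_intersection_lattice[OF T_flat[OF SS'(1)] T_flat[OF SS'(2)]] by simp
  qed
  have meet_T: "vec.span S \<sqinter>\<^bsub>?L\<^esub> vec.span S' = vec.span (S \<union> S')" if SS': "S \<in> T" "S' \<in> T" for S S'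
  proof
    note m = meet_intersection_lattice[OF T_flat[OF SS'(1)] T_flat[OF SS'(2)]]
    show "vec.span S \<sqinter>\<^bsub>?L\<^esub> vec.span S' \<subseteq> vec.span (S \<union> S')"
      by (rule m(3)[OF T_flat[OF T_Un[OF SS']]]) (simp add: vec.span_mono)
    have "S \<union> S' \<subseteq> vec.span S \<union> vec.span S'" using vec.span_superset by blast
    then show "vec.span (S \<union> S') \<subseteq> vec.span S \<sqinter>\<^bsub>?L\<^esub> vec.span S'"
      using m(2) by (intro vec.span_minimal sub[OF m(1)]) blast
  qed
  have gen: "\<exists>S\<in>T. X = vec.span S" if "X \<in> generated_sublattice ?L (C \<union> D)" for X
    using that
  proof induction
    case (generator X)
    then have "X \<noteq> {}" using sub C'(1) D'(1) vec.subspace_0 by blast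
    then have "B \<inter> X \<in> K" using generator unfolding K_def by blast
    then have "B \<inter> \<Inter>{B \<inter> X} \<in> T" unfolding T_def by blast
    then have "B \<inter> X \<in> T" by simp
    then show ?case using BX[OF generator] by auto
  next
    case (join X Y)
    then show ?case using join_T T_Int by metis
  next
    case (meet X Y)
    then show ?case using meet_T T_Un by metis
  qed
  show ?thesis
    unfolding distributive_on_def
  proof (intro ballI)
    fix X Y W assume XYW: "X \<in> generated_sublattice ?L (C \<union> D)" "Y \<in> generated_sublattice ?L (C \<union> D)"
      "W \<in> generated_sublattice ?L (C \<union> D)"
    obtain R S U where T: "R \<in> T" "S \<in> T" "U \<in> T" and eq: "X = vec.span R" "Y = vec.span S" "W = vec.span U"
      using gen[OF XYW(1)] gen[OF XYW(2)] gen[OF XYW(3)] by blast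
    show "X \<sqinter>\<^bsub>?L\<^esub> (Y \<squnion>\<^bsub>?L\<^esub> W) = (X \<sqinter>\<^bsub>?L\<^esub> Y) \<squnion>\<^bsub>?L\<^esub> (X \<sqinter>\<^bsub>?L\<^esub> W)"
      unfolding eq by (simp add: join_T meet_T T T_Int T_Un Un_Int_distrib)
  qed
qed

text \<open>The form of \<open>H''\<close> is a combination of the forms of \<open>H\<close> and
  \<open>H'\<close>, and the form of \<open>H'\<close> occurs in it because \<open>H''\<close>
  differs from \<open>H\<close>.\<close>

lemma modular_ranking_exchange:
  fixes \<A> :: "('k::field ^ 'm::finite) set set"
  assumes hyp: "hyperplane_arrangement \<A>" and rank: "modular_ranking \<A> \<rho>"
    and H: "H \<in> \<A>" "H' \<in> \<A>" "H \<noteq> H'" "\<rho> H = \<rho> H'"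
  shows "\<exists>H''\<in>\<A>. \<rho> H'' < \<rho> H \<and> H \<inter> H' \<subseteq> H'' \<and> H \<inter> H'' \<subseteq> H'"
proof -
  obtain H'' where H'': "H'' \<in> \<A>" "\<rho> H'' < \<rho> H" "H \<inter> H' \<subseteq> H''"
    using rank H unfolding modular_ranking_def by blast
  obtain \<alpha> \<alpha>' \<alpha>'' where forms: "H = form_kernel \<alpha>" "H' = form_kernel \<alpha>'" "H'' = form_kernel \<alpha>''" "\<alpha>'' \<noteq> 0"
    using hyp H(1,2) H''(1) unfolding hyperplane_arrangement_def by meson
  obtain c d where cd: "\<alpha>'' = c *s \<alpha> + d *s \<alpha>'" using form_kernel_Int_subsetD H''(3) forms by blast
  have "d \<noteq> 0"
  proof
    assume "d = 0"
    then have "form_kernel \<alpha> \<subseteq> form_kernel \<alpha>''" using cd by (auto simp: form_kernel_iff)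
    then have "H = H''" using form_kernel_subset_eqD forms by blast
    then show False using H''(2) by simp
  qed
  then have "H \<inter> H'' \<subseteq> H'" by (auto simp: forms cd form_kernel_iff)
  then show ?thesis using H'' by blast
qed

text \<open>The chain consists of \<open>X k\<close>, the intersection of the hyperplanes of rank less
  than \<open>k\<close>. It is maximal because \<open>X (k + 1)\<close> is cut out of \<open>X
  k\<close> by any single hyperplane of rank \<open>k\<close>. It is modular because the
  intersection \<open>?W k\<close> of all hyperplanes of rank less than \<open>k\<close> that
  contain \<open>Y\<close> is the sum of \<open>X k\<close> and \<open>Y\<close>: a vector
  \<open>w\<close> of \<open>?W k\<close> is moved into \<open>?W (k + 1)\<close>, \<open>?W
  (k + 2)\<close> and so on by vectors \<open>q\<close> supplied by the second ranking
  condition, and ends up in \<open>Y\<close>.\<close>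

theorem supersolvable_if_modular_ranking:
  fixes \<A> :: "('k::field ^ 'm::finite) set set"
  assumes hyp: "hyperplane_arrangement \<A>" and rank: "modular_ranking \<A> \<rho>"
  shows "supersolvable_arrangement \<A>"
proof -
  let ?L = "intersection_lattice \<A>"
  have finA: "finite \<A>" using hyp by (simp add: hyperplane_arrangement_def)
  note exchange = modular_ranking_exchange[OF hyp rank]
  have R2: "\<exists>v. v \<notin> H \<and> (\<forall>H'\<in>\<A>. \<rho> H' < \<rho> H \<longrightarrow> v \<in> H')" if "H \<in> \<A>" for H
  proof -
    have "\<not> \<Inter>{H'\<in>\<A>. \<rho> H' < \<rho> H} \<subseteq> H" using rank that unfolding modular_ranking_def by simp
    then show ?thesis by blast
  qed
  define X where "X k = \<Inter>{H\<in>\<A>. \<rho> H < k}" for k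
  have X_flat: "X k \<in> flats \<A>" for k unfolding X_def flats_def by blast
  have X_mono: "X k \<subseteq> X j" if "j \<le> k" for j k unfolding X_def using that by auto
  define top where "top = Suc (\<Sum>H\<in>\<A>. \<rho> H)"
  have top: "\<rho> H < top" if "H \<in> \<A>" for H
    using member_le_sum[OF that, of \<rho>] finA by (simp add: top_def)
  have sub: "vec.subspace Y" if "Y \<in> flats \<A>" for Y using subspace_flat[OF hyp that] .
  have move: "\<exists>t. u - t *s q \<in> H" if H: "H \<in> \<A>" and q: "q \<notin> H" for u q H
  proof -
    obtain \<alpha> where \<alpha>: "H = form_kernel \<alpha>" using hyp H unfolding hyperplane_arrangement_def by blast
    then have "u - (\<alpha> \<cdot> u / (\<alpha> \<cdot> q)) *s q \<in> H" using q by (simp add: form_kernel_iff)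
    then show ?thesis by blast
  qed
  have modular: "vec.span (X k \<union> Y) \<in> flats \<A>" if Y: "Y \<in> flats \<A>" for k Y
  proof -
    let ?W = "\<lambda>j. \<Inter>{H\<in>\<A>. \<rho> H < j \<and> Y \<subseteq> H}"
    have W_flat: "?W j \<in> flats \<A>" for j unfolding flats_def by blast
    have lift: "\<exists>w'\<in>?W (k + d). w' - w \<in> X k" if w: "w \<in> ?W k" for d w
    proof (induction d)
      case 0
      then show ?case using w vec.subspace_0[OF sub[OF X_flat]] by (intro bexI[of _ w]) auto
    next
      case (Suc d)
      let ?j = "k + d"
      from Suc obtain w' where w': "w' \<in> ?W ?j" "w' - w \<in> X k" by blast
      show ?case
      proof (cases "\<exists>H\<in>\<A>. \<rho> H = ?j \<and> Y \<subseteq> H")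
        case False
        then have "w' \<in> ?W (Suc ?j)" using w'(1) by (auto simp: less_Suc_eq)
        then show ?thesis using w'(2) by auto
      next
        case True
        then obtain H where H: "H \<in> \<A>" "\<rho> H = ?j" "Y \<subseteq> H" by blast
        obtain q where q: "q \<notin> H" "\<forall>H'\<in>\<A>. \<rho> H' < \<rho> H \<longrightarrow> q \<in> H'" using R2[OF H(1)] by blast
        obtain t where t: "w' - t *s q \<in> H" using move[OF H(1) q(1)] by blast
        have low: "w' - t *s q \<in> H'" if "H' \<in> \<A>" "\<rho> H' < ?j" "Y \<subseteq> H'" for H'
        proof -
          have "w' \<in> H'" "q \<in> H'" using w'(1) q(2) H(2) that by auto
          then show ?thesis using sub[OF flats_hyperplane[OF that(1)]] by (simp add: vec.subspace_diff vec.subspace_scale)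
        qed
        \<comment> \<open>all hyperplanes of rank \<open>?j\<close> through Y are corrected at once, since they differ from H by hyperplanes of smaller rank\<close>
        have "w' - t *s q \<in> H'" if H': "H' \<in> \<A>" "\<rho> H' = ?j" "Y \<subseteq> H'" for H'
        proof (cases "H = H'")
          case False
          then obtain H'' where "H'' \<in> \<A>" "\<rho> H'' < \<rho> H" "H \<inter> H' \<subseteq> H''" "H \<inter> H'' \<subseteq> H'"
            using exchange[OF H(1) H'(1)] H(2) H'(2) by auto
          then show ?thesis using low[of H''] H(2,3) H'(3) t by auto
        qed (use t in auto)
        then have "w' - t *s q \<in> ?W (Suc ?j)" using low by (auto simp: less_Suc_eq)
        moreover have "q \<in> X k" using q(2) H(2) by (auto simp: X_def)
        then have "(w' - w) - t *s q \<in> X k"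
          using w'(2) sub[OF X_flat] by (simp add: vec.subspace_diff vec.subspace_scale)
        then have "(w' - t *s q) - w \<in> X k" by (simp add: algebra_simps)
        ultimately show ?thesis by auto
      qed
    qed
    have "?W k \<subseteq> vec.span (X k \<union> Y)"
    proof
      fix w assume "w \<in> ?W k"
      then obtain w' where w': "w' \<in> ?W (k + top)" "w' - w \<in> X k" using lift by blast
      have "w' \<in> \<Inter>{H \<in> \<A>. Y \<subseteq> H}" using w'(1) top by (auto simp: trans_less_add2)
      then have "w' \<in> Y" using flats_eq_Inter[OF Y] by simp
      then have "w' - (w' - w) \<in> vec.span (X k \<union> Y)" using w'(2) by (intro vec.span_diff vec.span_base) auto
      then show "w \<in> vec.span (X k \<union> Y)" by simp
    qed
    moreover have "vec.span (X k \<union> Y) \<subseteq> ?W k"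
      by (rule vec.span_minimal[OF _ sub[OF W_flat]]) (auto simp: X_def)
    ultimately have "vec.span (X k \<union> Y) = ?W k" by blast
    then show ?thesis using W_flat by simp
  qed
  let ?D = "range X"
  have chain: "order_chain ?L ?D"
    unfolding order_chain_intersection_lattice
  proof (intro conjI ballI)
    show "?D \<subseteq> flats \<A>" using X_flat by blast
    fix Y Z assume "Y \<in> ?D" "Z \<in> ?D"
    then obtain j k where "Y = X j" "Z = X k" by blast
    then show "Y \<subseteq> Z \<or> Z \<subseteq> Y" using X_mono[of j k] X_mono[of k j] linear[of j k] by blast
  qed
  have "maximal_order_chain ?L ?D"
    unfolding maximal_order_chain_def
  proof (intro conjI chain allI impI equalityI)
    fix C' assume C': "order_chain ?L C' \<and> ?D \<subseteq> C'"
    show "?D \<subseteq> C'" using C' by blast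
    show "C' \<subseteq> ?D"
    proof
      fix Y assume Y: "Y \<in> C'"
      have Yf: "Y \<in> flats \<A>" and comp: "\<And>k. Y \<subseteq> X k \<or> X k \<subseteq> Y"
        using C' Y unfolding order_chain_intersection_lattice by blast+
      show "Y \<in> ?D"
      proof (cases "\<forall>k. Y \<subseteq> X k")
        case True
        have "X top \<subseteq> Y" using flats_eq_Inter[OF Yf] top by (auto simp: X_def)
        then show ?thesis using True by blast
      next
        case False
        define k where "k = (LEAST k. \<not> Y \<subseteq> X k)"
        have k: "\<not> Y \<subseteq> X k" "\<And>j. j < k \<Longrightarrow> Y \<subseteq> X j"
          using False LeastI_ex[of "\<lambda>k. \<not> Y \<subseteq> X k"] not_less_Least unfolding k_def by blast+
        have "k \<noteq> 0" using k(1) by (auto simp: X_def)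
        then obtain j where j: "k = Suc j" using not0_implies_Suc by blast
        have Yj: "Y \<subseteq> X j" and kY: "X k \<subseteq> Y" using k comp j by auto
        obtain H where H: "H \<in> \<A>" "\<rho> H < k" "\<not> Y \<subseteq> H" using k(1) by (auto simp: X_def)
        have rH: "\<rho> H = j"
        proof (rule ccontr)
          assume "\<rho> H \<noteq> j"
          then have "X j \<subseteq> H" using H(1,2) j by (auto simp: X_def)
          then show False using H(3) Yj by blast
        qed
        have step: "X j \<inter> H \<subseteq> X k"
        proof -
          have "X j \<inter> H \<subseteq> H'" if H': "H' \<in> \<A>" "\<rho> H' < Suc j" for H'
          proof (cases "\<rho> H' = j \<and> H' \<noteq> H")
            case True
            then obtain H'' where H'': "H'' \<in> \<A>" "\<rho> H'' < \<rho> H" "H \<inter> H'' \<subseteq> H'"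
              using exchange[OF H(1) H'(1)] rH by auto
            then have "X j \<subseteq> H''" using rH by (auto simp: X_def)
            then show ?thesis using H''(3) by blast
          next
            case False
            then show ?thesis using H' by (auto simp: X_def less_Suc_eq)
          qed
          then show ?thesis unfolding j X_def[of "Suc j"] by blast
        qed
        obtain v where v: "v \<in> Y" "v \<notin> H" using H(3) by blast
        have "X j \<subseteq> Y"
        proof
          fix u assume u: "u \<in> X j"
          obtain t where t: "u - t *s v \<in> H" using move[OF H(1) v(2)] by blast
          have "u - t *s v \<in> X j"
            using u v(1) Yj sub[OF X_flat[of j]] by (auto intro!: vec.subspace_diff vec.subspace_scale)
          then have "u - t *s v \<in> Y" using t step kY by blast
          then have "(u - t *s v) + t *s v \<in> Y"
            using v(1) sub[OF Yf] by (intro vec.subspace_add vec.subspace_scale)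
          then show "u \<in> Y" by simp
        qed
        then show ?thesis using Yj by blast
      qed
    qed
  qed
  moreover have "distributive_on ?L (generated_sublattice ?L (C \<union> ?D))" if "order_chain ?L C" for C
    using modular by (intro distributive_on_of_modular_chain[OF hyp that chain]) auto
  ultimately show ?thesis
    unfolding supersolvable_arrangement_def supersolvable_lattice_def
    using lattice_intersection_lattice finite_flats[OF finA] by auto
qed

section \<open>Induced paths\<close>

text \<open>The form in which induced paths are used: adjacency of two vertices of the path is decided
  by their positions.\<close>

lemma induced_path_iff:
  assumes E: "E \<subseteq> nsets V 2"
  shows "induced_path V E vs \<longleftrightarrow> vs \<noteq> [] \<and> distinct vs \<and> set vs \<subseteq> V \<and>
    (\<forall>i j. i < j \<and> j < length vs \<longrightarrow> ({vs ! i, vs ! j} \<in> E \<longleftrightarrow> j = Suc i))" (is "_ \<longleftrightarrow> ?rhs")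
proof
  assume p: "induced_path V E vs"
  then have d: "distinct vs" and e: "induced_edges (set vs) E = path_edges vs"
    by (auto simp: induced_path_def)
  have "{vs ! i, vs ! j} \<in> E \<longleftrightarrow> j = Suc i" if ij: "i < j" "j < length vs" for i j
  proof
    assume "{vs ! i, vs ! j} \<in> E"
    then have "{vs ! i, vs ! j} \<in> path_edges vs"
      using ij by (auto simp: induced_edges_def simp flip: e)
    then obtain k where k: "{vs ! i, vs ! j} = {vs ! k, vs ! Suc k}" "Suc k < length vs"
      by (auto simp: path_edges_def)
    then show "j = Suc i"
      using ij nth_eq_iff_index_eq[OF d] unfolding doubleton_eq_iff by auto
  next
    assume "j = Suc i"
    then have "{vs ! i, vs ! j} \<in> induced_edges (set vs) E"
      using ij unfolding e path_edges_def by blast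
    then show "{vs ! i, vs ! j} \<in> E" by (simp add: induced_edges_def)
  qed
  then show ?rhs using p by (simp add: induced_path_def)
next
  assume r: ?rhs
  have "induced_edges (set vs) E = path_edges vs"
  proof (intro equalityI subsetI)
    fix e assume e: "e \<in> induced_edges (set vs) E"
    then obtain a b where ab: "e = {a, b}" "a \<noteq> b"
      using E by (auto simp: induced_edges_def elim!: nsets2_E)
    then obtain i j where ij: "a = vs ! i" "b = vs ! j" "i < length vs" "j < length vs"
      using e by (auto simp: induced_edges_def in_set_conv_nth)
    then consider "i < j" | "j < i" using ab(2) by (metis linorder_neqE_nat)
    then show "e \<in> path_edges vs"
    proof cases
      case 1
      then have "j = Suc i" using r e ij ab by (auto simp: induced_edges_def)
      then show ?thesis using ab ij unfolding path_edges_def by blast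
    next
      case 2
      have "{vs ! j, vs ! i} \<in> E" using e ij ab by (simp add: induced_edges_def insert_commute)
      then have "i = Suc j" using r 2 ij by blast
      then show ?thesis using ab ij unfolding path_edges_def by (auto simp: insert_commute)
    qed
  next
    fix e assume "e \<in> path_edges vs"
    then obtain i where i: "e = {vs ! i, vs ! Suc i}" "Suc i < length vs" unfolding path_edges_def by blast
    then have "e \<in> E" using r by simp
    then show "e \<in> induced_edges (set vs) E" using i by (simp add: induced_edges_def)
  qed
  then show "induced_path V E vs" using r by (simp add: induced_path_def)
qed

text \<open>The inner vertices of a walk from \<open>s\<close> to \<open>t\<close> are required to lie
  in \<open>M\<close>; repetitions are allowed.\<close>

definition walk :: "'v set set \<Rightarrow> 'v set \<Rightarrow> 'v \<Rightarrow> 'v \<Rightarrow> 'v list \<Rightarrow> bool" where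
  "walk E M s t vs \<longleftrightarrow> vs \<noteq> [] \<and> vs ! 0 = s \<and> vs ! (length vs - 1) = t \<and>
     (\<forall>i. Suc i < length vs \<longrightarrow> {vs ! i, vs ! Suc i} \<in> E) \<and>
     (\<forall>i. 0 < i \<and> Suc i < length vs \<longrightarrow> vs ! i \<in> M)"

lemma walk_shortcut:
  assumes w: "walk E M s t vs" and ab: "a < b" "b < length vs"
    and junction: "if a = 0 then vs ! b = s else {vs ! (a - 1), vs ! b} \<in> E"
  shows "walk E M s t (take a vs @ drop b vs)"
proof -
  let ?us = "take a vs @ drop b vs"
  have len: "length ?us = a + (length vs - b)" using ab by simp
  have nth: "?us ! i = (if i < a then vs ! i else vs ! (b + (i - a)))" if "i < length ?us" for i
    using that ab by (auto simp: nth_append)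
  show ?thesis
    unfolding walk_def
  proof (intro conjI allI impI)
    show "?us \<noteq> []" using ab by simp
    show "?us ! 0 = s" using nth[of 0] len ab w junction by (auto simp: walk_def)
    have "b + (length ?us - 1 - a) = length vs - 1" using len ab by simp
    then show "?us ! (length ?us - 1) = t" using nth[of "length ?us - 1"] len ab w by (auto simp: walk_def)
  next
    fix i assume i: "Suc i < length ?us"
    consider "Suc i < a" | "Suc i = a" | "a \<le> i" by linarith
    then show "{?us ! i, ?us ! Suc i} \<in> E"
    proof cases
      case 1
      then show ?thesis using nth[of i] nth[of "Suc i"] i w ab by (simp add: walk_def)
    next
      case 2
      then show ?thesis using nth[of i] nth[of "Suc i"] i junction by (auto split: if_splits)
    next
      case 3
      then have "{vs ! (b + (i - a)), vs ! Suc (b + (i - a))} \<in> E"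
        using w i len unfolding walk_def by auto
      then show ?thesis using nth[of i] nth[of "Suc i"] i 3 by (simp add: Suc_diff_le)
    qed
  next
    fix i assume i: "0 < i \<and> Suc i < length ?us"
    show "?us ! i \<in> M"
    proof (cases "i < a")
      case True
      then show ?thesis using nth[of i] i w ab by (auto simp: walk_def)
    next
      case False
      then have "b + (i - a) > 0" "Suc (b + (i - a)) < length vs" using i len ab by auto
      then have "vs ! (b + (i - a)) \<in> M" using w unfolding walk_def by blast
      then show ?thesis using nth[of i] i False by simp
    qed
  qed
qed

text \<open>A shortest walk is an induced path.\<close>

lemma induced_path_of_walk:
  assumes E: "E \<subseteq> nsets V 2" and w: "walk E M s t us" and M: "M \<subseteq> V" "s \<in> V" "t \<in> V"
  shows "\<exists>vs. walk E M s t vs \<and> induced_path V E vs"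
proof -
  obtain vs where vs: "walk E M s t vs" and shortest: "\<And>us. walk E M s t us \<Longrightarrow> length vs \<le> length us"
    using w arg_min_nat_lemma[of "walk E M s t" us length] by blast
  have no_shortcut: False
    if "a < b" "b < length vs" "if a = 0 then vs ! b = s else {vs ! (a - 1), vs ! b} \<in> E" for a b
    using shortest[OF walk_shortcut[OF vs that]] that(1,2) by simp
  have "vs ! i \<noteq> vs ! j" if ij: "i < j" "j < length vs" for i j
  proof
    assume eq: "vs ! i = vs ! j"
    show False
    proof (rule no_shortcut[OF ij])
      have "i \<noteq> 0 \<Longrightarrow> {vs ! (i - 1), vs ! i} \<in> E"
        using vs ij unfolding walk_def by (metis Suc_pred' less_trans neq0_conv)
      then show "if i = 0 then vs ! j = s else {vs ! (i - 1), vs ! j} \<in> E"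
        using eq vs by (auto simp: walk_def)
    qed
  qed
  then have "distinct vs" unfolding distinct_conv_nth by (metis linorder_neqE_nat)
  moreover have "{vs ! i, vs ! j} \<in> E \<longleftrightarrow> j = Suc i" if ij: "i < j" "j < length vs" for i j
  proof
    assume "{vs ! i, vs ! j} \<in> E"
    then show "j = Suc i" using no_shortcut[of "Suc i" j] ij by fastforce
  qed (use vs ij in \<open>auto simp: walk_def\<close>)
  moreover have "set vs \<subseteq> V"
  proof
    fix v assume "v \<in> set vs"
    then obtain i where i: "v = vs ! i" "i < length vs" by (auto simp: in_set_conv_nth)
    consider "i = 0" | "i = length vs - 1" | "0 < i" "Suc i < length vs" using i(2) by linarith
    then show "v \<in> V" using vs M i(1) unfolding walk_def by cases auto
  qed
  moreover have "vs \<noteq> []" using vs by (simp add: walk_def)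
  ultimately show ?thesis using vs unfolding induced_path_iff[OF E] by blast
qed

definition adj_in :: "'v set set \<Rightarrow> 'v set \<Rightarrow> ('v \<times> 'v) set" where
  "adj_in E M = {(u, v). u \<in> M \<and> v \<in> M \<and> {u, v} \<in> E}"

definition connected_from :: "'v set set \<Rightarrow> 'v \<Rightarrow> 'v set \<Rightarrow> bool" where
  "connected_from E a M \<longleftrightarrow> a \<in> M \<and> (\<forall>v\<in>M. (a, v) \<in> (adj_in E M)\<^sup>*)"

lemma walk_snoc:
  assumes "walk E M s u vs" "u \<in> M" "{u, t} \<in> E" "length vs \<ge> 2"
  shows "walk E M s t (vs @ [t])"
proof -
  have last: "vs ! i = u" if "Suc i = length vs" for i
  proof -
    have "i = length vs - 1" using that by simp
    then show ?thesis using assms(1) by (simp add: walk_def)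
  qed
  show ?thesis using assms last unfolding walk_def by (auto simp: nth_append less_Suc_eq)
qed

lemma walk_of_reachable:
  assumes "(u, v) \<in> (adj_in E M)\<^sup>*" "u \<in> M" "{s, u} \<in> E"
  shows "\<exists>vs. walk E M s v vs \<and> v \<in> M \<and> length vs \<ge> 2"
  using assms
proof (induction rule: rtrancl_induct)
  case base
  then show ?case by (intro exI[of _ "[s, u]"]) (auto simp: walk_def less_Suc_eq)
next
  case (step v v')
  then obtain vs where vs: "walk E M s v vs" "v \<in> M" "length vs \<ge> 2" by blast
  have "{v, v'} \<in> E" "v' \<in> M" using step.hyps(2) by (auto simp: adj_in_def)
  then have "walk E M s v' (vs @ [v'])" using walk_snoc[OF vs(1,2) _ vs(3)] by blast
  then show ?case using \<open>v' \<in> M\<close> vs(3) by (intro exI[of _ "vs @ [v']"]) simp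
qed

lemma induced_path_through_connected:
  assumes E: "E \<subseteq> nsets V 2" and M: "connected_from E a M" "M \<subseteq> V"
    and st: "s \<in> V" "t \<in> V" "s \<noteq> t" "{s, t} \<notin> E"
    and u: "u \<in> M" "{s, u} \<in> E" and v: "v \<in> M" "{v, t} \<in> E"
  shows "\<exists>vs. induced_path V E vs \<and> walk E M s t vs \<and> length vs \<ge> 3"
proof -
  have "sym (adj_in E M)" by (auto simp: sym_def adj_in_def insert_commute)
  then have "(u, a) \<in> (adj_in E M)\<^sup>*" using M(1) u(1) unfolding connected_from_def by (metis symE sym_rtrancl)
  then have "(u, v) \<in> (adj_in E M)\<^sup>*" using M(1) v(1) unfolding connected_from_def by (metis rtrancl_trans)
  then obtain us where us: "walk E M s v us" "length us \<ge> 2" using walk_of_reachable[OF _ u] by blast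
  obtain vs where vs: "walk E M s t vs" "induced_path V E vs"
    using induced_path_of_walk[OF E walk_snoc[OF us(1) v us(2)] M(2) st(1,2)] by blast
  have "length vs \<ge> 3"
  proof (rule ccontr)
    assume "\<not> length vs \<ge> 3"
    moreover have "length vs > 0" using vs(1) by (simp add: walk_def)
    ultimately have "length vs = 1 \<or> length vs = 2" by linarith
    then show False using vs(1) st(3,4) by (auto simp: walk_def)
  qed
  then show ?thesis using vs by blast
qed

section \<open>Chordal graphs\<close>

text \<open>A nonadjacent pair \<open>s\<close>, \<open>t\<close> would be joined by an induced path
  through \<open>M\<close>, and together with \<open>r\<close> this path would be a chordless
  cycle of length at least four.\<close>

lemma chordal_separator_edge:
  assumes E: "E \<subseteq> nsets V 2" and ch: "chordal E" and M: "connected_from E a M" "M \<subseteq> V"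
    and st: "s \<in> V" "t \<in> V" "s \<noteq> t" "s \<notin> M" "t \<notin> M"
    and u: "u \<in> M" "{s, u} \<in> E" and v: "v \<in> M" "{v, t} \<in> E"
    and r: "r \<notin> M" "{r, s} \<in> E" "{t, r} \<in> E" "\<And>m. m \<in> M \<Longrightarrow> {r, m} \<notin> E"
  shows "{s, t} \<in> E"
proof (rule ccontr)
  assume "{s, t} \<notin> E"
  then obtain vs where vs: "induced_path V E vs" "walk E M s t vs" "length vs \<ge> 3"
    using induced_path_through_connected[OF E M st(1-3) _ u v] by blast
  note ip = vs(1)[unfolded induced_path_iff[OF E]]
  let ?n = "length vs" let ?cs = "vs @ [r]"
  have ends: "vs ! 0 = s" "vs ! (?n - 1) = t" and int: "\<And>i. 0 < i \<Longrightarrow> Suc i < ?n \<Longrightarrow> vs ! i \<in> M"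
    using vs(2) by (auto simp: walk_def)
  have no_loop: "{x} \<notin> E" for x using E by (auto simp: nsets_def)
  have place: "i = 0 \<or> i = ?n - 1 \<or> vs ! i \<in> M" if "i < ?n" for i
    using int[of i] that by linarith
  have r_nb: "i = 0 \<or> i = ?n - 1" if "i < ?n" "{r, vs ! i} \<in> E" for i
    using place[OF that(1)] r(4) that(2) by blast
  have r_vs: "r \<notin> set vs"
  proof
    assume "r \<in> set vs"
    then obtain i where i: "r = vs ! i" "i < ?n" by (auto simp: in_set_conv_nth)
    have "r \<noteq> s" "r \<noteq> t" using r(2,3) no_loop by auto
    then show False using place[OF i(2)] r(1) i ends by auto
  qed
  have edges: "cycle_edges ?cs = path_edges vs \<union> {{t, r}, {r, s}}"
  proof (intro equalityI subsetI)
    fix e assume "e \<in> cycle_edges ?cs"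
    then obtain i where i: "e = {?cs ! i, ?cs ! (Suc i mod Suc ?n)}" "i < Suc ?n" by (auto simp: cycle_edges_def)
    consider "Suc i < ?n" | "Suc i = ?n" | "i = ?n" using i(2) by linarith
    then show "e \<in> path_edges vs \<union> {{t, r}, {r, s}}"
    proof cases
      case 1
      then have "e = {vs ! i, vs ! Suc i}" using i by (simp add: nth_append)
      then show ?thesis using 1 unfolding path_edges_def by blast
    next
      case 2
      then have "i = ?n - 1" by simp
      then have "e = {t, r}" using i 2 ends by (simp add: nth_append)
      then show ?thesis by simp
    next
      case 3
      moreover have "vs \<noteq> []" using vs(3) by auto
      ultimately have "e = {r, s}" using i ends by (simp add: nth_append)
      then show ?thesis by simp
    qed
  next
    fix e assume "e \<in> path_edges vs \<union> {{t, r}, {r, s}}"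
    then consider i where "e = {vs ! i, vs ! Suc i}" "Suc i < ?n" | "e = {t, r}" | "e = {r, s}"
      unfolding path_edges_def by blast
    then have "\<exists>i<Suc ?n. e = {?cs ! i, ?cs ! (Suc i mod Suc ?n)}"
    proof cases
      case (1 i)
      then show ?thesis by (intro exI[of _ i]) (simp add: nth_append)
    next
      case 2
      then show ?thesis using vs(3) ends by (intro exI[of _ "?n - 1"]) (auto simp: nth_append)
    next
      case 3
      moreover have "vs \<noteq> []" using vs(3) by auto
      ultimately show ?thesis using ends by (intro exI[of _ "?n"]) (simp add: nth_append)
    qed
    then show "e \<in> cycle_edges ?cs" by (auto simp: cycle_edges_def)
  qed
  have "path_edges vs \<subseteq> E" using ip by (auto simp: path_edges_def)
  then have cyc: "is_cycle E ?cs \<and> length ?cs \<ge> 4" using vs(3) ip r_vs r(2,3) by (simp add: is_cycle_def edges)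
  then obtain x y where xy: "x \<in> set ?cs" "y \<in> set ?cs" "{x, y} \<in> E" "{x, y} \<notin> cycle_edges ?cs"
    using ch cyc unfolding chordal_def by blast
  have r_edge: "{r, z} \<in> cycle_edges ?cs" if z: "z \<in> set vs" "{r, z} \<in> E" for z
  proof -
    obtain i where "z = vs ! i" "i < ?n" using z(1) unfolding in_set_conv_nth by blast
    then have "z = s \<or> z = t" using r_nb[of i] z(2) ends by auto
    then show ?thesis unfolding edges by (auto simp: insert_commute)
  qed
  show False
  proof (cases "x = r \<or> y = r")
    case True
    moreover have "x \<noteq> y" using xy(3) no_loop by auto
    ultimately consider "x = r" "y \<in> set vs" | "y = r" "x \<in> set vs" using xy(1,2) by auto
    then show False
    proof cases
      case 1
      then show False using r_edge[of y] xy(3,4) by simp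
    next
      case 2
      then show False using r_edge[of x] xy(3,4) by (simp add: insert_commute)
    qed
  next
    case False
    then have "{x, y} \<in> path_edges vs"
      using vs(1) xy by (auto simp: induced_path_def induced_edges_def)
    then show False using xy(4) edges by blast
  qed
qed

text \<open>A form of Dirac's theorem that is suited to induction. Let \<open>a\<close> be a vertex of
  the clique. If \<open>a\<close> is adjacent to all other vertices, it can be removed.
  Otherwise take a connected set \<open>M\<close> containing \<open>a\<close> which is maximal
  among those with \<open>M \<union> N(M) \<noteq> W\<close>. By maximality every vertex of
  \<open>N(M)\<close> is adjacent to all vertices of the rest \<open>R\<close>, so chordality
  makes \<open>N(M)\<close> a clique. The induction hypothesis for \<open>R \<union>
  N(M)\<close> gives a simplicial vertex in \<open>R\<close>. All its neighbours are in
  \<open>R \<union> N(M)\<close>, and it is not in \<open>K\<close> because it is not adjacent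
  to \<open>a\<close>.\<close>

theorem simplicial_vertex_outside_clique:
  assumes E: "E \<subseteq> nsets V 2" and ch: "chordal E"
    and "finite W" "W \<subseteq> V" "K \<subset> W" "clique K E"
  shows "\<exists>v\<in>W - K. clique {u \<in> W. {u, v} \<in> E} E"
  using assms(3-)
proof (induction "card W" arbitrary: W K rule: less_induct)
  case less
  have no_loop: "{x} \<notin> E" for x using E by (auto simp: nsets_def)
  show ?case
  proof (cases "\<exists>w. W = {w}")
    case True
    then obtain w where w: "W = {w}" by blast
    then have "clique {u \<in> W. {u, w} \<in> E} E" by (auto simp: clique_def)
    moreover have "w \<in> W - K" using w less.prems(3) by blast
    ultimately show ?thesis by blast
  next
    case not_single: False
    obtain w0 where w0: "w0 \<in> W" using less.prems(3) by blast
    \<comment> \<open>an empty clique is replaced by a single vertex\<close>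
    define K' where "K' = (if K = {} then {w0} else K)"
    have K': "K' \<subset> W" "clique K' E" "K \<subseteq> K'" "K' \<noteq> {}"
      using less.prems(3,4) w0 not_single by (auto simp: K'_def clique_def)
    then obtain a where a: "a \<in> K'" by blast
    have aW: "a \<in> W" using a K'(1) by blast
    show ?thesis
    proof (cases "\<forall>w\<in>W - {a}. {a, w} \<in> E")
      case universal: True
      have "card (W - {a}) < card W" using aW less.prems(1) by (intro psubset_card_mono) auto
      moreover have "K' - {a} \<subset> W - {a}" using K'(1) a by blast
      moreover have "clique (K' - {a}) E" using K'(2) by (auto simp: clique_def)
      ultimately obtain v where v: "v \<in> (W - {a}) - (K' - {a})" "clique {u \<in> W - {a}. {u, v} \<in> E} E"
        using less.hyps[of "W - {a}" "K' - {a}"] less.prems(1,2) by blast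
      have "clique {u \<in> W. {u, v} \<in> E} E"
        unfolding clique_def
      proof (intro ballI impI)
        fix x y assume xy: "x \<in> {u \<in> W. {u, v} \<in> E}" "y \<in> {u \<in> W. {u, v} \<in> E}" "x \<noteq> y"
        show "{x, y} \<in> E"
        proof (cases "x = a \<or> y = a")
          case True
          then show ?thesis using universal xy by (auto simp: insert_commute)
        next
          case False
          then show ?thesis using v(2) xy by (auto simp: clique_def)
        qed
      qed
      then show ?thesis using v(1) K'(3) by blast
    next
      case False
      define nb where "nb M = {w \<in> W - M. \<exists>m\<in>M. {m, w} \<in> E}" for M
      define good where "good M \<longleftrightarrow> M \<subseteq> W \<and> connected_from E a M \<and> M \<union> nb M \<noteq> W" for M
      have "good {a}"
        using False aW by (auto simp: good_def connected_from_def nb_def)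
      then have ne: "{M. good M} \<noteq> {}" by blast
      have "finite {M. good M}" by (rule finite_subset[of _ "Pow W"]) (auto simp: good_def less.prems(1))
      then obtain M where M: "good M" and max: "\<And>M'. good M' \<Longrightarrow> M \<subseteq> M' \<Longrightarrow> M' = M"
        using finite_has_maximal[OF _ ne] by auto
      have MW: "M \<subseteq> W" and conn: "connected_from E a M" and aM: "a \<in> M"
        using M by (auto simp: good_def connected_from_def)
      define R where "R = W - M - nb M"
      have R: "R \<noteq> {}" using M MW by (auto simp: good_def R_def nb_def)
      have R_far: "{r, m} \<notin> E" if "r \<in> R" "m \<in> M" for r m
        using that by (auto simp: R_def nb_def insert_commute)
      have full: "{r, y} \<in> E" if r: "r \<in> R" and y: "y \<in> nb M" for r y
      proof -
        obtain m where m: "m \<in> M" "{m, y} \<in> E" using y by (auto simp: nb_def)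
        have "connected_from E a (insert y M)"
          unfolding connected_from_def
        proof (intro conjI ballI)
          show "a \<in> insert y M" using aM by simp
          have mono: "(adj_in E M)\<^sup>* \<subseteq> (adj_in E (insert y M))\<^sup>*" by (rule rtrancl_mono) (auto simp: adj_in_def)
          fix v assume "v \<in> insert y M"
          moreover have "(a, m) \<in> (adj_in E (insert y M))\<^sup>*" using conn m(1) mono by (auto simp: connected_from_def)
          then have "(a, y) \<in> (adj_in E (insert y M))\<^sup>*"
            by (rule rtrancl_into_rtrancl) (use m in \<open>auto simp: adj_in_def\<close>)
          ultimately show "(a, v) \<in> (adj_in E (insert y M))\<^sup>*" using conn mono by (auto simp: connected_from_def)
        qed
        moreover have "insert y M \<noteq> M" using y by (auto simp: nb_def)
        ultimately have "insert y M \<union> nb (insert y M) = W"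
          using max[of "insert y M"] MW y unfolding good_def by (auto simp: nb_def)
        moreover have "r \<in> W" "r \<notin> insert y M" using r y by (auto simp: R_def)
        ultimately have "r \<in> nb (insert y M)" by blast
        then show ?thesis using R_far[OF r] by (auto simp: nb_def insert_commute)
      qed
      have nbW: "nb M \<subseteq> W" by (auto simp: nb_def)
      have clq: "clique (nb M) E"
        unfolding clique_def
      proof (intro ballI impI)
        fix s t assume st: "s \<in> nb M" "t \<in> nb M" "s \<noteq> t"
        obtain r where r: "r \<in> R" using R by blast
        obtain u v where uv: "u \<in> M" "{u, s} \<in> E" "v \<in> M" "{v, t} \<in> E" using st(1,2) by (auto simp: nb_def)
        show "{s, t} \<in> E"
        proof (rule chordal_separator_edge[OF E ch conn])
          show "M \<subseteq> V" "s \<in> V" "t \<in> V" using MW st nbW less.prems(2) by auto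
          show "s \<notin> M" "t \<notin> M" using st by (auto simp: nb_def)
          show "{s, u} \<in> E" using uv by (simp add: insert_commute)
          show "{r, s} \<in> E" using full[OF r st(1)] .
          show "{t, r} \<in> E" using full[OF r st(2)] by (simp add: insert_commute)
          show "r \<notin> M" using r by (auto simp: R_def)
          show "{r, m} \<notin> E" if "m \<in> M" for m using R_far[OF r that] .
        qed (use uv st in auto)
      qed
      have "card (R \<union> nb M) < card W"
        using aM MW less.prems(1) by (intro psubset_card_mono) (auto simp: R_def nb_def)
      moreover have "nb M \<subset> R \<union> nb M" using R by (auto simp: R_def)
      moreover have sub: "R \<union> nb M \<subseteq> W" using nbW by (auto simp: R_def)
      ultimately obtain v where v: "v \<in> (R \<union> nb M) - nb M" "clique {u \<in> R \<union> nb M. {u, v} \<in> E} E"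
        using less.hyps[of "R \<union> nb M" "nb M"] clq less.prems(1,2) by (meson finite_subset order_trans)
      have vR: "v \<in> R" using v(1) by blast
      have "{u \<in> W. {u, v} \<in> E} = {u \<in> R \<union> nb M. {u, v} \<in> E}"
        using sub R_far[OF vR] by (auto simp: R_def insert_commute)
      moreover have "v \<notin> K"
      proof
        assume "v \<in> K"
        then have "v \<in> K'" using K'(3) by blast
        moreover have "v \<noteq> a" using aM vR by (auto simp: R_def)
        ultimately have "{v, a} \<in> E" using K'(2) a by (auto simp: clique_def)
        then show False using R_far[OF vR aM] by simp
      qed
      moreover have "v \<in> W" using vR by (simp add: R_def)
      ultimately show ?thesis using v(2) by (intro bexI[of _ v]) (simp_all only: Diff_iff, simp)
    qed
  qed
qed

section \<open>Weighted elimination orderings\<close>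

text \<open>\<open>U\<close> is a connected component of the set of vertices whose weight equals a fixed
  minimal weight. The neighbours of \<open>U\<close> have strictly larger weights, so two
  nonadjacent ones would be the ends of a valley path through \<open>U\<close>. Hence they
  form a clique, outside of which there is a simplicial vertex.\<close>

lemma weighted_simplicial_vertex:
  assumes E: "E \<subseteq> nsets V 2" and ch: "chordal E"
    and comparable: "\<not> has_incomparable_edge V E \<psi>" and no_valley: "\<not> has_valley_path V E \<psi>"
    and W: "finite W" "W \<subseteq> V" "W \<noteq> {}"
  shows "\<exists>v\<in>W. clique {u \<in> W. {u, v} \<in> E} E \<and> (\<forall>u\<in>W. {u, v} \<in> E \<longrightarrow> \<psi> v \<subseteq> \<psi> u)"
proof -
  have no_loop: "{x} \<notin> E" for x using E by (auto simp: nsets_def)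
  have cmp: "\<psi> u \<subseteq> \<psi> v \<or> \<psi> v \<subseteq> \<psi> u" if "{u, v} \<in> E" for u v
  proof -
    have "induced_path V E [u, v]"
      unfolding induced_path_iff[OF E] using that E no_loop by (auto simp: less_Suc_eq)
    then show ?thesis using comparable unfolding has_incomparable_edge_def by blast
  qed
  obtain w where w: "w \<in> W" and min: "\<And>u. u \<in> W \<Longrightarrow> \<psi> u \<subseteq> \<psi> w \<Longrightarrow> \<psi> u = \<psi> w"
    using finite_has_minimal[of "\<psi> ` W"] W by fastforce
  define M0 where "M0 = {u \<in> W. \<psi> u = \<psi> w}"
  define U where "U = {u. (w, u) \<in> (adj_in E M0)\<^sup>*}"
  have U_M0: "u \<in> M0" if "u \<in> U" for u
  proof -
    have "(w, u) \<in> (adj_in E M0)\<^sup>*" using that by (simp add: U_def)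
    then show ?thesis by (cases rule: rtranclE) (use w in \<open>auto simp: M0_def adj_in_def\<close>)
  qed
  have wU: "w \<in> U" by (simp add: U_def)
  have UW: "U \<subseteq> W" using U_M0 by (auto simp: M0_def)
  have conn: "connected_from E w U"
    unfolding connected_from_def
  proof (intro conjI ballI wU)
    fix v assume "v \<in> U"
    then have "(w, v) \<in> (adj_in E M0)\<^sup>*" by (simp add: U_def)
    then show "(w, v) \<in> (adj_in E U)\<^sup>*"
    proof (induction rule: rtrancl_induct)
      case (step y z)
      then have "(w, z) \<in> (adj_in E M0)\<^sup>*" by (meson rtrancl_into_rtrancl)
      then have "(y, z) \<in> adj_in E U" using step.hyps by (auto simp: adj_in_def U_def)
      then show ?case using step.IH by (meson rtrancl_into_rtrancl)
    qed simp
  qed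
  define nb where "nb = {s \<in> W - U. \<exists>u\<in>U. {u, s} \<in> E}"
  have larger: "\<psi> w \<subset> \<psi> s" if s: "s \<in> nb" for s
  proof -
    obtain u where u: "u \<in> U" "{u, s} \<in> E" and sW: "s \<in> W" "s \<notin> U" using s by (auto simp: nb_def)
    have \<psi>u: "\<psi> u = \<psi> w" "u \<in> M0" using U_M0[OF u(1)] by (auto simp: M0_def)
    have "\<psi> s \<noteq> \<psi> w"
    proof
      assume "\<psi> s = \<psi> w"
      then have "(u, s) \<in> adj_in E M0" using sW u \<psi>u by (auto simp: adj_in_def M0_def)
      then have "s \<in> U" using u(1) by (auto simp: U_def intro: rtrancl_into_rtrancl)
      then show False using sW by blast
    qed
    then show ?thesis using cmp[OF u(2)] min[OF sW(1)] \<psi>u by auto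
  qed
  have clq: "clique nb E"
    unfolding clique_def
  proof (intro ballI impI, rule ccontr)
    fix s t assume st: "s \<in> nb" "t \<in> nb" "s \<noteq> t" "{s, t} \<notin> E"
    obtain u v where uv: "u \<in> U" "{u, s} \<in> E" "v \<in> U" "{v, t} \<in> E" using st(1,2) by (auto simp: nb_def)
    obtain vs where vs: "induced_path V E vs" "walk E U s t vs" "length vs \<ge> 3"
      using induced_path_through_connected[OF E conn _ _ _ st(3,4) uv(1) _ uv(3,4)] UW W(2) st(1,2) uv(2)
      by (auto simp: nb_def insert_commute)
    have inner: "\<psi> (vs ! j) = \<psi> w" if "0 < j" "Suc j < length vs" for j
      using vs(2) that U_M0 unfolding walk_def M0_def by blast
    have "has_valley_path V E \<psi>"
      unfolding has_valley_path_def
    proof (intro exI[of _ vs] conjI allI impI)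
      show "induced_path V E vs" "length vs \<ge> 3" by fact+
      show "\<psi> (vs ! 1) \<subset> \<psi> (vs ! 0)" using larger[OF st(1)] vs inner[of 1] by (simp add: walk_def)
      show "\<psi> (vs ! (length vs - 2)) \<subset> \<psi> (vs ! (length vs - 1))"
        using larger[OF st(2)] vs inner[of "length vs - 2"] by (simp add: walk_def)
      show "\<psi> (vs ! j) = \<psi> (vs ! 1)" if "1 \<le> j \<and> j \<le> length vs - 2" for j
      proof -
        have "Suc j < length vs" using that vs(3) by linarith
        then show ?thesis using inner[of j] inner[of 1] that by simp
      qed
    qed
    then show False using no_valley by blast
  qed
  have "\<exists>v\<in>(U \<union> nb) - nb. clique {u \<in> U \<union> nb. {u, v} \<in> E} E"
  proof (rule simplicial_vertex_outside_clique[OF E ch _ _ _ clq])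
    show sub: "U \<union> nb \<subseteq> V" using UW W(2) by (auto simp: nb_def)
    show "finite (U \<union> nb)" using UW W(1) by (auto simp: nb_def intro: finite_subset)
    show "nb \<subset> U \<union> nb" using wU by (auto simp: nb_def)
  qed
  then obtain v where v: "v \<in> U" "clique {u \<in> U \<union> nb. {u, v} \<in> E} E" by blast
  have "{u \<in> W. {u, v} \<in> E} = {u \<in> U \<union> nb. {u, v} \<in> E}"
    using v(1) UW by (auto simp: nb_def insert_commute)
  moreover have "\<psi> v \<subseteq> \<psi> u" if "u \<in> W" "{u, v} \<in> E" for u
  proof (cases "u \<in> U")
    case True
    then show ?thesis using U_M0[OF True] U_M0[OF v(1)] by (simp add: M0_def)
  next
    case False
    then have "u \<in> nb" using that v(1) by (auto simp: nb_def insert_commute)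
    then show ?thesis using larger U_M0[OF v(1)] by (auto simp: M0_def)
  qed
  moreover have "v \<in> W" using v(1) UW by blast
  ultimately show ?thesis using v(2) by (intro bexI[of _ v]) (simp_all only:, blast)
qed

lemma weighted_elimination_orderingI:
  assumes E: "E \<subseteq> nsets V 2" and vs: "distinct vs" "set vs = V"
    and cl: "\<And>j. j < length vs \<Longrightarrow> clique {u \<in> set (take j vs). {u, vs ! j} \<in> E} E"
    and wt: "\<And>j u. j < length vs \<Longrightarrow> u \<in> set (take j vs) \<Longrightarrow> {u, vs ! j} \<in> E \<Longrightarrow> \<psi> (vs ! j) \<subseteq> \<psi> u"
  shows "weighted_elimination_ordering V E \<psi> vs"
proof -
  have no_loop: "{x} \<notin> E" for x using E by (auto simp: nsets_def)
  have "simplicial (induced_edges (set (take (Suc i) vs)) E) (vs ! i)" if i: "i < length vs" for i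
    unfolding simplicial_def clique_def
  proof (intro ballI impI)
    fix x y assume xy: "x \<in> {u. {u, vs ! i} \<in> induced_edges (set (take (Suc i) vs)) E}"
      "y \<in> {u. {u, vs ! i} \<in> induced_edges (set (take (Suc i) vs)) E}" "x \<noteq> y"
    have "x \<noteq> vs ! i" "y \<noteq> vs ! i" using xy no_loop by (auto simp: induced_edges_def)
    then have "x \<in> {u \<in> set (take i vs). {u, vs ! i} \<in> E}" "y \<in> {u \<in> set (take i vs). {u, vs ! i} \<in> E}"
      using xy i by (auto simp: induced_edges_def take_Suc_conv_app_nth)
    then have "{x, y} \<in> E" using cl[OF i] xy(3) by (auto simp: clique_def)
    then show "{x, y} \<in> induced_edges (set (take (Suc i) vs)) E" using xy by (auto simp: induced_edges_def)
  qed
  moreover have "\<psi> (vs ! j) \<subseteq> \<psi> (vs ! i)" if "i < j" "j < length vs" "{vs ! i, vs ! j} \<in> E" for i j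
  proof (rule wt)
    show "vs ! i \<in> set (take j vs)" using that by (auto simp: in_set_conv_nth)
  qed (use that in auto)
  ultimately show ?thesis
    using vs by (simp add: weighted_elimination_ordering_def perfect_elimination_ordering_def)
qed

theorem weighted_elimination_ordering_if_no_obstruction:
  assumes E: "E \<subseteq> nsets V 2" and "finite V" and ch: "chordal E"
    and comparable: "\<not> has_incomparable_edge V E \<psi>" and no_valley: "\<not> has_valley_path V E \<psi>"
  shows "\<exists>vs. weighted_elimination_ordering V E \<psi> vs"
proof -
  have "\<exists>vs. distinct vs \<and> set vs = W \<and>
      (\<forall>j<length vs. clique {u \<in> set (take j vs). {u, vs ! j} \<in> E} E \<and>
        (\<forall>u\<in>set (take j vs). {u, vs ! j} \<in> E \<longrightarrow> \<psi> (vs ! j) \<subseteq> \<psi> u))"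
    if "finite W" "W \<subseteq> V" for W
    using that
  proof (induction "card W" arbitrary: W)
    case 0
    then show ?case by (intro exI[of _ "[]"]) simp
  next
    case (Suc k)
    then have "W \<noteq> {}" by auto
    then obtain v where v: "v \<in> W" "clique {u \<in> W. {u, v} \<in> E} E" "\<forall>u\<in>W. {u, v} \<in> E \<longrightarrow> \<psi> v \<subseteq> \<psi> u"
      using weighted_simplicial_vertex[OF E ch comparable no_valley Suc.prems] by blast
    have k: "k = card (W - {v})" using Suc.hyps(2) v(1) Suc.prems(1) by simp
    have W': "finite (W - {v})" "W - {v} \<subseteq> V" using Suc.prems by auto
    then obtain vs where vs: "distinct vs" "set vs = W - {v}"
        "\<forall>j<length vs. clique {u \<in> set (take j vs). {u, vs ! j} \<in> E} E \<and>
          (\<forall>u\<in>set (take j vs). {u, vs ! j} \<in> E \<longrightarrow> \<psi> (vs ! j) \<subseteq> \<psi> u)"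
      using Suc.hyps(1)[OF k W'] by blast
    have sub: "clique {u \<in> W - {v}. {u, v} \<in> E} E" using v(2) by (auto simp: clique_def)
    show ?case
    proof (intro exI[of _ "vs @ [v]"] conjI allI impI)
      show "distinct (vs @ [v])" "set (vs @ [v]) = W" using vs(1,2) v(1) by auto
      fix j assume "j < length (vs @ [v])"
      then consider "j < length vs" | "j = length vs" by fastforce
      then show "clique {u \<in> set (take j (vs @ [v])). {u, (vs @ [v]) ! j} \<in> E} E"
        and "\<forall>u\<in>set (take j (vs @ [v])). {u, (vs @ [v]) ! j} \<in> E \<longrightarrow> \<psi> ((vs @ [v]) ! j) \<subseteq> \<psi> u"
        using vs(2,3) v sub by (cases; simp add: nth_append)+
    qed
  qed
  then obtain vs where "distinct vs" "set vs = V"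
      "\<forall>j<length vs. clique {u \<in> set (take j vs). {u, vs ! j} \<in> E} E \<and>
        (\<forall>u\<in>set (take j vs). {u, vs ! j} \<in> E \<longrightarrow> \<psi> (vs ! j) \<subseteq> \<psi> u)"
    using assms(2) by blast
  then have "weighted_elimination_ordering V E \<psi> vs" by (intro weighted_elimination_orderingI[OF E]) auto
  then show ?thesis by blast
qed

section \<open>Unimodality\<close>

text \<open>If the weights along an induced path are comparable but not unimodal, then some strict
  descent is followed by a strict ascent. A closest such pair has constant weights in between
  and bounds a valley path.\<close>

theorem unimodal_induced_paths_iff:
  assumes E: "E \<subseteq> nsets V 2"
  shows "(\<not> has_incomparable_edge V E \<psi> \<and> \<not> has_valley_path V E \<psi>) \<longleftrightarrow>
    (\<forall>vs. induced_path V E vs \<longrightarrow> unimodal \<psi> vs)" (is "?free \<longleftrightarrow> ?unimodal")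
proof
  assume u: ?unimodal
  have "\<not> has_incomparable_edge V E \<psi>"
  proof
    assume "has_incomparable_edge V E \<psi>"
    then obtain a b where ab: "induced_path V E [a, b]" "\<not> \<psi> a \<subseteq> \<psi> b" "\<not> \<psi> b \<subseteq> \<psi> a"
      by (auto simp: has_incomparable_edge_def)
    then show False using u unfolding unimodal_def by (fastforce simp: less_Suc_eq)
  qed
  moreover have "\<not> has_valley_path V E \<psi>"
  proof
    assume "has_valley_path V E \<psi>"
    then obtain vs where vs: "induced_path V E vs" "length vs \<ge> 3" "\<psi> (vs ! 1) \<subset> \<psi> (vs ! 0)"
        "\<psi> (vs ! (length vs - 2)) \<subset> \<psi> (vs ! (length vs - 1))"
      unfolding has_valley_path_def by blast
    have "unimodal \<psi> vs" using u vs(1) by simp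
    then obtain i where i: "\<forall>j<i. \<psi> (vs ! j) \<subseteq> \<psi> (vs ! Suc j)"
        "\<forall>j. i \<le> j \<and> Suc j < length vs \<longrightarrow> \<psi> (vs ! Suc j) \<subseteq> \<psi> (vs ! j)"
      unfolding unimodal_def by blast
    have "i = 0" using i(1)[rule_format, of 0] vs(3) by (cases i) auto
    moreover have "Suc (length vs - 2) = length vs - 1" using vs(2) by simp
    ultimately show False using i(2)[rule_format, of "length vs - 2"] vs(2,4) by auto
  qed
  ultimately show ?free by blast
next
  assume f: ?free
  show ?unimodal
  proof (intro allI impI, rule ccontr)
    fix vs assume vs: "induced_path V E vs" and nu: "\<not> unimodal \<psi> vs"
    note ip = vs[unfolded induced_path_iff[OF E]]
    let ?n = "length vs" let ?w = "\<lambda>i. \<psi> (vs ! i)"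
    have sub: "induced_path V E (take k (drop i vs))" if "i + k \<le> ?n" "k > 0" for i k
    proof -
      have "take k (drop i vs) \<noteq> []" using that by simp
      moreover have "distinct (take k (drop i vs))" using ip by simp
      moreover have "set (take k (drop i vs)) \<subseteq> V"
        using ip set_take_subset[of k "drop i vs"] set_drop_subset[of i vs] by blast
      ultimately show ?thesis unfolding induced_path_iff[OF E] using ip that by auto
    qed
    have cmp: "?w i \<subseteq> ?w (Suc i) \<or> ?w (Suc i) \<subseteq> ?w i" if "Suc i < ?n" for i
    proof -
      have "take 2 (drop i vs) = [vs ! i, vs ! Suc i]"
        using that by (simp add: numeral_2_eq_2 take_Suc_conv_app_nth Cons_nth_drop_Suc[symmetric])
      then have "induced_path V E [vs ! i, vs ! Suc i]" using sub[of i 2] that by simp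
      then show ?thesis using f unfolding has_incomparable_edge_def by blast
    qed
    \<comment> \<open>\<open>turn d\<close>: a strict descent is followed by a strict ascent d steps later\<close>
    define turn where "turn d \<longleftrightarrow> (\<exists>i. d > 0 \<and> Suc (i + d) < ?n \<and> \<not> ?w i \<subseteq> ?w (Suc i) \<and> \<not> ?w (Suc (i + d)) \<subseteq> ?w (i + d))" for d
    have "\<exists>d. turn d"
    proof (rule ccontr)
      assume no: "\<not> (\<exists>d. turn d)"
      define i0 where "i0 = (LEAST i. Suc i < ?n \<longrightarrow> \<not> ?w i \<subseteq> ?w (Suc i))"
      have i0: "Suc i0 < ?n \<longrightarrow> \<not> ?w i0 \<subseteq> ?w (Suc i0)"
        unfolding i0_def by (rule LeastI[of _ ?n]) simp
      have before: "Suc j < ?n \<and> ?w j \<subseteq> ?w (Suc j)" if "j < i0" for j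
        using not_less_Least[of j "\<lambda>i. Suc i < ?n \<longrightarrow> \<not> ?w i \<subseteq> ?w (Suc i)"] that unfolding i0_def by blast
      have "i0 < ?n" using before[of "i0 - 1"] ip by (cases "i0 = 0") auto
      moreover have "?w (Suc j) \<subseteq> ?w j" if j: "i0 \<le> j" "Suc j < ?n" for j
      proof (cases "j = i0")
        case True
        then show ?thesis using i0 cmp j by blast
      next
        case False
        then have "j > i0" using j by simp
        show ?thesis
        proof (rule ccontr)
          assume "\<not> ?thesis"
          then have "turn (j - i0)" unfolding turn_def using i0 j \<open>j > i0\<close> by (intro exI[of _ i0]) simp
          then show False using no by blast
        qed
      qed
      ultimately have "unimodal \<psi> vs" unfolding unimodal_def using before by blast
      then show False using nu by blast
    qed
    then obtain d where d: "turn d" and shortest: "\<And>d'. d' < d \<Longrightarrow> \<not> turn d'"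
      unfolding exists_least_iff[of turn] by blast
    then obtain i where i: "d > 0" "Suc (i + d) < ?n" "\<not> ?w i \<subseteq> ?w (Suc i)" "\<not> ?w (Suc (i + d)) \<subseteq> ?w (i + d)"
      unfolding turn_def by blast
    have flat: "?w (i + m) = ?w (Suc (i + m))" if m: "0 < m" "m < d" for m
    proof -
      have "?w (i + m) \<subseteq> ?w (Suc (i + m))"
      proof (rule ccontr)
        assume "\<not> ?thesis"
        moreover have "i + m + (d - m) = i + d" using m by simp
        ultimately have "turn (d - m)" unfolding turn_def using i m by (intro exI[of _ "i + m"]) simp
        then show False using shortest[of "d - m"] m by simp
      qed
      moreover have "?w (Suc (i + m)) \<subseteq> ?w (i + m)"
      proof (rule ccontr)
        assume "\<not> ?thesis"
        then have "turn m" unfolding turn_def using i m by (intro exI[of _ i]) simp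
        then show False using shortest m by blast
      qed
      ultimately show ?thesis by blast
    qed
    have const: "?w (i + Suc m) = ?w (Suc i)" if "m < d" for m
      using that
    proof (induction m)
      case (Suc m)
      then show ?case using flat[of "Suc m"] by simp
    qed simp
    let ?us = "take (d + 2) (drop i vs)"
    have len: "length ?us = d + 2" using i(2) by simp
    have nth: "?us ! m = vs ! (i + m)" if "m < d + 2" for m using that i(2) by simp
    have "has_valley_path V E \<psi>"
      unfolding has_valley_path_def
    proof (intro exI[of _ ?us] conjI allI impI)
      show "induced_path V E ?us" using i(2) by (intro sub) auto
      show "length ?us \<ge> 3" using len i(1) by simp
      show "\<psi> (?us ! 1) \<subset> \<psi> (?us ! 0)" using nth[of 0] nth[of 1] cmp[of i] i by auto
      show "\<psi> (?us ! j) = \<psi> (?us ! 1)" if "1 \<le> j \<and> j \<le> length ?us - 2" for j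
      proof -
        have "j - 1 < d" "j < d + 2" "Suc (j - 1) = j" using that i(1) unfolding len by auto
        then show ?thesis using const[of "j - 1"] nth[of j] nth[of 1] by simp
      qed
      show "\<psi> (?us ! (length ?us - 2)) \<subset> \<psi> (?us ! (length ?us - 1))"
        unfolding len using nth[of d] nth[of "d + 1"] cmp[of "i + d"] i by auto
    qed
    then show False using f by blast
  qed
qed

section \<open>Saturation at a localization\<close>

text \<open>Saturation, with conditions only at the hyperplanes whose forms are killed by the
  substitution \<open>\<phi>\<close>. In the applications \<open>\<phi>\<close> restricts
  polynomials to a flat \<open>X\<close>, and the killed forms belong to the hyperplanes that
  contain \<open>X\<close>. Multiplication by the product \<open>h\<close> of the other forms
  makes the conditions at the other hyperplanes trivial.\<close>

lemma free_saturated_local: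
  fixes \<Phi> :: "('k::field ^ 'm::finite) set" and \<phi> :: "'m \<Rightarrow> ('k, 'm) sym_alg"
  assumes free: "free_arrangement (form_kernel ` \<Phi>)" and nz: "0 \<notin> \<Phi>" and fin: "finite \<Phi>"
    and reg: "regular_triple y1 y2 y3"
    and \<eta>1: "\<And>\<alpha>. \<alpha> \<in> \<Phi> \<Longrightarrow> lin_ext \<phi> \<alpha> = 0 \<Longrightarrow> form_poly \<alpha> dvd lin_ext \<eta>1 \<alpha> - y1 * g \<alpha>"
    and \<eta>2: "\<And>\<alpha>. \<alpha> \<in> \<Phi> \<Longrightarrow> lin_ext \<phi> \<alpha> = 0 \<Longrightarrow> form_poly \<alpha> dvd lin_ext \<eta>2 \<alpha> - y2 * g \<alpha>"
    and \<eta>3: "\<And>\<alpha>. \<alpha> \<in> \<Phi> \<Longrightarrow> lin_ext \<phi> \<alpha> = 0 \<Longrightarrow> form_poly \<alpha> dvd lin_ext \<eta>3 \<alpha> - y3 * g \<alpha>"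
  shows "\<exists>\<xi> h. subst \<phi> h \<noteq> 0 \<and>
    (\<forall>\<alpha>\<in>\<Phi>. lin_ext \<phi> \<alpha> = 0 \<longrightarrow> form_poly \<alpha> dvd lin_ext \<xi> \<alpha> - h * g \<alpha>)"
proof -
  define A where "A = {\<alpha> \<in> \<Phi>. lin_ext \<phi> \<alpha> \<noteq> 0}"
  define h where "h = (\<Prod>\<alpha>\<in>A. form_poly \<alpha>)"
  have "(\<Prod>\<alpha>\<in>B. lin_ext \<phi> \<alpha>) \<noteq> 0" if "finite B" "B \<subseteq> A" for B
    using that by (induction B rule: finite_induct) (auto simp: sym_alg_mult_eq_0 A_def)
  then have h: "subst \<phi> h \<noteq> 0" using fin by (simp add: h_def subst_form_poly A_def)
  have dvd_h: "form_poly \<alpha> dvd h" if "\<alpha> \<in> A" for \<alpha>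
    unfolding h_def using fin that by (intro dvd_prodI) (auto simp: A_def)
  have scaled: "form_poly \<alpha> dvd lin_ext (\<lambda>i. h * \<eta> i) \<alpha> - y * (h * g \<alpha>)"
    if "\<And>\<alpha>. \<alpha> \<in> \<Phi> \<Longrightarrow> lin_ext \<phi> \<alpha> = 0 \<Longrightarrow> form_poly \<alpha> dvd lin_ext \<eta> \<alpha> - y * g \<alpha>" "\<alpha> \<in> \<Phi>" for \<eta> y \<alpha>
  proof -
    have eq: "lin_ext (\<lambda>i. h * \<eta> i) \<alpha> - y * (h * g \<alpha>) = h * (lin_ext \<eta> \<alpha> - y * g \<alpha>)"
      using lin_ext_comb[of h \<eta> 0 \<eta> \<alpha>] by (simp add: algebra_simps)
    show ?thesis unfolding eq using that dvd_h[of \<alpha>] by (cases "\<alpha> \<in> A") (auto simp: A_def)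
  qed
  have "\<exists>\<xi>. \<forall>\<alpha>\<in>\<Phi>. form_poly \<alpha> dvd lin_ext \<xi> \<alpha> - h * g \<alpha>"
    by (rule free_saturated[OF free nz reg scaled[OF \<eta>1] scaled[OF \<eta>2] scaled[OF \<eta>3]])
  then show ?thesis using h by blast
qed

lemma dvd_prod_diff:
  fixes f g :: "'b \<Rightarrow> 'a::comm_ring_1"
  assumes "\<And>a. a \<in> A \<Longrightarrow> d dvd f a - g a"
  shows "d dvd prod f A - prod g A"
  using assms
proof (induction A rule: infinite_finite_induct)
  case (insert a A)
  have "prod f (insert a A) - prod g (insert a A) =
      f a * (prod f A - prod g A) + (f a - g a) * prod g A"
    using insert.hyps by (simp add: algebra_simps)
  with insert show ?case by simp
qed auto

lemma axis_component: "axis i c $ j = (if j = i then c else 0)"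
  by (simp add: axis_def)

section \<open>The hyperplanes of a psi-graphical arrangement\<close>

locale psi_graph =
  fixes z :: "'m::finite" and x :: "'v \<Rightarrow> 'm" and V :: "'v set" and E :: "'v set set"
    and \<psi> :: "'v \<Rightarrow> 'k::field set"
  assumes inj: "inj_on x V" and x_ne_z [simp]: "i \<in> V \<Longrightarrow> x i \<noteq> z"
    and E: "E \<subseteq> nsets V 2" and finV: "finite V" and fin\<psi>: "i \<in> V \<Longrightarrow> finite (\<psi> i)"
begin

abbreviation zf :: "'k \<Rightarrow> 'k ^ 'm" where "zf a \<equiv> axis z a"
abbreviation xf :: "'v \<Rightarrow> 'k ^ 'm" where "xf i \<equiv> axis (x i) 1"

lemma x_eq_iff [simp]: "i \<in> V \<Longrightarrow> j \<in> V \<Longrightarrow> x i = x j \<longleftrightarrow> i = j"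
  using inj by (auto dest: inj_onD)

lemma z_ne_x [simp]: "i \<in> V \<Longrightarrow> z \<noteq> x i"
  using x_ne_z by metis

lemma edgeD: "{i, j} \<in> E \<Longrightarrow> i \<in> V \<and> j \<in> V \<and> i \<noteq> j"
  using E by (metis doubleton_in_nsets_2 subsetD)

definition forms :: "('k ^ 'm) set" where
  "forms = {zf 1} \<union> {xf i - xf j | i j. {i, j} \<in> E} \<union> {xf i - zf a | i a. i \<in> V \<and> a \<in> \<psi> i}"

lemma forms_cases:
  assumes "\<alpha> \<in> forms"
  obtains "\<alpha> = zf 1" | i j where "\<alpha> = xf i - xf j" "{i, j} \<in> E"
    | i a where "\<alpha> = xf i - zf a" "i \<in> V" "a \<in> \<psi> i"
  using assms by (auto simp: forms_def)

lemma forms_mem: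
  "zf 1 \<in> forms" "{i, j} \<in> E \<Longrightarrow> xf i - xf j \<in> forms" "i \<in> V \<Longrightarrow> a \<in> \<psi> i \<Longrightarrow> xf i - zf a \<in> forms"
  by (auto simp: forms_def)

definition arr :: "('k ^ 'm) set set" where
  "arr = psi_graphical_arrangement z x V E \<psi>"

lemma arr_forms: "arr = form_kernel ` forms"
proof -
  have 1: "form_kernel (zf 1) = {v. v $ z = 0}" by (simp add: form_kernel_def)
  have 2: "form_kernel (xf i - xf j) = {v. v $ x i - v $ x j = 0}" for i j by (simp add: form_kernel_def)
  have 3: "form_kernel (xf i - zf a) = {v. v $ x i = a * v $ z}" for i a by (simp add: form_kernel_def)
  have "form_kernel ` {xf i - xf j | i j. {i, j} \<in> E} = {form_kernel (xf i - xf j) | i j. {i, j} \<in> E}"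
    and "form_kernel ` {xf i - zf a | i a. i \<in> V \<and> a \<in> \<psi> i} = {form_kernel (xf i - zf a) | i a. i \<in> V \<and> a \<in> \<psi> i}"
    by blast+
  then show ?thesis
    unfolding arr_def psi_graphical_arrangement_def forms_def image_Un 1 2 3 by (simp add: 1)
qed

lemma zero_notin_forms: "0 \<notin> forms"
proof
  assume "0 \<in> forms"
  then show False
  proof (cases rule: forms_cases)
    case 1
    then have "(zf 1 :: 'k ^ 'm) $ z = 0" by (metis zero_index)
    then show False by simp
  next
    case (2 i j)
    then have "(xf i - xf j) $ x i = 0" by (metis zero_index)
    then show False using edgeD[OF 2(2)] by (simp add: axis_component)
  next
    case (3 i a)
    then have "(xf i - zf a) $ x i = 0" by (metis zero_index)
    then show False using 3(2) by (simp add: axis_component)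
  qed
qed

lemma finite_forms: "finite forms"
proof -
  have "forms = {zf 1} \<union> (\<lambda>(i, j). xf i - xf j) ` {(i, j). {i, j} \<in> E} \<union>
      (\<Union>i\<in>V. (\<lambda>a. xf i - zf a) ` \<psi> i)"
    by (auto simp: forms_def)
  moreover have "finite {(i, j). {i, j} \<in> E}"
    by (rule finite_subset[of _ "V \<times> V"]) (auto dest: edgeD simp: finV)
  ultimately show ?thesis using finV fin\<psi> by simp
qed

lemma hyperplane_arrangement_arr: "hyperplane_arrangement arr"
  unfolding hyperplane_arrangement_def arr_forms
proof (intro conjI ballI)
  fix H assume "H \<in> form_kernel ` forms"
  then obtain \<alpha> where "\<alpha> \<in> forms" "H = form_kernel \<alpha>" by blast
  moreover from this have "\<alpha> \<noteq> 0" using zero_notin_forms by metis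
  ultimately show "\<exists>\<alpha>. \<alpha> \<noteq> 0 \<and> H = form_kernel \<alpha>" by blast
qed (simp add: finite_forms)

section \<open>An elimination ordering gives a modular ranking\<close>

text \<open>A hyperplane is ranked by the last vertex whose coordinate vector it does not contain, and
  \<open>z = 0\<close> has rank 0. The coordinate vector of a vertex lies in all hyperplanes
  of smaller rank, which gives the second ranking condition. The first one is exactly what the
  clique condition and the weight condition of the ordering provide.\<close>

lemma modular_ranking_if_ordering:
  assumes "weighted_elimination_ordering V E \<psi> vs"
  shows "\<exists>\<rho>. modular_ranking arr \<rho>"
proof -
  have vs: "set vs = V" and
    simpl: "\<And>i. i < length vs \<Longrightarrow> simplicial (induced_edges (set (take (Suc i) vs)) E) (vs ! i)" and
    wt: "\<And>i j. i < j \<Longrightarrow> j < length vs \<Longrightarrow> {vs ! i, vs ! j} \<in> E \<Longrightarrow> \<psi> (vs ! j) \<subseteq> \<psi> (vs ! i)"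
    using assms unfolding weighted_elimination_ordering_def perfect_elimination_ordering_def by simp_all
  have "\<forall>i\<in>V. \<exists>k. k < length vs \<and> vs ! k = i" using vs by (metis in_set_conv_nth)
  then obtain pos where pos: "\<And>i. i \<in> V \<Longrightarrow> pos i < length vs" "\<And>i. i \<in> V \<Longrightarrow> vs ! pos i = i" by metis
  have pos_eq: "pos i = pos j \<longleftrightarrow> i = j" if "i \<in> V" "j \<in> V" for i j using pos that by metis
  have cl: "{j, j'} \<in> E" if "{j, i} \<in> E" "{j', i} \<in> E" "pos j < pos i" "pos j' < pos i" "j \<noteq> j'" for i j j'
  proof -
    have V: "i \<in> V" "j \<in> V" "j' \<in> V" using that edgeD by blast+
    let ?T = "set (take (Suc (pos i)) vs)"
    have T: "k \<in> ?T" if "k \<in> V" "pos k \<le> pos i" for k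
      using pos[OF that(1)] pos(1)[OF V(1)] that(2) by (auto simp: in_set_conv_nth intro!: exI[of _ "pos k"])
    have "{j, i} \<in> induced_edges ?T E" "{j', i} \<in> induced_edges ?T E"
      using that T V by (auto simp: induced_edges_def)
    then have "j \<in> {u. {u, i} \<in> induced_edges ?T E}" "j' \<in> {u. {u, i} \<in> induced_edges ?T E}" by simp_all
    moreover have "clique {u. {u, i} \<in> induced_edges ?T E} (induced_edges ?T E)"
      using simpl[OF pos(1)[OF V(1)]] unfolding simplicial_def pos(2)[OF V(1)] .
    ultimately have "{j, j'} \<in> induced_edges ?T E" using that(5) unfolding clique_def by blast
    then show ?thesis by (simp add: induced_edges_def)
  qed
  define \<rho> where "\<rho> H = Max (insert 0 {Suc (pos i) | i. i \<in> V \<and> axis (x i) 1 \<notin> H})" for H :: "('k ^ 'm) set"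
  have fin: "finite (insert 0 {Suc (pos i) | i. i \<in> V \<and> axis (x i) 1 \<notin> H})" for H :: "('k ^ 'm) set"
    using finV by simp
  have \<rho>_ge: "Suc (pos i) \<le> \<rho> H" if "i \<in> V" "axis (x i) 1 \<notin> H" for i H
    unfolding \<rho>_def using that by (intro Max_ge fin) auto
  have \<rho>_le: "\<rho> H \<le> n" if "\<And>i. i \<in> V \<Longrightarrow> axis (x i) 1 \<notin> H \<Longrightarrow> Suc (pos i) \<le> n" for H n
    unfolding \<rho>_def using that by (intro Max.boundedI fin) auto
  have \<rho>_z: "\<rho> (form_kernel (zf 1)) = 0"
    using \<rho>_le[of "form_kernel (zf 1)" 0] by (simp add: form_kernel_iff) (simp add: axis_component)
  have \<rho>_x: "\<rho> (form_kernel (xf i - xf j)) = Suc (pos i)" if "{i, j} \<in> E" "pos j < pos i" for i j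
  proof (rule antisym)
    have ij: "i \<in> V" "j \<in> V" "i \<noteq> j" using edgeD[OF that(1)] by auto
    show "\<rho> (form_kernel (xf i - xf j)) \<le> Suc (pos i)"
    proof (rule \<rho>_le)
      fix k assume "k \<in> V" "axis (x k) 1 \<notin> form_kernel (xf i - xf j)"
      then have "k = i \<or> k = j" using ij by (auto simp: form_kernel_iff axis_component split: if_splits)
      then show "Suc (pos k) \<le> Suc (pos i)" using that(2) by auto
    qed
    show "Suc (pos i) \<le> \<rho> (form_kernel (xf i - xf j))"
      using ij by (intro \<rho>_ge) (auto simp: form_kernel_iff axis_component)
  qed
  have \<rho>_a: "\<rho> (form_kernel (xf i - zf a)) = Suc (pos i)" if "i \<in> V" for i a
  proof (rule antisym)
    show "\<rho> (form_kernel (xf i - zf a)) \<le> Suc (pos i)"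
    proof (rule \<rho>_le)
      fix k assume "k \<in> V" "axis (x k) 1 \<notin> form_kernel (xf i - zf a)"
      then have "k = i" using that by (auto simp: form_kernel_iff axis_component split: if_splits)
      then show "Suc (pos k) \<le> Suc (pos i)" by simp
    qed
    show "Suc (pos i) \<le> \<rho> (form_kernel (xf i - zf a))"
      using that by (intro \<rho>_ge) (auto simp: form_kernel_iff axis_component)
  qed
  \<comment> \<open>hyperplanes of rank \<open>Suc (pos i)\<close> are the kernels of \<open>xf i - \<beta>\<close> with \<open>\<beta> \<in> N i\<close>\<close>
  define N where "N i = {xf j | j. {j, i} \<in> E \<and> pos j < pos i} \<union> {zf a | a. a \<in> \<psi> i}" for i
  have normal: "H = form_kernel (zf 1) \<or> (\<exists>i\<in>V. \<exists>\<beta>\<in>N i. H = form_kernel (xf i - \<beta>) \<and> \<rho> H = Suc (pos i))"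
    if H: "H \<in> arr" for H
  proof -
    obtain \<alpha> where \<alpha>: "\<alpha> \<in> forms" "H = form_kernel \<alpha>" using H by (auto simp: arr_forms)
    from \<alpha>(1) show ?thesis
    proof (cases rule: forms_cases)
      case (2 i j)
      have ij: "i \<in> V" "j \<in> V" "i \<noteq> j" using edgeD[OF 2(2)] by auto
      then consider "pos j < pos i" | "pos i < pos j" using pos_eq by (metis linorder_neqE_nat)
      then show ?thesis
      proof cases
        case 1
        then have "xf j \<in> N i" using 2(2) by (auto simp: N_def insert_commute)
        then show ?thesis using \<rho>_x[OF 2(2) 1] ij(1) \<alpha>(2) 2(1) by blast
      next
        case b: 2
        have ji: "{j, i} \<in> E" using 2(2) by (simp add: insert_commute)
        have "H = form_kernel (xf j - xf i)" using \<alpha>(2) 2(1) by (auto simp: form_kernel_def)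
        moreover have "xf i \<in> N j" using 2(2) b by (auto simp: N_def)
        ultimately show ?thesis using \<rho>_x[OF ji b] ij(2) by blast
      qed
    next
      case (3 i a)
      then have "zf a \<in> N i" by (auto simp: N_def)
      then show ?thesis using \<rho>_a[OF 3(2)] \<alpha>(2) 3 by blast
    qed (use \<alpha> in blast)
  qed
  have "modular_ranking arr \<rho>"
    unfolding modular_ranking_def
  proof (intro conjI ballI impI)
    fix H H' assume HH': "H \<in> arr" "H' \<in> arr" "H \<noteq> H' \<and> \<rho> H = \<rho> H'"
    have "\<exists>i\<in>V. \<exists>\<beta>\<in>N i. \<exists>\<beta>'\<in>N i. H = form_kernel (xf i - \<beta>) \<and> H' = form_kernel (xf i - \<beta>') \<and> \<rho> H = Suc (pos i)"
      using normal[OF HH'(1)] normal[OF HH'(2)] HH'(3) \<rho>_z pos_eq by (metis nat.inject nat.distinct(1))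
    then obtain i \<beta> \<beta>' where i: "i \<in> V" "\<beta> \<in> N i" "\<beta>' \<in> N i" "\<rho> H = Suc (pos i)"
      and eq: "H = form_kernel (xf i - \<beta>)" "H' = form_kernel (xf i - \<beta>')" by blast
    have ne: "\<beta> \<noteq> \<beta>'" using HH'(3) eq by blast
    have "\<exists>\<alpha>\<in>forms. \<rho> (form_kernel \<alpha>) < Suc (pos i) \<and> form_kernel (\<beta> - \<beta>') \<subseteq> form_kernel \<alpha>"
    proof -
      have mixed: "\<exists>\<alpha>\<in>forms. \<rho> (form_kernel \<alpha>) < Suc (pos i) \<and> form_kernel \<gamma> \<subseteq> form_kernel \<alpha>"
        if j: "{j, i} \<in> E" "pos j < pos i" "a \<in> \<psi> i" and \<gamma>: "form_kernel \<gamma> = form_kernel (xf j - zf a)" for j a \<gamma>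
      proof -
        have jV: "j \<in> V" using edgeD[OF j(1)] by blast
        have "\<psi> i \<subseteq> \<psi> j" using wt[of "pos j" "pos i"] pos[OF jV] pos[OF i(1)] j by auto
        then show ?thesis using \<rho>_a[OF jV] forms_mem(3)[OF jV] j \<gamma> by (intro bexI[of _ "xf j - zf a"]) auto
      qed
      consider j j' where "\<beta> = xf j" "\<beta>' = xf j'" "{j, i} \<in> E" "{j', i} \<in> E" "pos j < pos i" "pos j' < pos i"
        | j a where "\<beta> = xf j" "\<beta>' = zf a" "{j, i} \<in> E" "pos j < pos i" "a \<in> \<psi> i"
        | j a where "\<beta> = zf a" "\<beta>' = xf j" "{j, i} \<in> E" "pos j < pos i" "a \<in> \<psi> i"
        | a a' where "\<beta> = zf a" "\<beta>' = zf a'"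
        using i(2,3) unfolding N_def by blast
      then show ?thesis
      proof cases
        case (1 j j')
        then have "j \<noteq> j'" using ne by blast
        then have e: "{j, j'} \<in> E" "{j', j} \<in> E" using cl[OF 1(3-6)] by (auto simp: insert_commute)
        have "j \<in> V" "j' \<in> V" using edgeD e by blast+
        then consider "pos j' < pos j" | "pos j < pos j'" using pos_eq \<open>j \<noteq> j'\<close> by (metis linorder_neqE_nat)
        then show ?thesis
        proof cases
          case a: 1
          show ?thesis using \<rho>_x[OF e(1) a] forms_mem(2)[OF e(1)] 1 by (intro bexI[of _ "xf j - xf j'"]) auto
        next
          case b: 2
          show ?thesis using \<rho>_x[OF e(2) b] forms_mem(2)[OF e(2)] 1
            by (intro bexI[of _ "xf j' - xf j"]) (auto simp: form_kernel_def)
        qed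
      next
        case (2 j a)
        then show ?thesis using mixed[of j a] by blast
      next
        case (3 j a)
        moreover have "form_kernel (zf a - xf j) = form_kernel (xf j - zf a)" by (auto simp: form_kernel_def)
        ultimately show ?thesis using mixed[of j a] by blast
      next
        case (4 a a')
        then have "a \<noteq> a'" using ne by blast
        then have "form_kernel (zf a - zf a') \<subseteq> form_kernel (zf 1)"
          by (auto simp: form_kernel_iff simp flip: left_diff_distrib)
        then show ?thesis using \<rho>_z forms_mem(1) 4 by (intro bexI[of _ "zf 1"]) auto
      qed
    qed
    then obtain \<alpha> where \<alpha>: "\<alpha> \<in> forms" "\<rho> (form_kernel \<alpha>) < Suc (pos i)" "form_kernel (\<beta> - \<beta>') \<subseteq> form_kernel \<alpha>"
      by blast
    have "H \<inter> H' \<subseteq> form_kernel (\<beta> - \<beta>')" by (auto simp: eq form_kernel_iff)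
    then show "\<exists>H''\<in>arr. \<rho> H'' < \<rho> H \<and> H \<inter> H' \<subseteq> H''"
      using \<alpha> i(4) by (intro bexI[of _ "form_kernel \<alpha>"]) (auto simp: arr_forms)
  next
    fix H assume H: "H \<in> arr"
    have "\<exists>v. v \<notin> H \<and> (\<forall>H'\<in>arr. \<rho> H' < \<rho> H \<longrightarrow> v \<in> H')"
      using normal[OF H]
    proof (elim disjE bexE conjE)
      assume "H = form_kernel (zf 1)"
      then show ?thesis using \<rho>_z by (intro exI[of _ "axis z 1"]) (auto simp: form_kernel_iff)
    next
      fix i \<beta> assume i: "i \<in> V" "\<beta> \<in> N i" "H = form_kernel (xf i - \<beta>)" "\<rho> H = Suc (pos i)"
      have "\<beta> $ x i = 0" using i(1,2) by (auto simp: N_def axis_component dest: edgeD)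
      then have "axis (x i) 1 \<notin> H" using i(3) by (simp add: form_kernel_iff)
      moreover have "axis (x i) 1 \<in> H'" if "\<rho> H' < \<rho> H" for H'
        using \<rho>_ge[OF i(1), of H'] that i(4) by fastforce
      ultimately show ?thesis by blast
    qed
    then show "\<not> \<Inter>{H' \<in> arr. \<rho> H' < \<rho> H} \<subseteq> H" by blast
  qed
  then show ?thesis by blast
qed

end

context psi_graph begin

section \<open>Circuits without chords\<close>

lemma xf_component: "i \<in> V \<Longrightarrow> j \<in> V \<Longrightarrow> xf i $ x j = (if i = j then 1 else 0)"
  by (auto simp: axis_component)

text \<open>The forms \<open>xf (us ! 0) - \<tau>\<close>, \<open>xf (us ! (n - 1)) - \<tau>\<close> and
  \<open>xf (us ! i) - xf (us ! Suc i)\<close> are \<open>n + 1 \<ge> 4\<close> forms with a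
  single linear relation: the first is the sum of the others. They are, up to sign, the only
  forms that vanish on the flat where all coordinates \<open>x\<^sub>v\<close> with \<open>v
  \<in> us\<close> equal \<open>\<tau>\<close>. The element \<open>g\<close> of the cokernel
  is 1 at the first form \<open>\<gamma>\<close> and 0 at the others. It is annihilated by
  \<open>\<gamma>\<close>, by \<open>xf (us ! 0) - xf (us ! 1)\<close> (move the first
  coordinate only) and by \<open>xf (us ! 1) - xf (us ! 2)\<close> (move the first two
  coordinates). Restricted to the flat, the linear relation shows that \<open>h g\<close> is
  nonzero for every \<open>h\<close> that does not vanish there.\<close>

lemma not_free_circuit:
  fixes \<tau> :: "'k ^ 'm" and us :: "'v list"
  defines "n \<equiv> length us"
  defines "\<phi> \<equiv> \<lambda>i. if \<exists>v\<in>set us. i = x v then form_poly \<tau> else Var i"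
  defines "circuit \<equiv> {xf (us ! 0) - \<tau>, xf (us ! (n - 1)) - \<tau>} \<union>
    {xf (us ! i) - xf (us ! Suc i) | i. Suc i < n}"
  assumes us: "distinct us" "set us \<subseteq> V" "n \<ge> 3"
    and \<tau>: "\<And>v. v \<in> set us \<Longrightarrow> \<tau> $ x v = 0"
    and mem: "\<And>\<beta>. \<beta> \<in> circuit \<Longrightarrow> \<beta> \<in> forms"
    and only: "\<And>\<alpha>. \<alpha> \<in> forms \<Longrightarrow> lin_ext \<phi> \<alpha> = 0 \<Longrightarrow> \<alpha> \<in> circuit \<or> - \<alpha> \<in> circuit"
  shows "\<not> free_arrangement arr"
proof
  assume free: "free_arrangement arr"
  let ?u = "\<lambda>i. us ! i"
  have uV: "?u i \<in> V" "?u i \<in> set us" if "i < n" for i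
    using that us(2) by (auto simp: n_def)
  have u_eq: "?u i = ?u j \<longleftrightarrow> i = j" if "i < n" "j < n" for i j
    using us(1) that by (simp add: n_def nth_eq_iff_index_eq)
  have comp: "xf (?u i) $ x (?u j) = (if i = j then 1 else 0)" if "i < n" "j < n" for i j
    using xf_component[OF uV(1)[OF that(1)] uV(1)[OF that(2)]] u_eq[OF that] by simp
  have \<tau>u: "\<tau> $ x (?u i) = 0" if "i < n" for i using \<tau> uV(2)[OF that] .
  have n: "0 < n" "1 < n" "2 < n" "n - 1 < n" "n - 1 \<noteq> 0" "n - 1 \<noteq> 1" using us(3) by auto
  define \<alpha>1 \<alpha>2 \<gamma> where "\<alpha>1 = xf (?u 0) - xf (?u 1)" and "\<alpha>2 = xf (?u 1) - xf (?u 2)" and "\<gamma> = xf (?u 0) - \<tau>"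
  define y1 y2 y3 where "y1 = form_poly \<alpha>1" and "y2 = form_poly \<alpha>2" and "y3 = form_poly \<gamma>"
  have reg: "regular_triple y1 y2 y3"
    unfolding y1_def y2_def
  proof (rule regular_tripleI[where p = "xf (?u 0)" and q = "xf (?u 1)"])
    show "\<alpha>1 \<cdot> xf (?u 0) = 1" "\<alpha>2 \<cdot> xf (?u 1) = 1" "\<alpha>2 \<cdot> xf (?u 0) = 0"
      using n by (simp_all add: \<alpha>1_def \<alpha>2_def comp)
    have 1: "\<gamma> - (\<gamma> \<cdot> xf (?u 0)) *s \<alpha>1 = xf (?u 1) - \<tau>"
      using n by (simp add: \<gamma>_def \<alpha>1_def comp \<tau>u)
    have 2: "(xf (?u 1) - \<tau>) - ((xf (?u 1) - \<tau>) \<cdot> xf (?u 1)) *s \<alpha>2 = xf (?u 2) - \<tau>"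
      using n by (simp add: \<alpha>2_def comp \<tau>u)
    have "(xf (?u 2) - \<tau>) $ x (?u 2) = 1" using n by (simp add: comp \<tau>u)
    then have "xf (?u 2) - \<tau> \<noteq> 0" by (metis zero_index zero_neq_one)
    then show "restr \<alpha>2 (xf (?u 1)) (restr \<alpha>1 (xf (?u 0)) y3) \<noteq> 0"
      unfolding y3_def restr_form_poly 1 2 by (simp only: form_poly_eq_0) simp
  qed
  define g0 where "g0 \<beta> = (if \<beta> = \<gamma> then 1 else 0 :: ('k, 'm) sym_alg)" for \<beta>
  \<comment> \<open>edges occur with both orientations, and g is extended as an odd function\<close>
  define g where "g \<alpha> = (if \<alpha> \<in> circuit then g0 \<alpha> else - g0 (- \<alpha>))" for \<alpha>
  define \<eta>1 where "\<eta>1 i = (if i = x (?u 0) then y1 else 0)" for i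
  define \<eta>2 where "\<eta>2 i = (if i = x (?u 0) \<or> i = x (?u 1) then y2 else 0)" for i
  have supp: "lin_ext \<eta>1 \<tau> = 0" "lin_ext \<eta>2 \<tau> = 0"
    using \<tau>u n unfolding lin_ext_def by (auto intro!: sum.neutral simp: \<eta>1_def \<eta>2_def)
  have \<eta>1u: "\<eta>1 (x (?u i)) = (if i = 0 then y1 else 0)" if "i < n" for i
    using that n uV(1) u_eq by (simp add: \<eta>1_def)
  have \<eta>2u: "\<eta>2 (x (?u i)) = (if i = 0 \<or> i = 1 then y2 else 0)" if "i < n" for i
    using that n uV(1) u_eq by (simp add: \<eta>2_def)
  have \<gamma>_ne: "xf (?u (n - 1)) - \<tau> \<noteq> \<gamma>" "\<And>i. Suc i < n \<Longrightarrow> xf (?u i) - xf (?u (Suc i)) \<noteq> \<gamma>"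
  proof -
    have \<gamma>_comp: "\<gamma> $ x (?u i) = (if i = 0 then 1 else 0)" if "i < n" for i
      using that n by (simp add: \<gamma>_def comp \<tau>u)
    show "xf (?u (n - 1)) - \<tau> \<noteq> \<gamma>"
    proof
      assume "xf (?u (n - 1)) - \<tau> = \<gamma>"
      then have "(xf (?u (n - 1)) - \<tau>) $ x (?u 0) = \<gamma> $ x (?u 0)" by simp
      then show False using n by (simp add: comp \<tau>u \<gamma>_comp)
    qed
    show "xf (?u i) - xf (?u (Suc i)) \<noteq> \<gamma>" if i: "Suc i < n" for i
    proof
      assume "xf (?u i) - xf (?u (Suc i)) = \<gamma>"
      then have "(xf (?u i) - xf (?u (Suc i))) $ x (?u (Suc i)) = \<gamma> $ x (?u (Suc i))" by simp
      then show False using i by (simp add: comp \<gamma>_comp)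
    qed
  qed
  have circuit_cases: "P \<beta>" if "\<beta> \<in> circuit" "P \<gamma>" "P (xf (?u (n - 1)) - \<tau>)"
      "\<And>i. Suc i < n \<Longrightarrow> P (xf (?u i) - xf (?u (Suc i)))" for P \<beta>
    using that unfolding circuit_def \<gamma>_def by blast
  have local: "form_poly \<alpha> dvd lin_ext \<eta> \<alpha> - y * g \<alpha>"
    if \<alpha>: "\<alpha> \<in> forms" "lin_ext \<phi> \<alpha> = 0"
      and \<eta>: "\<And>\<beta>. \<beta> \<in> circuit \<Longrightarrow> form_poly \<beta> dvd lin_ext \<eta> \<beta> - y * g0 \<beta>" for \<alpha> \<eta> y
  proof (cases "\<alpha> \<in> circuit")
    case True
    then show ?thesis using \<eta> by (simp add: g_def)
  next
    case False
    then have "form_poly (- \<alpha>) dvd lin_ext \<eta> (- \<alpha>) - y * g0 (- \<alpha>)" using only[OF \<alpha>] \<eta> by blast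
    then have "form_poly \<alpha> dvd - (lin_ext \<eta> \<alpha> + y * g0 (- \<alpha>))" by simp
    then show ?thesis using False unfolding dvd_minus_iff by (simp add: g_def)
  qed
  have field1: "form_poly \<beta> dvd lin_ext \<eta>1 \<beta> - y1 * g0 \<beta>" if "\<beta> \<in> circuit" for \<beta>
    using that
  proof (rule circuit_cases)
    show "form_poly \<gamma> dvd lin_ext \<eta>1 \<gamma> - y1 * g0 \<gamma>"
      using n \<eta>1u[of 0] supp by (simp add: g0_def) (simp add: \<gamma>_def)
    show "form_poly (xf (?u (n - 1)) - \<tau>) dvd lin_ext \<eta>1 (xf (?u (n - 1)) - \<tau>) - y1 * g0 (xf (?u (n - 1)) - \<tau>)"
      using n \<eta>1u[of "n - 1"] supp \<gamma>_ne(1) by (simp add: g0_def)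
    show "form_poly (xf (?u i) - xf (?u (Suc i))) dvd
        lin_ext \<eta>1 (xf (?u i) - xf (?u (Suc i))) - y1 * g0 (xf (?u i) - xf (?u (Suc i)))" if "Suc i < n" for i
      using that \<eta>1u[of i] \<eta>1u[of "Suc i"] \<gamma>_ne(2)[OF that] by (simp add: g0_def y1_def \<alpha>1_def)
  qed
  have field2: "form_poly \<beta> dvd lin_ext \<eta>2 \<beta> - y2 * g0 \<beta>" if "\<beta> \<in> circuit" for \<beta>
    using that
  proof (rule circuit_cases)
    show "form_poly \<gamma> dvd lin_ext \<eta>2 \<gamma> - y2 * g0 \<gamma>"
      using n \<eta>2u[of 0] supp by (simp add: g0_def) (simp add: \<gamma>_def)
    show "form_poly (xf (?u (n - 1)) - \<tau>) dvd lin_ext \<eta>2 (xf (?u (n - 1)) - \<tau>) - y2 * g0 (xf (?u (n - 1)) - \<tau>)"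
      using n \<eta>2u[of "n - 1"] supp \<gamma>_ne(1) by (simp add: g0_def)
    show "form_poly (xf (?u i) - xf (?u (Suc i))) dvd
        lin_ext \<eta>2 (xf (?u i) - xf (?u (Suc i))) - y2 * g0 (xf (?u i) - xf (?u (Suc i)))" if "Suc i < n" for i
      using that \<eta>2u[of i] \<eta>2u[of "Suc i"] \<gamma>_ne(2)[OF that]
      by (cases "i = 0"; cases "i = 1") (simp_all add: g0_def y2_def \<alpha>2_def numeral_2_eq_2)
  qed
  have field3: "form_poly \<beta> dvd lin_ext (\<lambda>i. 0) \<beta> - y3 * g0 \<beta>" if "\<beta> \<in> circuit" for \<beta>
    by (simp add: g0_def y3_def lin_ext_def)
  obtain \<xi> h where h: "subst \<phi> h \<noteq> 0"
      and \<xi>: "\<forall>\<alpha>\<in>forms. lin_ext \<phi> \<alpha> = 0 \<longrightarrow> form_poly \<alpha> dvd lin_ext \<xi> \<alpha> - h * g \<alpha>"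
    using free_saturated_local[OF free[unfolded arr_forms] zero_notin_forms finite_forms reg,
        of \<phi> \<eta>1 g \<eta>2 "\<lambda>i. 0"] local[OF _ _ field1] local[OF _ _ field2] local[OF _ _ field3] by blast
  have \<phi>\<tau>: "lin_ext \<phi> \<tau> = form_poly \<tau>"
    unfolding form_poly_lin_ext lin_ext_def by (rule sum.cong) (auto simp: \<phi>_def \<tau>)
  have \<phi>u: "\<phi> (x (?u i)) = form_poly \<tau>" if "i < n" for i
    using uV(2)[OF that] by (auto simp: \<phi>_def)
  have killed: "lin_ext \<phi> \<beta> = 0" if "\<beta> \<in> circuit" for \<beta>
    using that by (rule circuit_cases) (use n in \<open>simp_all add: \<phi>u \<phi>\<tau> \<gamma>_def\<close>)
  have vanish: "subst \<phi> (lin_ext \<xi> \<beta> - h * g0 \<beta>) = 0" if "\<beta> \<in> circuit" for \<beta>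
  proof -
    have "form_poly \<beta> dvd lin_ext \<xi> \<beta> - h * g0 \<beta>"
      using \<xi> mem[OF that] killed[OF that] that by (auto simp: g_def)
    then obtain q where "lin_ext \<xi> \<beta> - h * g0 \<beta> = form_poly \<beta> * q" by blast
    then show ?thesis using killed[OF that] by (simp only: subst_mult subst_form_poly) simp
  qed
  have last0: "subst \<phi> (lin_ext \<xi> (xf (?u (n - 1)) - \<tau>)) = 0"
    using vanish[of "xf (?u (n - 1)) - \<tau>"] \<gamma>_ne(1) by (simp add: circuit_def g0_def)
  have edge0: "subst \<phi> (lin_ext \<xi> (xf (?u i) - xf (?u (Suc i)))) = 0" if "Suc i < n" for i
  proof -
    have "xf (?u i) - xf (?u (Suc i)) \<in> circuit" unfolding circuit_def using that by blast
    from vanish[OF this] \<gamma>_ne(2)[OF that] show ?thesis by (simp add: g0_def)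
  qed
  have "subst \<phi> (lin_ext \<xi> (xf (?u (n - 1 - d)) - \<tau>)) = 0" if "d < n" for d
    using that
  proof (induction d)
    case 0
    then show ?case using last0 by simp
  next
    case (Suc d)
    then have "Suc (n - 1 - Suc d) = n - 1 - d" by simp
    then show ?case using Suc edge0[of "n - 1 - Suc d"] by simp
  qed
  from this[of "n - 1"] have "subst \<phi> (lin_ext \<xi> \<gamma>) = 0" using n by (simp add: \<gamma>_def)
  moreover have "subst \<phi> (lin_ext \<xi> \<gamma> - h * g0 \<gamma>) = 0" by (rule vanish) (simp add: circuit_def \<gamma>_def)
  ultimately show False using h by (simp add: g0_def)
qed

end

lemma dvd_diff_swap: "d dvd p - q \<Longrightarrow> d dvd q - (p :: 'a::comm_ring_1)"
  using dvd_minus_iff[of d "p - q"] by simp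

context psi_graph begin

lemma E_comm: "{i, j} \<in> E \<longleftrightarrow> {j, i} \<in> E"
  by (simp add: insert_commute)

lemma Var_neq: "i \<noteq> j \<Longrightarrow> (Var i :: ('k, 'm) sym_alg) \<noteq> Const c * Var j"
proof
  assume ij: "i \<noteq> j" and "(Var i :: ('k, 'm) sym_alg) = Const c * Var j"
  then have "form_poly (axis i 1 - axis j c :: 'k ^ 'm) = 0" by simp
  then have "(axis i 1 - axis j c :: 'k ^ 'm) $ i = 0" by (simp only: form_poly_eq_0 zero_index)
  then show False using ij by (simp add: axis_component)
qed

lemma Var_neq': "i \<noteq> j \<Longrightarrow> (Var i :: ('k, 'm) sym_alg) \<noteq> Var j"
  using Var_neq[of i j 1] by simp

lemma Var_nonzero: "(Var i :: ('k, 'm) sym_alg) \<noteq> 0"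
  using form_poly_eq_0[of "axis i 1 :: 'k ^ 'm"] by (simp add: axis_eq_0_iff)

text \<open>One vertex \<open>r\<close> of a chordless cycle plays the role of \<open>\<tau>\<close>;
  the other vertices form the list \<open>us\<close>.\<close>

theorem chordal_if_free:
  assumes free: "free_arrangement arr"
  shows "chordal E"
proof (rule ccontr)
  assume "\<not> chordal E"
  then obtain vs where cyc: "is_cycle E vs" and len: "length vs \<ge> 4"
      and chordless: "\<And>u v. u \<in> set vs \<Longrightarrow> v \<in> set vs \<Longrightarrow> {u, v} \<in> E \<Longrightarrow> {u, v} \<in> cycle_edges vs"
    unfolding chordal_def by blast
  define us where "us = tl vs"
  define r where "r = vs ! 0"
  let ?n = "length us"
  have vs: "vs = r # us" using len by (cases vs) (auto simp: us_def r_def)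
  have n: "?n \<ge> 3" using len by (simp add: vs)
  have dist: "distinct us" "r \<notin> set us" using cyc by (auto simp: is_cycle_def vs)
  have edge: "{vs ! i, vs ! (Suc i mod length vs)} \<in> E" if "i < length vs" for i
    using cyc that unfolding is_cycle_def cycle_edges_def by blast
  have "Suc 0 mod length vs = Suc 0" using len by simp
  then have first: "{r, us ! 0} \<in> E" using edge[of 0] len vs by (metis length_greater_0_conv list.distinct(1) nth_Cons_0 nth_Cons_Suc)
  have last: "{us ! (?n - 1), r} \<in> E" using edge[of ?n] n by (auto simp: vs nth_Cons' split: if_splits)
  have mid: "{us ! i, us ! Suc i} \<in> E" if "Suc i < ?n" for i using edge[of "Suc i"] that by (simp add: vs)
  have cV: "r \<in> V" "set us \<subseteq> V"
  proof -
    show "r \<in> V" using edgeD[OF first] by blast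
    show "set us \<subseteq> V"
    proof
      fix v assume "v \<in> set us"
      then obtain i where i: "v = us ! i" "i < ?n" by (auto simp: in_set_conv_nth)
      then show "v \<in> V"
        using edgeD[OF mid, of i] edgeD[OF last] by (cases "Suc i < ?n") (auto simp: not_less Suc_le_eq dest: le_antisym)
    qed
  qed
  have "\<not> free_arrangement arr"
  proof (rule not_free_circuit[where us = us and \<tau> = "xf r"])
    show "distinct us" "set us \<subseteq> V" "?n \<ge> 3" by fact+
    show "xf r $ x v = 0" if "v \<in> set us" for v
      using that dist(2) cV by (subst xf_component) auto
  next
    fix \<beta> assume "\<beta> \<in> {xf (us ! 0) - xf r, xf (us ! (?n - 1)) - xf r} \<union> {xf (us ! i) - xf (us ! Suc i) |i. Suc i < ?n}"
    then show "\<beta> \<in> forms" using forms_mem(2) first last mid E_comm by blast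
  next
    let ?\<phi> = "\<lambda>i. if \<exists>v\<in>set us. i = x v then form_poly (xf r) else Var i :: ('k, 'm) sym_alg"
    let ?C = "{xf (us ! 0) - xf r, xf (us ! (?n - 1)) - xf r} \<union> {xf (us ! i) - xf (us ! Suc i) |i. Suc i < ?n}"
    define w where "w i = (if i \<in> set us then r else i)" for i
    have wV: "w i \<in> V" if "i \<in> V" for i using that cV by (simp add: w_def)
    have \<phi>x: "?\<phi> (x i) = Var (x (w i))" if "i \<in> V" for i
      using that cV(2) by (auto simp: w_def subset_iff)
    have \<phi>z: "?\<phi> z = Var z" using cV(2) by auto
    fix \<alpha> assume \<alpha>: "\<alpha> \<in> forms" "lin_ext ?\<phi> \<alpha> = 0"
    from \<alpha>(1) show "\<alpha> \<in> ?C \<or> - \<alpha> \<in> ?C"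
    proof (cases rule: forms_cases)
      case 1
      then show ?thesis using \<alpha>(2) \<phi>z Var_nonzero[of z] by simp
    next
      case (3 i a)
      then have "Var (x (w i)) = (Const a * Var z :: ('k, 'm) sym_alg)"
        using \<alpha>(2) \<phi>z \<phi>x[of i] by simp
      then show ?thesis using Var_neq[of "x (w i)" z a] wV[OF 3(2)] by simp
    next
      case (2 i j)
      then have ij: "i \<in> V" "j \<in> V" "i \<noteq> j" using edgeD by blast+
      then have "Var (x (w i)) = (Var (x (w j)) :: ('k, 'm) sym_alg)" using \<alpha>(2) \<phi>x[of i] \<phi>x[of j] 2(1) by simp
      then have "w i = w j" using Var_neq' wV ij x_eq_iff by metis
      then have "i \<in> set vs" "j \<in> set vs" using ij(3) by (auto simp: w_def vs split: if_splits)
      then have "{i, j} \<in> cycle_edges vs" using chordless 2(2) by blast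
      then obtain k where k: "{i, j} = {vs ! k, vs ! (Suc k mod length vs)}" "k < length vs"
        unfolding cycle_edges_def by blast
      consider "k = 0" | k' where "k = Suc k'" "Suc k' < ?n" | "k = ?n"
        using k(2) by (cases k) (auto simp: vs less_Suc_eq)
      then have "\<exists>p q. {i, j} = {p, q} \<and> xf p - xf q \<in> ?C"
      proof cases
        case 1
        then have "{i, j} = {us ! 0, r}" using k(1) n by (auto simp: vs)
        then show ?thesis by blast
      next
        case (2 k')
        then have "{i, j} = {us ! k', us ! Suc k'}" using k(1) by (simp add: vs)
        then show ?thesis using 2(2) by blast
      next
        case 3
        then have "{i, j} = {us ! (?n - 1), r}" using k(1) n by (auto simp: vs nth_Cons')
        then show ?thesis by blast
      qed
      then obtain p q where pq: "{i, j} = {p, q}" "xf p - xf q \<in> ?C" by blast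
      from pq(1) have "i = p \<and> j = q \<or> i = q \<and> j = p" by (auto simp: doubleton_eq_iff)
      then show ?thesis using pq(2) 2(1) by auto
    qed
  qed
  then show False using free by blast
qed

text \<open>The two hyperplanes \<open>x\<^sub>v = a z\<close> at the ends \<open>v\<close> of the path
  close it to a circuit, with \<open>\<tau> = a z\<close> as an additional vertex.\<close>

lemma not_free_closed_path:
  assumes us: "induced_path V E us" "length us \<ge> 3"
    and a: "a \<in> \<psi> (us ! 0)" "a \<in> \<psi> (us ! (length us - 1))"
    and inner: "\<And>i. 0 < i \<Longrightarrow> Suc i < length us \<Longrightarrow> a \<notin> \<psi> (us ! i)"
  shows "\<not> free_arrangement arr"
proof -
  let ?n = "length us"
  note ip = us(1)[unfolded induced_path_iff[OF E]]
  have usV: "set us \<subseteq> V" and dist: "distinct us" using ip by blast+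
  show ?thesis
  proof (rule not_free_circuit[where us = us and \<tau> = "zf a"])
    show "distinct us" "set us \<subseteq> V" "?n \<ge> 3" by fact+
    show "zf a $ x v = 0" if "v \<in> set us" for v using that usV by (auto simp: axis_component)
  next
    fix \<beta> assume "\<beta> \<in> {xf (us ! 0) - zf a, xf (us ! (?n - 1)) - zf a} \<union> {xf (us ! i) - xf (us ! Suc i) |i. Suc i < ?n}"
    then consider "\<beta> = xf (us ! 0) - zf a" | "\<beta> = xf (us ! (?n - 1)) - zf a"
      | i where "\<beta> = xf (us ! i) - xf (us ! Suc i)" "Suc i < ?n" by blast
    then show "\<beta> \<in> forms"
    proof cases
      case 1
      have "us ! 0 \<in> set us" using us(2) by (intro nth_mem) linarith
      then have "us ! 0 \<in> V" using usV by blast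
      then show ?thesis using 1 forms_mem(3) a(1) by blast
    next
      case 2
      have "us ! (?n - 1) \<in> V" using usV us(2) nth_mem[of "?n - 1" us] by auto
      then show ?thesis using 2 forms_mem(3) a(2) by blast
    next
      case (3 i)
      then show ?thesis using forms_mem(2) ip by blast
    qed
  next
    let ?\<phi> = "\<lambda>i. if \<exists>v\<in>set us. i = x v then form_poly (zf a) else Var i :: ('k, 'm) sym_alg"
    let ?C = "{xf (us ! 0) - zf a, xf (us ! (?n - 1)) - zf a} \<union> {xf (us ! i) - xf (us ! Suc i) |i. Suc i < ?n}"
    have \<phi>x: "?\<phi> (x i) = (if i \<in> set us then Const a * Var z else Var (x i))" if "i \<in> V" for i
      using that usV by (auto simp: subset_iff)
    have \<phi>z: "?\<phi> z = Var z" using usV by auto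
    fix \<alpha> assume \<alpha>: "\<alpha> \<in> forms" "lin_ext ?\<phi> \<alpha> = 0"
    from \<alpha>(1) show "\<alpha> \<in> ?C \<or> - \<alpha> \<in> ?C"
    proof (cases rule: forms_cases)
      case 1
      then show ?thesis using \<alpha>(2) \<phi>z Var_nonzero[of z] by simp
    next
      case (3 i c)
      have eq: "?\<phi> (x i) = Const c * Var z" using \<alpha>(2) 3(1) \<phi>z by simp
      have i: "i \<in> set us"
      proof (rule ccontr)
        assume "i \<notin> set us"
        then show False using eq \<phi>x[OF 3(2)] Var_neq[of "x i" z c] 3(2) by simp
      qed
      then have "form_poly (zf (a - c)) = (0 :: ('k, 'm) sym_alg)"
        using eq \<phi>x[OF 3(2)] by (simp add: single_diff algebra_simps)
      then have "zf (a - c) = 0" by (simp only: form_poly_eq_0)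
      then have ac: "a = c" by (simp add: axis_eq_0_iff)
      obtain k where k: "i = us ! k" "k < ?n" using i by (auto simp: in_set_conv_nth)
      have "k = 0 \<or> k = ?n - 1"
      proof (rule ccontr)
        assume "\<not> ?thesis"
        then have "0 < k" "Suc k < ?n" using k(2) by auto
        then show False using inner 3(3) ac k(1) by blast
      qed
      then show ?thesis using 3(1) k(1) ac by auto
    next
      case (2 i j)
      then have ij: "i \<in> V" "j \<in> V" "i \<noteq> j" using edgeD by blast+
      have eq: "?\<phi> (x i) = ?\<phi> (x j)" using \<alpha>(2) 2(1) by simp
      have "i \<in> set us \<and> j \<in> set us"
        using eq \<phi>x[OF ij(1)] \<phi>x[OF ij(2)] Var_neq[of "x i" z a] Var_neq[of "x j" z a] Var_neq'[of "x i" "x j"] ij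
        by (auto split: if_splits)
      then obtain p q where pq: "i = us ! p" "j = us ! q" "p < ?n" "q < ?n" by (auto simp: in_set_conv_nth)
      consider "p < q" | "q < p" using pq ij(3) by (metis linorder_neqE_nat)
      then show ?thesis
      proof cases
        case 1
        then have "q = Suc p" using ip pq 2(2) by blast
        then show ?thesis using 2(1) pq by blast
      next
        case b: 2
        then have "p = Suc q" using ip pq 2(2) E_comm by blast
        moreover have "- \<alpha> = xf j - xf i" using 2(1) by simp
        ultimately show ?thesis using pq by blast
      qed
    qed
  qed
qed

section \<open>Crossing weights at the ends of a path\<close>

text \<open>Write \<open>G\<close> for the product of the forms \<open>x\<^sub>0 - c z\<close> with
  \<open>c \<in> \<psi>(u\<^sub>0)\<close> different from \<open>a\<close>, where
  \<open>u\<^sub>0, u\<^sub>1, \<dots>\<close> is the path and \<open>x\<^sub>i\<close> the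
  coordinate of \<open>u\<^sub>i\<close>. The element \<open>g\<close> of the cokernel has the
  value \<open>G\<close> at \<open>x\<^sub>0 - a z\<close> and is 0 at all other forms. It is
  annihilated by \<open>x\<^sub>0 - a z\<close>, by \<open>x\<^sub>1 - x\<^sub>0\<close> (move
  \<open>x\<^sub>0\<close> only), and by the product \<open>y3\<close> (move
  \<open>x\<^sub>0\<close> and \<open>x\<^sub>1\<close>, by multiples of \<open>G\<close>
  evaluated at \<open>x\<^sub>0\<close> and \<open>x\<^sub>1\<close>); the factors of
  \<open>y3\<close> serve the hyperplanes at \<open>u\<^sub>1\<close> whose forms are not
  already covered by \<open>G\<close>. These three are a regular triple because \<open>a
  \<notin> \<psi>(u\<^sub>1)\<close>. If some \<open>\<xi>\<close> showed that \<open>h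
  g\<close> is zero, one could assume that \<open>\<xi>(z) = 0\<close>, by subtracting a
  multiple of the Euler derivation. Then \<open>\<xi>(x\<^sub>0) = G s\<close> with \<open>s
  \<equiv> h\<close> modulo \<open>x\<^sub>0 - a z\<close>. After all coordinates of the path
  are identified, \<open>\<xi>(x\<^sub>0)\<close> equals the value at the other end and is
  divisible by \<open>x\<^sub>0 - b z\<close>, so \<open>s\<close> is. Hence \<open>h\<close>,
  after the identification, lies in the ideal generated by \<open>x\<^sub>0 - a z\<close> and
  \<open>x\<^sub>0 - b z\<close> and vanishes on the flat where \<open>z\<close> and all these
  coordinates are zero.\<close>

lemma not_free_crossing_path:
  assumes us: "induced_path V E us" "length us \<ge> 2"
    and a: "a \<in> \<psi> (us ! 0)" "a \<notin> \<psi> (us ! 1)"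
    and b: "b \<in> \<psi> (us ! (length us - 1))" "b \<notin> \<psi> (us ! 0)"
  shows "\<not> free_arrangement arr"
proof
  assume free: "free_arrangement arr"
  let ?n = "length us" and ?u = "\<lambda>i. us ! i"
  note ip = us(1)[unfolded induced_path_iff[OF E]]
  have usV: "set us \<subseteq> V" and dist: "distinct us" using ip by blast+
  have uV: "?u i \<in> V" "?u i \<in> set us" if "i < ?n" for i using that usV by auto
  have u_eq: "?u i = ?u j \<longleftrightarrow> i = j" if "i < ?n" "j < ?n" for i j
    using dist that by (simp add: nth_eq_iff_index_eq)
  have n: "0 < ?n" "1 < ?n" "?n - 1 < ?n" using us(2) by auto
  have comp: "xf (?u i) $ x (?u j) = (if i = j then 1 else 0)" if "i < ?n" "j < ?n" for i j
    using xf_component[OF uV(1)[OF that(1)] uV(1)[OF that(2)]] u_eq[OF that] by simp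
  have compz: "zf c $ x (?u j) = 0" if "j < ?n" for j c using uV(1)[OF that] by (simp add: axis_component)
  have compxz: "xf (?u j) $ z = 0" if "j < ?n" for j using uV(1)[OF that] by (auto simp: axis_component)
  define L where "L v c = form_poly (xf v - zf c)" for v c
  define G where "G v = (\<Prod>c\<in>\<psi> (?u 0) - {a}. L v c)" for v
  define \<alpha>1 \<alpha>2 where "\<alpha>1 = xf (?u 1) - xf (?u 0)" and "\<alpha>2 = xf (?u 0) - zf a"
  define tail where "tail = (if 2 < ?n then form_poly (xf (?u 1) - xf (?u 2)) else 1)"
  define y1 y2 y3 where "y1 = form_poly \<alpha>1" and "y2 = form_poly \<alpha>2"
    and "y3 = (\<Prod>c\<in>\<psi> (?u 1) - \<psi> (?u 0). L (?u 1) c) * tail"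
  have fin0: "finite (\<psi> (?u 0) - {a})" and fin1: "finite (\<psi> (?u 1) - \<psi> (?u 0))"
    using fin\<psi> uV(1) n by auto
  have prod_nz: "(\<Prod>c\<in>C. f c) \<noteq> (0 :: ('k, 'm) sym_alg)" if "finite C" "\<And>c. c \<in> C \<Longrightarrow> f c \<noteq> 0" for C and f :: "'k \<Rightarrow> _"
    using that by (induction C rule: finite_induct) (auto simp: sym_alg_mult_eq_0)
  have form_nz: "xf v - zf c \<noteq> 0" if "v \<in> V" for v c
  proof -
    have "(xf v - zf c) $ x v = 1" using that by (simp add: axis_component)
    then show ?thesis by (metis zero_index zero_neq_one)
  qed
  have reg: "regular_triple y1 y2 y3"
    unfolding y1_def y2_def
  proof (rule regular_tripleI[where p = "xf (?u 1)" and q = "xf (?u 0)"])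
    show "\<alpha>1 \<cdot> xf (?u 1) = 1" "\<alpha>2 \<cdot> xf (?u 0) = 1" "\<alpha>2 \<cdot> xf (?u 1) = 0"
      using n by (simp_all add: \<alpha>1_def \<alpha>2_def comp compz)
    have restr2: "restr \<alpha>2 (xf (?u 0)) (restr \<alpha>1 (xf (?u 1)) (form_poly \<gamma>)) =
        form_poly (\<gamma> - (\<gamma> $ x (?u 1)) *s \<alpha>1 - (\<gamma> $ x (?u 0) + \<gamma> $ x (?u 1)) *s \<alpha>2)" for \<gamma>
      using n unfolding restr_form_poly by (simp add: comp \<alpha>1_def algebra_simps)
    have "restr \<alpha>2 (xf (?u 0)) (restr \<alpha>1 (xf (?u 1)) (L (?u 1) c)) \<noteq> 0" if "c \<in> \<psi> (?u 1) - \<psi> (?u 0)" for c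
    proof -
      let ?\<gamma> = "xf (?u 1) - zf c"
      have "(?\<gamma> - (?\<gamma> $ x (?u 1)) *s \<alpha>1 - (?\<gamma> $ x (?u 0) + ?\<gamma> $ x (?u 1)) *s \<alpha>2) $ z = a - c"
        using n by (simp add: comp compz compxz \<alpha>1_def \<alpha>2_def)
      moreover have "a \<noteq> c" using that a(2) by blast
      ultimately have "?\<gamma> - (?\<gamma> $ x (?u 1)) *s \<alpha>1 - (?\<gamma> $ x (?u 0) + ?\<gamma> $ x (?u 1)) *s \<alpha>2 \<noteq> 0"
        by (metis right_minus_eq zero_index)
      then show ?thesis unfolding L_def restr2 by (simp only: form_poly_eq_0) simp
    qed
    moreover have "restr \<alpha>2 (xf (?u 0)) (restr \<alpha>1 (xf (?u 1)) tail) \<noteq> 0"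
    proof (cases "2 < ?n")
      case True
      let ?\<gamma> = "xf (?u 1) - xf (?u 2)"
      have "(?\<gamma> - (?\<gamma> $ x (?u 1)) *s \<alpha>1 - (?\<gamma> $ x (?u 0) + ?\<gamma> $ x (?u 1)) *s \<alpha>2) $ x (?u 2) = - 1"
        using n True by (simp add: comp compz \<alpha>1_def \<alpha>2_def)
      then have "?\<gamma> - (?\<gamma> $ x (?u 1)) *s \<alpha>1 - (?\<gamma> $ x (?u 0) + ?\<gamma> $ x (?u 1)) *s \<alpha>2 \<noteq> 0"
        by (metis neg_equal_0_iff_equal zero_index zero_neq_one)
      moreover have "tail = form_poly ?\<gamma>" using True by (simp add: tail_def)
      ultimately show ?thesis by (simp only: restr2 form_poly_eq_0) simp
    qed (simp add: tail_def restr_def)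
    ultimately show "restr \<alpha>2 (xf (?u 0)) (restr \<alpha>1 (xf (?u 1)) y3) \<noteq> 0"
      using prod_nz[OF fin1] by (simp add: y3_def restr_def sym_alg_mult_eq_0)
  qed
  define g where "g \<alpha> = (if \<alpha> = \<alpha>2 then G (?u 0) else 0)" for \<alpha>
  define \<eta>1 where "\<eta>1 i = (if i = x (?u 0) then y1 * G (?u 0) else 0)" for i
  define \<eta>3 where "\<eta>3 i = (if i = x (?u 0) then y3 * G (?u 0) else if i = x (?u 1) then y3 * G (?u 1) else 0)" for i
  define \<phi> where "\<phi> i = (if i = z \<or> (\<exists>v\<in>set us. i = x v) then 0 else Var i :: ('k, 'm) sym_alg)" for i
  have \<phi>x: "\<phi> (x i) = (if i \<in> set us then 0 else Var (x i))" if "i \<in> V" for i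
    using that usV by (auto simp: \<phi>_def subset_iff)
  have \<phi>z: "\<phi> z = 0" by (simp add: \<phi>_def)
  have local_cases: "P \<alpha>"
    if \<alpha>: "\<alpha> \<in> forms" "lin_ext \<phi> \<alpha> = 0" and Pz: "P (zf 1)"
      and Pe: "\<And>i. Suc i < ?n \<Longrightarrow> P (xf (?u i) - xf (?u (Suc i)))"
      and Pe': "\<And>i. Suc i < ?n \<Longrightarrow> P (xf (?u (Suc i)) - xf (?u i))"
      and Pa: "\<And>i c. i < ?n \<Longrightarrow> c \<in> \<psi> (?u i) \<Longrightarrow> P (xf (?u i) - zf c)" for \<alpha> P
    using \<alpha>(1)
  proof (cases rule: forms_cases)
    case 1
    then show ?thesis using Pz by simp
  next
    case (3 i c)
    have "i \<in> set us" using \<alpha>(2) 3(1) \<phi>z \<phi>x[OF 3(2)] Var_nonzero[of "x i"] by (auto split: if_splits)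
    then obtain k where "i = ?u k" "k < ?n" by (auto simp: in_set_conv_nth)
    then show ?thesis using Pa 3 by blast
  next
    case (2 i j)
    then have ij: "i \<in> V" "j \<in> V" "i \<noteq> j" using edgeD by blast+
    have "\<phi> (x i) = \<phi> (x j)" using \<alpha>(2) 2(1) by simp
    then have "i \<in> set us \<and> j \<in> set us"
      using \<phi>x[OF ij(1)] \<phi>x[OF ij(2)] Var_nonzero[of "x i"] Var_nonzero[of "x j"] Var_neq'[of "x i" "x j"] ij
      by (auto split: if_splits)
    then obtain p q where pq: "i = ?u p" "j = ?u q" "p < ?n" "q < ?n" by (auto simp: in_set_conv_nth)
    consider "p < q" | "q < p" using pq ij(3) by (metis linorder_neqE_nat)
    then show ?thesis
    proof cases
      case 1
      then have "q = Suc p" using ip pq 2(2) by blast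
      then show ?thesis using 2(1) pq Pe by blast
    next
      case b: 2
      then have "p = Suc q" using ip pq 2(2) E_comm by blast
      then show ?thesis using 2(1) pq Pe' by blast
    qed
  qed
  have \<alpha>2_eq: "xf (?u i) - zf c = \<alpha>2 \<longleftrightarrow> i = 0 \<and> c = a" if "i < ?n" for i c
  proof
    assume eq: "xf (?u i) - zf c = \<alpha>2"
    have "(xf (?u i) - zf c) $ x (?u i) = \<alpha>2 $ x (?u i)" "(xf (?u i) - zf c) $ z = \<alpha>2 $ z" using eq by simp_all
    then show "i = 0 \<and> c = a" using that n by (simp add: comp compz compxz \<alpha>2_def split: if_splits)
  qed (simp add: \<alpha>2_def)
  have \<alpha>2_comp: "\<alpha>2 $ x (?u i) = (if i = 0 then 1 else 0)" if "i < ?n" for i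
    using that n by (simp add: \<alpha>2_def comp compz)
  have ne\<alpha>2: "\<gamma> \<noteq> \<alpha>2" if "i < ?n" "\<gamma> $ x (?u i) \<noteq> (if i = 0 then 1 else 0)" for \<gamma> i
    using \<alpha>2_comp that by metis
  have gz: "g (zf 1) = 0" using ne\<alpha>2[of 0 "zf 1"] n by (simp add: g_def compz)
  have ge: "g (xf (?u i) - xf (?u (Suc i))) = 0" "g (xf (?u (Suc i)) - xf (?u i)) = 0" if "Suc i < ?n" for i
    using ne\<alpha>2[of "Suc i" "xf (?u i) - xf (?u (Suc i))"] ne\<alpha>2[of "Suc i" "xf (?u (Suc i)) - xf (?u i)"] that
    by (simp_all add: g_def comp)
  have ga: "g (xf (?u i) - zf c) = (if i = 0 \<and> c = a then G (?u 0) else 0)" if "i < ?n" for i c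
    using \<alpha>2_eq[OF that] by (simp add: g_def)
  have L_dvd_G: "L v c dvd G v" if "c \<in> \<psi> (?u 0)" "c \<noteq> a" for v c
    unfolding G_def using that fin0 by (intro dvd_prodI) auto
  have \<eta>1u: "\<eta>1 (x (?u i)) = (if i = 0 then y1 * G (?u 0) else 0)" if "i < ?n" for i
    using that n uV(1) u_eq by (simp add: \<eta>1_def)
  have \<eta>3u: "\<eta>3 (x (?u i)) = (if i = 0 then y3 * G (?u 0) else if i = 1 then y3 * G (?u 1) else 0)" if "i < ?n" for i
    using that n uV(1) u_eq by (simp add: \<eta>3_def)
  have \<eta>z: "\<eta>1 z = 0" "\<eta>3 z = 0" using n uV(1) by (simp_all add: \<eta>1_def \<eta>3_def)
  have swap: "form_poly (xf v - xf w) dvd q \<Longrightarrow> form_poly (xf w - xf v) dvd q" for v w q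
    using minus_dvd_iff[of "form_poly (xf v - xf w)" q] by simp
  have field1: "form_poly \<alpha> dvd lin_ext \<eta>1 \<alpha> - y1 * g \<alpha>" if "\<alpha> \<in> forms" "lin_ext \<phi> \<alpha> = 0" for \<alpha>
    using that
  proof (rule local_cases)
    show "form_poly (zf 1) dvd lin_ext \<eta>1 (zf 1) - y1 * g (zf 1)" by (simp add: gz \<eta>z)
    have edge: "form_poly (xf (?u i) - xf (?u (Suc i))) dvd \<eta>1 (x (?u i)) - \<eta>1 (x (?u (Suc i)))" if "Suc i < ?n" for i
      using that \<eta>1u[of i] \<eta>1u[of "Suc i"] swap[of "?u 1" "?u 0" y1] by (simp add: y1_def \<alpha>1_def dvd_mult2)
    fix i
    show "form_poly (xf (?u i) - xf (?u (Suc i))) dvd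
        lin_ext \<eta>1 (xf (?u i) - xf (?u (Suc i))) - y1 * g (xf (?u i) - xf (?u (Suc i)))" if "Suc i < ?n"
      using edge[OF that] ge[OF that] by simp
    show "form_poly (xf (?u (Suc i)) - xf (?u i)) dvd
        lin_ext \<eta>1 (xf (?u (Suc i)) - xf (?u i)) - y1 * g (xf (?u (Suc i)) - xf (?u i))" if "Suc i < ?n"
      using dvd_diff_swap[OF swap[OF edge[OF that]]] ge[OF that] by simp
    show "form_poly (xf (?u i) - zf c) dvd lin_ext \<eta>1 (xf (?u i) - zf c) - y1 * g (xf (?u i) - zf c)"
      if "i < ?n" "c \<in> \<psi> (?u i)" for c
      using that \<eta>1u[of i] ga[of i c] \<eta>z L_dvd_G[of c "?u 0", unfolded L_def] by (auto intro: dvd_mult)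
  qed
  have field2: "form_poly \<alpha> dvd lin_ext (\<lambda>i. 0) \<alpha> - y2 * g \<alpha>" for \<alpha>
    by (simp add: g_def y2_def lin_ext_def)
  have G_diff: "form_poly (xf (?u 0) - xf (?u 1)) dvd G (?u 0) - G (?u 1)"
    unfolding G_def by (rule dvd_prod_diff) (simp add: L_def)
  have field3: "form_poly \<alpha> dvd lin_ext \<eta>3 \<alpha> - y3 * g \<alpha>" if "\<alpha> \<in> forms" "lin_ext \<phi> \<alpha> = 0" for \<alpha>
    using that
  proof (rule local_cases)
    show "form_poly (zf 1) dvd lin_ext \<eta>3 (zf 1) - y3 * g (zf 1)" by (simp add: gz \<eta>z)
    have edge: "form_poly (xf (?u i) - xf (?u (Suc i))) dvd \<eta>3 (x (?u i)) - \<eta>3 (x (?u (Suc i)))" if i: "Suc i < ?n" for i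
    proof -
      consider "i = 0" | "i = 1" | "i > 1" by linarith
      then show ?thesis
      proof cases
        case 1
        have "\<eta>3 (x (?u 0)) - \<eta>3 (x (?u 1)) = y3 * (G (?u 0) - G (?u 1))"
          using n \<eta>3u[of 0] \<eta>3u[of 1] by (simp add: algebra_simps)
        then show ?thesis using G_diff dvd_mult 1 by simp
      next
        case 2
        then have "2 < ?n" using i by simp
        then have "form_poly (xf (?u 1) - xf (?u 2)) dvd y3" by (simp add: y3_def tail_def del: form_poly_simps)
        moreover have "\<eta>3 (x (?u 1)) - \<eta>3 (x (?u 2)) = y3 * G (?u 1)" using \<eta>3u[of 1] \<eta>3u[of 2] \<open>2 < ?n\<close> by simp
        ultimately show ?thesis using 2 by (simp add: numeral_2_eq_2 dvd_mult2 del: form_poly_simps)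
      next
        case 3
        then show ?thesis using i \<eta>3u[of i] \<eta>3u[of "Suc i"] by simp
      qed
    qed
    fix i
    show "form_poly (xf (?u i) - xf (?u (Suc i))) dvd
        lin_ext \<eta>3 (xf (?u i) - xf (?u (Suc i))) - y3 * g (xf (?u i) - xf (?u (Suc i)))" if "Suc i < ?n"
      using edge[OF that] ge[OF that] by simp
    show "form_poly (xf (?u (Suc i)) - xf (?u i)) dvd
        lin_ext \<eta>3 (xf (?u (Suc i)) - xf (?u i)) - y3 * g (xf (?u (Suc i)) - xf (?u i))" if "Suc i < ?n"
      using dvd_diff_swap[OF swap[OF edge[OF that]]] ge[OF that] by simp
    show "form_poly (xf (?u i) - zf c) dvd lin_ext \<eta>3 (xf (?u i) - zf c) - y3 * g (xf (?u i) - zf c)"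
      if i: "i < ?n" and c: "c \<in> \<psi> (?u i)" for c
    proof -
      have "lin_ext \<eta>3 (xf (?u i) - zf c) = \<eta>3 (x (?u i))" by (simp add: \<eta>z)
      moreover consider "i = 0" | "i = 1" "c \<in> \<psi> (?u 0)" | "i = 1" "c \<notin> \<psi> (?u 0)" | "i > 1" by linarith
      then have "form_poly (xf (?u i) - zf c) dvd \<eta>3 (x (?u i)) - y3 * g (xf (?u i) - zf c)"
      proof cases
        case 1
        then show ?thesis
          using c \<eta>3u[of 0] n ga[of 0 c] L_dvd_G[of c "?u 0", unfolded L_def]
          by (cases "c = a") (simp_all add: dvd_mult del: form_poly_simps)
      next
        case 2
        then have "c \<noteq> a" using a(2) c by blast
        then show ?thesis
          using 2 i \<eta>3u[of 1] ga[of 1 c] L_dvd_G[of c "?u 1", unfolded L_def] by (simp add: dvd_mult del: form_poly_simps)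
      next
        case 3
        then have "L (?u 1) c dvd y3" unfolding y3_def using c fin1 by (intro dvd_mult2 dvd_prodI) auto
        then show ?thesis using 3 i \<eta>3u[of 1] ga[of 1 c] by (simp add: dvd_mult2 L_def del: form_poly_simps)
      next
        case 4
        then show ?thesis using i \<eta>3u[of i] ga[of i c] by simp
      qed
      ultimately show ?thesis by simp
    qed
  qed
  obtain \<xi> h where h: "subst \<phi> h \<noteq> 0"
      and \<xi>: "\<forall>\<alpha>\<in>forms. lin_ext \<phi> \<alpha> = 0 \<longrightarrow> form_poly \<alpha> dvd lin_ext \<xi> \<alpha> - h * g \<alpha>"
    using free_saturated_local[OF free[unfolded arr_forms] zero_notin_forms finite_forms reg,
        of \<phi> \<eta>1 g "\<lambda>i. 0" \<eta>3] field1 field2 field3 by blast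
  have \<phi>u: "\<phi> (x (?u i)) = 0" if "i < ?n" for i using \<phi>x uV[OF that] by simp
  have "form_poly (zf 1) dvd \<xi> z" using \<xi> forms_mem(1) gz \<phi>z by fastforce
  then obtain e where e: "\<xi> z = Var z * e" by (auto elim: dvdE)
  \<comment> \<open>e times the Euler derivation is subtracted\<close>
  define D where "D i = \<xi> i - e * Var i" for i
  have D: "form_poly \<alpha> dvd lin_ext D \<alpha> - h * g \<alpha>" if "\<alpha> \<in> forms" "lin_ext \<phi> \<alpha> = 0" for \<alpha>
  proof -
    have "lin_ext D \<alpha> = lin_ext \<xi> \<alpha> - e * form_poly \<alpha>"
      using lin_ext_comb[of 1 \<xi> "- e" Var \<alpha>] by (simp add: D_def[abs_def] form_poly_lin_ext)
    then have eq: "lin_ext D \<alpha> - h * g \<alpha> = (lin_ext \<xi> \<alpha> - h * g \<alpha>) - e * form_poly \<alpha>" by simp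
    from dvd_diff[OF \<xi>[rule_format, OF that] dvd_triv_right] show ?thesis unfolding eq .
  qed
  have Dz: "D z = 0" by (simp add: D_def e mult.commute)
  have Da: "L (?u i) c dvd D (x (?u i)) - h * (if i = 0 \<and> c = a then G (?u 0) else 0)"
    if "i < ?n" "c \<in> \<psi> (?u i)" for i c
    using D[OF forms_mem(3)[OF uV(1)[OF that(1)] that(2)]] ga[OF that(1), of c] \<phi>u[OF that(1)] \<phi>z Dz by (simp add: L_def)
  have De: "form_poly (xf (?u i) - xf (?u (Suc i))) dvd D (x (?u i)) - D (x (?u (Suc i)))" if i: "Suc i < ?n" for i
  proof -
    have "{?u i, ?u (Suc i)} \<in> E" using ip i by blast
    from D[OF forms_mem(2)[OF this]] show ?thesis using ge(1)[OF i] \<phi>u[of i] \<phi>u[of "Suc i"] i by simp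
  qed
  have prime_L: "prime_elem (L v c)" if "v \<in> V" for v c
    unfolding L_def by (rule prime_elem_form_poly[OF form_nz[OF that]])
  have L_prop: "c = c'" if v: "v \<in> V" and t: "xf v - zf c' = t *s (xf v - zf c)" for v c c' t
  proof -
    have "(xf v - zf c') $ x v = t * (xf v - zf c) $ x v" "(xf v - zf c') $ z = t * (xf v - zf c) $ z"
      by (simp_all only: t vector_smult_component)
    then show ?thesis using v by (auto simp: axis_component)
  qed
  have L_ndvd: "\<not> L (?u 0) c dvd G (?u 0)" if "c \<notin> \<psi> (?u 0) - {a}" for c
  proof
    assume "L (?u 0) c dvd G (?u 0)"
    then obtain c' where c': "c' \<in> \<psi> (?u 0) - {a}" "L (?u 0) c dvd L (?u 0) c'"
      using prime_elem_dvd_prodD[OF fin0 prime_L[OF uV(1)[OF n(1)]]] unfolding G_def by blast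
    have "xf (?u 0) - zf c \<noteq> 0" by (rule form_nz[OF uV(1)[OF n(1)]])
    then obtain t where "xf (?u 0) - zf c' = t *s (xf (?u 0) - zf c)"
      using c'(2) form_poly_dvd_form_poly_iff unfolding L_def by blast
    then show False using L_prop[OF uV(1)[OF n(1)]] c'(1) that by metis
  qed
  have "G (?u 0) dvd D (x (?u 0))"
    unfolding G_def L_def
  proof (rule prod_form_poly_dvd_classwise)
    fix c assume c: "c \<in> \<psi> (?u 0) - {a}"
    show "xf (?u 0) - zf c \<noteq> 0" by (rule form_nz[OF uV(1)[OF n(1)]])
    have "\<exists>t. xf (?u 0) - zf c = t *s (xf (?u 0) - zf c)" by (rule exI[of _ 1]) simp
    then have "{c' \<in> \<psi> (?u 0) - {a}. \<exists>t. xf (?u 0) - zf c' = t *s (xf (?u 0) - zf c)} = {c}"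
      using c L_prop[OF uV(1)[OF n(1)]] by blast
    then show "(\<Prod>c'\<in>{c' \<in> \<psi> (?u 0) - {a}. \<exists>t. xf (?u 0) - zf c' = t *s (xf (?u 0) - zf c)}.
        form_poly (xf (?u 0) - zf c')) dvd D (x (?u 0))"
      using Da[of 0 c] n c by (simp add: L_def)
  qed (rule fin0)
  then obtain s where s: "D (x (?u 0)) = G (?u 0) * s" by blast
  have "L (?u 0) a dvd G (?u 0) * (s - h)" using Da[of 0 a] n a(1) by (simp add: s algebra_simps)
  then have "L (?u 0) a dvd s - h"
    using prime_L[OF uV(1)[OF n(1)]] L_ndvd[of a] by (simp add: prime_elem_dvd_mult_iff)
  then obtain r where r: "s - h = L (?u 0) a * r" by blast
  \<comment> \<open>\<open>\<pi>\<close> identifies the coordinates of the path, \<open>\<phi>\<close> restricts to the flat where they and z vanish\<close>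
  define \<pi> where "\<pi> i = (if \<exists>v\<in>set us. i = x v then Var (x (?u 0)) else Var i :: ('k, 'm) sym_alg)" for i
  have \<pi>u: "\<pi> (x (?u i)) = Var (x (?u 0))" if "i < ?n" for i using uV(2)[OF that] by (auto simp: \<pi>_def)
  have \<pi>z: "\<pi> z = Var z" using usV by (auto simp: \<pi>_def)
  have \<pi>L: "subst \<pi> (L (?u i) c) = L (?u 0) c" if "i < ?n" for i c
    unfolding L_def subst_form_poly using that by (simp add: \<pi>u \<pi>z)
  have \<pi>G: "subst \<pi> (G (?u 0)) = G (?u 0)" using \<pi>L[OF n(1)] by (simp add: G_def)
  have "subst \<pi> (D (x (?u i))) = subst \<pi> (D (x (?u 0)))" if "i < ?n" for i
    using that
  proof (induction i)
    case (Suc i)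
    obtain q where q: "D (x (?u i)) - D (x (?u (Suc i))) = form_poly (xf (?u i) - xf (?u (Suc i))) * q"
      using De[OF Suc.prems] by blast
    have "subst \<pi> (form_poly (xf (?u i) - xf (?u (Suc i)))) = 0"
      unfolding subst_form_poly using Suc.prems by (simp add: \<pi>u)
    then have "subst \<pi> (D (x (?u i)) - D (x (?u (Suc i)))) = 0" unfolding q subst_mult by simp
    then show ?case using Suc by simp
  qed simp
  then have ends: "subst \<pi> (D (x (?u (?n - 1)))) = G (?u 0) * subst \<pi> s" using n(3) by (simp add: s \<pi>G)
  have "(if ?n - 1 = 0 \<and> b = a then G (?u 0) else 0) = 0" using n by simp
  from Da[OF n(3) b(1), unfolded this] have "L (?u (?n - 1)) b dvd D (x (?u (?n - 1)))" by simp
  then obtain q where "D (x (?u (?n - 1))) = L (?u (?n - 1)) b * q" by blast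
  then have "G (?u 0) * subst \<pi> s = L (?u 0) b * subst \<pi> q" using ends \<pi>L[OF n(3)] by simp
  then have "L (?u 0) b dvd G (?u 0) * subst \<pi> s" by simp
  then have "L (?u 0) b dvd subst \<pi> s"
    using prime_L[OF uV(1)[OF n(1)]] L_ndvd[of b] b(2) by (simp add: prime_elem_dvd_mult_iff)
  then obtain r' where r': "subst \<pi> s = L (?u 0) b * r'" by blast
  have \<phi>L: "subst \<phi> (L (?u 0) c) = 0" for c unfolding L_def subst_form_poly using \<phi>u[OF n(1)] by (simp add: \<phi>z)
  have \<phi>\<pi>: "subst \<phi> (subst \<pi> p) = subst \<phi> p" for p
  proof -
    have "subst \<phi> (\<pi> i) = \<phi> i" for i using \<phi>u[OF n(1)] by (auto simp: \<pi>_def \<phi>_def)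
    then show ?thesis by (simp add: subst_subst)
  qed
  have "h = s - L (?u 0) a * r" using r by (simp add: algebra_simps)
  then have "subst \<phi> h = subst \<phi> (subst \<pi> s)" by (simp add: \<phi>L \<phi>\<pi>)
  also have "\<dots> = 0" by (simp add: r' \<phi>L)
  finally show False using h by simp
qed

text \<open>A valley path whose last weight contains some \<open>b\<close> that is missing in the inner
  weights is closed by \<open>b\<close> if \<open>b\<close> occurs in the first weight, and
  crosses otherwise.\<close>

theorem no_obstruction_if_free:
  assumes free: "free_arrangement arr"
  shows "\<not> has_incomparable_edge V E \<psi> \<and> \<not> has_valley_path V E \<psi>"
proof
  show "\<not> has_incomparable_edge V E \<psi>"
  proof
    assume "has_incomparable_edge V E \<psi>"
    then obtain u v a b where "induced_path V E [u, v]" "a \<in> \<psi> u" "a \<notin> \<psi> v" "b \<in> \<psi> v" "b \<notin> \<psi> u"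
      unfolding has_incomparable_edge_def by blast
    then show False using not_free_crossing_path[of "[u, v]" a b] free by simp
  qed
  show "\<not> has_valley_path V E \<psi>"
  proof
    assume "has_valley_path V E \<psi>"
    then obtain us where us: "induced_path V E us" "length us \<ge> 3" "\<psi> (us ! 1) \<subset> \<psi> (us ! 0)"
        "\<forall>j. 1 \<le> j \<and> j \<le> length us - 2 \<longrightarrow> \<psi> (us ! j) = \<psi> (us ! 1)"
        "\<psi> (us ! (length us - 2)) \<subset> \<psi> (us ! (length us - 1))"
      unfolding has_valley_path_def by blast
    obtain b where b: "b \<in> \<psi> (us ! (length us - 1))" "b \<notin> \<psi> (us ! (length us - 2))" using us(5) by blast
    show False
    proof (cases "b \<in> \<psi> (us ! 0)")
      case True
      have "b \<notin> \<psi> (us ! i)" if "0 < i" "Suc i < length us" for i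
      proof -
        have "1 \<le> i \<and> i \<le> length us - 2" using that us(2) by linarith
        then have "\<psi> (us ! i) = \<psi> (us ! 1)" by (rule us(4)[rule_format])
        also have "1 \<le> length us - 2 \<and> length us - 2 \<le> length us - 2" using us(2) by linarith
        then have "\<psi> (us ! 1) = \<psi> (us ! (length us - 2))" by (rule us(4)[rule_format, symmetric])
        finally show ?thesis using b(2) by simp
      qed
      then show False using not_free_closed_path[OF us(1,2) True b(1)] free by blast
    next
      case False
      obtain a where "a \<in> \<psi> (us ! 0)" "a \<notin> \<psi> (us ! 1)" using us(3) by blast
      then show False using not_free_crossing_path[OF us(1) _ _ _ b(1) False] us(2) free by simp
    qed
  qed
qed

end

section \<open>The characterization of freeness and supersolvability\<close>

theorem theorem1p4:
  fixes l :: nat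
    and z :: "'m::finite" and x :: "nat \<Rightarrow> 'm"
    and E :: "nat set set"
    and \<psi> :: "nat \<Rightarrow> 'k::field set"
  assumes coords: "bij_betw x {1..l} (UNIV - {z})"
    and graph: "E \<subseteq> nsets {1..l} 2"
    and fin: "\<And>i. i \<in> {1..l} \<Longrightarrow> finite (\<psi> i)"
  defines "\<A> \<equiv> psi_graphical_arrangement z x {1..l} E \<psi>"
  shows "((\<exists>vs. weighted_elimination_ordering {1..l} E \<psi> vs) \<longleftrightarrow> supersolvable_arrangement \<A>)
    \<and> (supersolvable_arrangement \<A> \<longleftrightarrow> free_arrangement \<A>)
    \<and> (free_arrangement \<A> \<longleftrightarrow>
         chordal E \<and> \<not> has_incomparable_edge {1..l} E \<psi> \<and> \<not> has_valley_path {1..l} E \<psi>)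
    \<and> (chordal E \<and> \<not> has_incomparable_edge {1..l} E \<psi> \<and> \<not> has_valley_path {1..l} E \<psi> \<longleftrightarrow>
         chordal E \<and> (\<forall>vs. induced_path {1..l} E vs \<longrightarrow> unimodal \<psi> vs))"
proof -
  interpret psi_graph z x "{1..l}" E \<psi>
  proof
    show "inj_on x {1..l}" using coords by (simp add: bij_betw_def)
    show "x i \<noteq> z" if "i \<in> {1..l}" for i using bij_betwE[OF coords] that by blast
    show "E \<subseteq> nsets {1..l} 2" by (rule graph)
    show "finite {1..l}" by simp
    show "finite (\<psi> i)" if "i \<in> {1..l}" for i using that by (rule fin)
  qed
  have arr: "arr = \<A>" unfolding arr_def \<A>_def by (rule refl)
  have 12: "supersolvable_arrangement \<A>" if "weighted_elimination_ordering {1..l} E \<psi> vs" for vs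
    using modular_ranking_if_ordering[OF that] supersolvable_if_modular_ranking[OF hyperplane_arrangement_arr]
    unfolding arr by blast
  have 23: "free_arrangement \<A>" if "supersolvable_arrangement \<A>"
    using modular_ranking_if_supersolvable[OF hyperplane_arrangement_arr] that
      free_if_modular_ranking[OF hyperplane_arrangement_arr]
    unfolding arr by blast
  have 34: "chordal E \<and> \<not> has_incomparable_edge {1..l} E \<psi> \<and> \<not> has_valley_path {1..l} E \<psi>"
    if "free_arrangement \<A>"
    using chordal_if_free no_obstruction_if_free that unfolding arr by blast
  have 41: "\<exists>vs. weighted_elimination_ordering {1..l} E \<psi> vs"
    if "chordal E" "\<not> has_incomparable_edge {1..l} E \<psi>" "\<not> has_valley_path {1..l} E \<psi>"
    using weighted_elimination_ordering_if_no_obstruction[OF graph _ that] by simp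
  show ?thesis
    using 12 23 34 41 unimodal_induced_paths_iff[OF graph, of \<psi>] by blast
qed

end
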